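(* Let $\mathsf{k}$ be a field and let $e,r,s,\delta,d$ be positive integers. For a finite simple graph $G$ write $S=\mathsf{k}[V(G)]$. Then: (a) There exists a finite simple graph $G$ with $e(S/I(G))=e$ and $\operatorname{reg}(S/I(G))=r$. (b) If $e\cdot s\ge2$, there exists a finite simple graph $G$ with $e(S/I(G))=e$ and $\deg(h_{S/I(G)}(t))=s$. (c) There exists a finite simple graph $G$ with $e(S/I(G))=e$ and $\operatorname{depth}(S/I(G))=\delta$. (d) If $e\cdot d\ge2$, there exists a finite simple graph $G$ with $e(S/I(G))=e$ and $\dim(S/I(G))=d$.
   Context: For a finite simple graph $G$ with vertex set $V(G)$ and edge set $E(G)$, the vertices are regarded as variables, $S=\mathsf{k}[V(G)]$ is the standard graded polynomial ring, and the edge ideal is $I(G)=(xy:\{x,y\}\in E(G))\subseteq S$. For a homogeneous ideal $I\subsetneq S$ with $\dim(S/I)=d$, the Hilbert series is $H(S/I,t)=h_{S/I}(t)/(1-t)^d$ with $h_{S/I}(t)=h_0+h_1t+\cdots+h_st^s\in\mathbb Z[t]$, $h_s\neq0$; $h_{S/I}(t)$ is the $h$-polynomial of $S/I$, and the multiplicity is $e(S/I)=h_{S/I}(1)$. The (Castelnuovo-Mumford) regularity is $\operatorname{reg}(S/I)=\max\{j:\operatorname{Tor}_i^S(S/I,\mathsf{k})_{i+j}\neq0\text{ for some }i\ge0\}$. *)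

theory Defs
  imports
    "HOL-Algebra.Embedded_Algebras"
    "HOL-Library.Poly_Mapping"
    "HOL-Library.Extended_Nat"
    "HOL-Computational_Algebra.Polynomial_FPS"
    "Jordan_Normal_Form.Matrix"
begin

section \<open>Polynomial rings and edge ideals\<close>

definition fin_simple_graph :: "'v set \<Rightarrow> 'v set set \<Rightarrow> bool" where
  "fin_simple_graph V E \<longleftrightarrow> finite V \<and> (\<forall>f\<in>E. f \<subseteq> V \<and> card f = 2)"

text \<open>A monomial is its finitely supported exponent function, and a polynomial is a finitely
  supported coefficient function on monomials. This type has variables \<open>x_v\<close> for all \<open>v :: 'v\<close>;
  the ring \<open>k[V]\<close> is the subring of those polynomials that only involve variables from \<open>V\<close>.\<close>

type_synonym ('v, 'k) mvpoly = "('v \<Rightarrow>\<^sub>0 nat) \<Rightarrow>\<^sub>0 'k"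

definition poly_ring :: "'v set \<Rightarrow> ('v, 'k::field) mvpoly ring" where
  "poly_ring V = \<lparr>carrier = {p. \<forall>m\<in>Poly_Mapping.keys p. Poly_Mapping.keys m \<subseteq> V},
     monoid.mult = (*), one = 1, zero = 0, add = (+)\<rparr>"

definition pvar :: "'v \<Rightarrow> ('v, 'k::field) mvpoly" where
  "pvar v = Poly_Mapping.single (Poly_Mapping.single v 1) 1"

definition pconst :: "'k \<Rightarrow> ('v, 'k::field) mvpoly" where
  "pconst c = Poly_Mapping.single 0 c"

definition edge_ideal :: "'v set \<Rightarrow> 'v set set \<Rightarrow> ('v, 'k::field) mvpoly set" where
  "edge_ideal V E = genideal (poly_ring V) {pvar x * pvar y | x y. {x, y} \<in> E}"

definition irrelevant_ideal :: "'v set \<Rightarrow> ('v, 'k::field) mvpoly set" where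
  "irrelevant_ideal V = genideal (poly_ring V) (pvar ` V)"

definition mon_degree :: "('v \<Rightarrow>\<^sub>0 nat) \<Rightarrow> nat" where
  "mon_degree m = (\<Sum>v\<in>Poly_Mapping.keys m. Poly_Mapping.lookup m v)"

text \<open>The graded component of \<open>k[V]\<close> of degree \<open>j\<close>; it is zero for negative \<open>j\<close>.\<close>

definition homog :: "'v set \<Rightarrow> int \<Rightarrow> ('v, 'k::field) mvpoly set" where
  "homog V j = {p \<in> carrier (poly_ring V). \<forall>m\<in>Poly_Mapping.keys p. int (mon_degree m) = j}"

section \<open>Krull dimension, Hilbert series, h-polynomial, multiplicity\<close>

definition krull_dim :: "('a, 'b) ring_scheme \<Rightarrow> enat" where
  "krull_dim R = Sup {enat n | n. \<exists>P. (\<forall>i\<le>n. primeideal (P i) R) \<and> (\<forall>i<n. P i \<subset> P (Suc i))}"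

text \<open>In the following, \<open>I\<close> is a proper homogeneous ideal of \<open>S = k[V]\<close>.
  The ring \<open>S/I\<close> contains the image \<open>K\<close> of the constants as a subfield, and the Hilbert function
  is the dimension over \<open>K\<close> of the image \<open>(S/I)_n\<close> of the graded component \<open>S_n\<close>.\<close>

definition quot_ring :: "'v set \<Rightarrow> ('v, 'k::field) mvpoly set \<Rightarrow> ('v, 'k) mvpoly set ring" where
  "quot_ring V I = poly_ring V Quot I"

definition quot_map :: "'v set \<Rightarrow> ('v, 'k::field) mvpoly set \<Rightarrow> ('v, 'k) mvpoly \<Rightarrow> ('v, 'k) mvpoly set" where
  "quot_map V I p = I +>\<^bsub>poly_ring V\<^esub> p"

definition hilbert_function :: "'v set \<Rightarrow> ('v, 'k::field) mvpoly set \<Rightarrow> nat \<Rightarrow> nat" where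
  "hilbert_function V I n =
     ring.dim (quot_ring V I) (quot_map V I ` range pconst) (quot_map V I ` homog V (int n))"

definition hilbert_series :: "'v set \<Rightarrow> ('v, 'k::field) mvpoly set \<Rightarrow> int fps" where
  "hilbert_series V I = Abs_fps (\<lambda>n. int (hilbert_function V I n))"

text \<open>The equation \<open>H(S/I,t) = h(t) / (1-t)^d\<close> with \<open>d = dim (S/I)\<close>, with the denominator cleared.\<close>

definition h_poly :: "'v set \<Rightarrow> ('v, 'k::field) mvpoly set \<Rightarrow> int poly" where
  "h_poly V I = (THE h. hilbert_series V I * (1 - fps_X) ^ the_enat (krull_dim (quot_ring V I))
     = fps_of_poly h)"

definition hilbert_multiplicity :: "'v set \<Rightarrow> ('v, 'k::field) mvpoly set \<Rightarrow> int" where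
  "hilbert_multiplicity V I = poly (h_poly V I) 1"

section \<open>Depth\<close>

text \<open>\<open>fs\<close> is an \<open>M\<close>-regular sequence for the \<open>R\<close>-module \<open>M = R/I\<close>: each \<open>fs ! i\<close> is a
  nonzerodivisor on \<open>M/(fs ! 0, \<dots>, fs ! (i-1))M\<close>, and \<open>M/(fs)M\<close> is nonzero.\<close>

definition regular_sequence_quot :: "('a, 'b) ring_scheme \<Rightarrow> 'a set \<Rightarrow> 'a list \<Rightarrow> bool" where
  "regular_sequence_quot R I fs \<longleftrightarrow>
     set fs \<subseteq> carrier R \<and>
     (\<forall>i<length fs. \<forall>g\<in>carrier R.
        fs ! i \<otimes>\<^bsub>R\<^esub> g \<in> genideal R (I \<union> set (take i fs)) \<longrightarrow> g \<in> genideal R (I \<union> set (take i fs))) \<and>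
     genideal R (I \<union> set fs) \<noteq> carrier R"

definition depth_quot :: "'v set \<Rightarrow> ('v, 'k::field) mvpoly set \<Rightarrow> enat" where
  "depth_quot V I = Sup {enat (length fs) | fs.
     set fs \<subseteq> irrelevant_ideal V \<and> regular_sequence_quot (poly_ring V) I fs}"

section \<open>Graded free resolutions, Tor, regularity\<close>

text \<open>The graded free module \<open>F = S(-a_1) \<oplus> \<dots> \<oplus> S(-a_n)\<close> is given by its list of shifts
  \<open>[a_1, \<dots>, a_n]\<close>. We describe \<open>F\<close>, its submodule \<open>mF\<close> (\<open>m\<close> the irrelevant ideal), and its
  graded component \<open>F_j\<close>.\<close>

definition free_mod :: "'v set \<Rightarrow> int list \<Rightarrow> ('v, 'k::field) mvpoly vec set" where
  "free_mod V a = {u \<in> carrier_vec (length a). \<forall>b<length a. u $ b \<in> carrier (poly_ring V)}"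

definition free_mod_irr :: "'v set \<Rightarrow> int list \<Rightarrow> ('v, 'k::field) mvpoly vec set" where
  "free_mod_irr V a = {u \<in> carrier_vec (length a). \<forall>b<length a. u $ b \<in> irrelevant_ideal V}"

definition free_mod_piece :: "'v set \<Rightarrow> int list \<Rightarrow> int \<Rightarrow> ('v, 'k::field) mvpoly vec set" where
  "free_mod_piece V a j = {u \<in> carrier_vec (length a). \<forall>b<length a. u $ b \<in> homog V (j - a ! b)}"

text \<open>An exact complex \<open>\<dots> \<rightarrow> F_2 \<rightarrow> F_1 \<rightarrow> F_0 \<rightarrow> S/I \<rightarrow> 0\<close> of finitely generated graded free modules
  and degree-preserving maps: \<open>F_i\<close> has shifts \<open>a i\<close>, the matrix \<open>D i\<close> represents
  \<open>F_{i+1} \<rightarrow> F_i\<close>, and the row vector \<open>\<epsilon>\<close> represents a lift \<open>F_0 \<rightarrow> S\<close> of the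
  augmentation \<open>F_0 \<rightarrow> S/I\<close>.\<close>

definition graded_free_resolution ::
  "'v set \<Rightarrow> ('v, 'k::field) mvpoly set \<Rightarrow> (nat \<Rightarrow> int list) \<Rightarrow> ('v, 'k) mvpoly vec
     \<Rightarrow> (nat \<Rightarrow> ('v, 'k) mvpoly mat) \<Rightarrow> bool" where
  "graded_free_resolution V I a \<epsilon> D \<longleftrightarrow>
     \<epsilon> \<in> carrier_vec (length (a 0)) \<and>
     (\<forall>b<length (a 0). \<epsilon> $ b \<in> homog V (a 0 ! b)) \<and>
     (\<forall>i. D i \<in> carrier_mat (length (a i)) (length (a (Suc i))) \<and>
        (\<forall>b<length (a i). \<forall>c<length (a (Suc i)). D i $$ (b, c) \<in> homog V (a (Suc i) ! c - a i ! b))) \<and>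
     (\<lambda>u. quot_map V I (\<epsilon> \<bullet> u)) ` free_mod V (a 0) = carrier (quot_ring V I) \<and>
     {u \<in> free_mod V (a 0). quot_map V I (\<epsilon> \<bullet> u) = \<zero>\<^bsub>quot_ring V I\<^esub>}
       = (\<lambda>w. D 0 *\<^sub>v w) ` free_mod V (a 1) \<and>
     (\<forall>i. {u \<in> free_mod V (a (Suc i)). D i *\<^sub>v u = 0\<^sub>v (length (a i))}
       = (\<lambda>w. D (Suc i) *\<^sub>v w) ` free_mod V (a (Suc (Suc i))))"

text \<open>\<open>Tor_i(S/I, k)_j \<noteq> 0\<close>, where \<open>k = S/m\<close>. Here \<open>Tor_i(S/I, k)\<close> is the \<open>i\<close>-th homology of
  \<open>F \<otimes> k = F/mF\<close> for a graded free resolution \<open>F\<close> of \<open>S/I\<close>; the result does not depend on \<open>F\<close>.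
  The vector \<open>u \<in> (F_i)_j\<close> represents a cycle of \<open>F/mF\<close> that is not a boundary.\<close>

definition tor_nonzero :: "'v set \<Rightarrow> ('v, 'k::field) mvpoly set \<Rightarrow> nat \<Rightarrow> int \<Rightarrow> bool" where
  "tor_nonzero V I i j \<longleftrightarrow>
     (\<exists>a \<epsilon> D. graded_free_resolution V I a \<epsilon> D \<and>
       (\<exists>u \<in> free_mod_piece V (a i) j.
          (case i of 0 \<Rightarrow> True | Suc l \<Rightarrow> D l *\<^sub>v u \<in> free_mod_irr V (a l)) \<and>
          \<not> (\<exists>w \<in> free_mod V (a (Suc i)). u - D i *\<^sub>v w \<in> free_mod_irr V (a i))))"

definition regularity :: "'v set \<Rightarrow> ('v, 'k::field) mvpoly set \<Rightarrow> int" where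
  "regularity V I = (GREATEST j. \<exists>i. tor_nonzero V I i (int i + j))"

end

theory Submission
  imports Defs "HOL-Library.Nat_Bijection"
begin

text \<open>All graphs are disjoint unions of complete multipartite graphs. An independent set of maximal size
  picks a largest part in every component, so the multiplicity is the product of the numbers of
  largest parts. Part (a) uses a component with \<open>e\<close> parts of size 2 and a singleton part, and \<open>r - 1\<close>
  copies of \<open>K_{1,2}\<close>; part (b) uses \<open>e\<close> parts of size \<open>s\<close>, with an extra singleton part if \<open>s > 1\<close>, where
  the top coefficient of the h-polynomial is an Euler characteristic; parts (c) and (d) use \<open>K_e\<close>
  with isolated vertices, for which the isolated vertices and the sum of the remaining ones form
  a regular sequence.

  The dimension and the depth are at most the size of a largest independent set because both a
  chain of primes and a regular sequence give elements whose power products are linearly independent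
  modulo \<open>I\<close>, too many for the Hilbert function. For the upper bound on the regularity, a zigzag in
  the tensor product of an arbitrary graded free resolution with the Koszul complex moves a
  Tor class to the Koszul homology of \<open>S/I\<close>, which is bounded by induction on the vertices through
  \<open>I : x\<close> and \<open>(I, x)\<close>. For the lower bound, an induced matching is a Tor class of the
  Taylor resolution.\<close>

section \<open>Monomial ideals of simplicial complexes\<close>

text \<open>\<open>tor_nonzero\<close> asks for some graded free resolution, minimal or not, and
  \<open>regularity\<close> is a greatest element. An upper bound must therefore cope with every
  resolution, while a lower bound needs just one; Taylor's is explicit and works although it need
  not be minimal.

  Every component beyond the first has exactly one largest part, so it changes the dimension or the
  regularity without touching the multiplicity. A component with an edge adds 1 to the regularity,
  whatever the sizes of its parts; the singleton part in (a) provides an edge also when e = 1. In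
  (b) a second part is needed because with a single part the ideal is zero and h = 1. If s = 1, an
  additional singleton would count as a largest part, and there e s >= 2 supplies the second part.
  In (c) and (d) depth and dimension agree, so one family of graphs serves both.

  Edge ideals enter only through the supports of monomials. Adding a variable to the ideal or taking
  a colon by it then becomes an operation on simplicial complexes, with the polynomial ring kept
  fixed.\<close>

abbreviation keys where "keys \<equiv> Poly_Mapping.keys"
abbreviation lookup where "lookup \<equiv> Poly_Mapping.lookup"
abbreviation single where "single \<equiv> Poly_Mapping.single"

text \<open>The first rule turns carrier membership into a condition on supports. It is switched off
  wherever membership has to stay opaque for the closure lemmas to apply.\<close>

lemma poly_ring_simps [simp]:
  "p \<in> carrier (poly_ring V) \<longleftrightarrow> (\<forall>m\<in>keys p. keys m \<subseteq> V)"
  "p \<otimes>\<^bsub>poly_ring V\<^esub> q = p * q" "p \<oplus>\<^bsub>poly_ring V\<^esub> q = p + q"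
  "\<one>\<^bsub>poly_ring V\<^esub> = 1" "\<zero>\<^bsub>poly_ring V\<^esub> = 0"
  by (simp_all add: poly_ring_def)

lemma keys_add_nat: "keys (m + n :: 'v \<Rightarrow>\<^sub>0 nat) = keys m \<union> keys n"
  by (auto simp: in_keys_iff lookup_add)

lemma lookup_single_mult_add:
  fixes t :: "'v \<Rightarrow>\<^sub>0 nat" and p :: "('v, 'k::field) mvpoly"
  shows "lookup (single t c * p) (t + m) = c * lookup p m"
proof -
  have "lookup (single t c * p) (t + m) = (\<Sum>l. (c when t = l) * (\<Sum>q. lookup p q when t + m = l + q))"
    by (simp add: lookup_mult lookup_single)
  also have "\<dots> = c * (\<Sum>q. lookup p q when t + m = t + q)"
    by (simp add: when_mult)
  also have "\<dots> = c * lookup p m" by simp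
  finally show ?thesis .
qed

lemma lookup_single_mult_not:
  fixes t :: "'v \<Rightarrow>\<^sub>0 nat" and p :: "('v, 'k::field) mvpoly"
  assumes "\<And>n. m \<noteq> t + n"
  shows "lookup (single t c * p) m = 0"
  using assms by (simp add: lookup_mult lookup_single when_mult)

lemma keys_single_mult:
  fixes t :: "'v \<Rightarrow>\<^sub>0 nat" and p :: "('v, 'k::field) mvpoly"
  assumes "c \<noteq> 0"
  shows "keys (single t c * p) = (+) t ` keys p"
proof (rule Set.set_eqI)
  fix m
  show "m \<in> keys (single t c * p) \<longleftrightarrow> m \<in> (+) t ` keys p"
  proof (cases "\<exists>n. m = t + n")
    case True
    then obtain n where "m = t + n" by blast
    then show ?thesis using assms by (auto simp: in_keys_iff lookup_single_mult_add)
  next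
    case False
    then show ?thesis by (auto simp: in_keys_iff lookup_single_mult_not)
  qed
qed

lemma poly_sum_singles:
  fixes p :: "'a \<Rightarrow>\<^sub>0 'b::comm_monoid_add"
  shows "p = (\<Sum>m\<in>keys p. single m (lookup p m))"
proof (rule poly_mapping_eqI)
  fix k
  show "lookup p k = lookup (\<Sum>m\<in>keys p. single m (lookup p m)) k"
    by (cases "k \<in> keys p")
       (auto simp: lookup_sum lookup_single when_def in_keys_iff sum.delta)
qed

text \<open>The linear projection onto the span of the monomials satisfying \<open>P\<close>. It
  serves three purposes: reduction modulo a monomial ideal, setting variables to zero, and taking
  homogeneous components.\<close>

definition pfilter :: "('a \<Rightarrow> bool) \<Rightarrow> ('a \<Rightarrow>\<^sub>0 'b::zero) \<Rightarrow> ('a \<Rightarrow>\<^sub>0 'b)" where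
  "pfilter P p = Abs_poly_mapping (\<lambda>m. if P m then lookup p m else 0)"

lemma lookup_pfilter: "lookup (pfilter P p) m = (if P m then lookup p m else 0)"
proof -
  have "finite {m. (if P m then lookup p m else 0) \<noteq> 0}"
    by (rule finite_subset[of _ "keys p"]) (auto simp: in_keys_iff split: if_splits)
  then show ?thesis unfolding pfilter_def by simp
qed

lemma keys_pfilter: "keys (pfilter P p) = {m\<in>keys p. P m}"
  by (auto simp: in_keys_iff lookup_pfilter split: if_splits)

lemma pfilter_add: "pfilter P (p + q) = pfilter P p + pfilter P (q :: 'a \<Rightarrow>\<^sub>0 'b::monoid_add)"
  by (rule poly_mapping_eqI) (simp add: lookup_pfilter lookup_add)

lemma pfilter_zero [simp]: "pfilter P 0 = 0"
  by (rule poly_mapping_eqI) (simp add: lookup_pfilter)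

lemma pfilter_sum: "pfilter P (\<Sum>i\<in>A. f i) = (\<Sum>i\<in>A. pfilter P (f i :: 'a \<Rightarrow>\<^sub>0 'b::comm_monoid_add))"
  by (induct A rule: infinite_finite_induct) (auto simp: pfilter_add)

lemma pfilter_single: "pfilter P (single m c) = (if P m then single m c else 0)"
  by (rule poly_mapping_eqI) (auto simp: lookup_pfilter lookup_single when_def)

lemma pfilter_split: "p = pfilter P p + pfilter (\<lambda>m. \<not> P m) (p :: 'a \<Rightarrow>\<^sub>0 'b::monoid_add)"
  by (rule poly_mapping_eqI) (simp add: lookup_pfilter lookup_add)

lemma keys_add_subset: "keys p \<subseteq> A \<Longrightarrow> keys q \<subseteq> A \<Longrightarrow> keys (p + q) \<subseteq> A"
  by (meson Poly_Mapping.keys_add order_trans le_sup_iff)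

lemma keys_mult_elem:
  fixes p q :: "('v, 'k::field) mvpoly"
  assumes "m \<in> keys (p * q)"
  obtains a b where "a \<in> keys p" "b \<in> keys q" "m = a + b"
  using subsetD[OF keys_mult assms] by blast

lemma carrier_closed:
  fixes p q :: "('v, 'k::field) mvpoly"
  assumes "p \<in> carrier (poly_ring V)" "q \<in> carrier (poly_ring V)"
  shows "p + q \<in> carrier (poly_ring V)" "p * q \<in> carrier (poly_ring V)"
    "- p \<in> carrier (poly_ring V)" "p - q \<in> carrier (poly_ring V)"
proof -
  show "p + q \<in> carrier (poly_ring V)"
    using assms subsetD[OF Poly_Mapping.keys_add, of _ p q] by auto
  show "p * q \<in> carrier (poly_ring V)"
    using assms by (fastforce elim!: keys_mult_elem simp: keys_add_nat)
  show "- p \<in> carrier (poly_ring V)"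
    using assms(1) by (simp add: in_keys_iff)
  show "p - q \<in> carrier (poly_ring V)"
    using assms subsetD[OF keys_diff, of _ p q] by auto
qed

section \<open>The polynomial ring as an abstract ring, and its ideals\<close>

lemma cring_poly_ring: "cring (poly_ring V :: ('v, 'k::field) mvpoly ring)"
proof (rule cringI)
  show "abelian_group (poly_ring V :: ('v, 'k::field) mvpoly ring)"
  proof (rule abelian_groupI)
    fix p :: "('v, 'k) mvpoly"
    assume "p \<in> carrier (poly_ring V)"
    then show "\<exists>q\<in>carrier (poly_ring V). q \<oplus>\<^bsub>poly_ring V\<^esub> p = \<zero>\<^bsub>poly_ring V\<^esub>"
      using carrier_closed(3)[of p V] by (intro bexI[of _ "- p"]) simp_all
  qed (use carrier_closed(1) in \<open>auto simp del: poly_ring_simps(1)\<close>, auto simp: algebra_simps)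
  show "comm_monoid (poly_ring V :: ('v, 'k::field) mvpoly ring)"
    by (rule comm_monoidI)
       (use carrier_closed(2) in \<open>auto simp del: poly_ring_simps(1) simp: algebra_simps\<close>, simp)
qed (simp add: algebra_simps)

lemma ring_poly_ring: "ring (poly_ring V :: ('v, 'k::field) mvpoly ring)"
  using cring_poly_ring cring.axioms(1) by blast

lemma poly_ring_a_inv: "p \<in> carrier (poly_ring V) \<Longrightarrow> \<ominus>\<^bsub>poly_ring V\<^esub> p = - (p :: ('v, 'k::field) mvpoly)"
proof -
  interpret cring "poly_ring V :: ('v, 'k) mvpoly ring" by (rule cring_poly_ring)
  assume p: "p \<in> carrier (poly_ring V)"
  have "- p \<oplus>\<^bsub>poly_ring V\<^esub> p = \<zero>\<^bsub>poly_ring V\<^esub>" by simp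
  then show ?thesis using minus_equality p carrier_closed(3)[OF p p] by blast
qed

lemma ideal_poly_ringI:
  fixes J :: "('v, 'k::field) mvpoly set"
  assumes "J \<subseteq> carrier (poly_ring V)" "0 \<in> J" "\<And>p q. p \<in> J \<Longrightarrow> q \<in> J \<Longrightarrow> p + q \<in> J"
    and "\<And>p q. p \<in> J \<Longrightarrow> q \<in> carrier (poly_ring V) \<Longrightarrow> q * p \<in> J"
  shows "ideal J (poly_ring V)"
proof (rule idealI[OF ring_poly_ring])
  interpret cring "poly_ring V :: ('v, 'k) mvpoly ring" by (rule cring_poly_ring)
  show "subgroup J (add_monoid (poly_ring V))"
  proof (rule add.subgroupI)
    fix p assume p: "p \<in> J"
    have "(- 1) * p \<in> J" using assms(4)[OF p, of "- 1"] by (simp add: in_keys_iff lookup_one)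
    then show "\<ominus>\<^bsub>poly_ring V\<^esub> p \<in> J" using p assms(1) poly_ring_a_inv[of p V] by auto
  qed (use assms in auto)
  show "x \<otimes>\<^bsub>poly_ring V\<^esub> a \<in> J" "a \<otimes>\<^bsub>poly_ring V\<^esub> x \<in> J"
    if "a \<in> J" "x \<in> carrier (poly_ring V)" for a x
    using assms(4)[OF that] by (simp_all add: mult.commute)
qed

lemma ideal_poly_ringD:
  fixes J :: "('v, 'k::field) mvpoly set"
  assumes "ideal J (poly_ring V)"
  shows "J \<subseteq> carrier (poly_ring V)" "0 \<in> J" "\<And>p q. p \<in> J \<Longrightarrow> q \<in> J \<Longrightarrow> p + q \<in> J"
    "\<And>p q. p \<in> J \<Longrightarrow> q \<in> carrier (poly_ring V) \<Longrightarrow> q * p \<in> J" "\<And>p. p \<in> J \<Longrightarrow> - p \<in> J"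
    "\<And>p q. p \<in> J \<Longrightarrow> q \<in> J \<Longrightarrow> p - q \<in> J"
proof -
  interpret ideal J "poly_ring V" by fact
  show 1: "J \<subseteq> carrier (poly_ring V)" using a_subset .
  show "0 \<in> J" using additive_subgroup.zero_closed[OF additive_subgroup_axioms] by simp
  show 2: "p \<in> J \<Longrightarrow> q \<in> J \<Longrightarrow> p + q \<in> J" for p q using additive_subgroup.a_closed[OF additive_subgroup_axioms] by simp
  show "p \<in> J \<Longrightarrow> q \<in> carrier (poly_ring V) \<Longrightarrow> q * p \<in> J" for p q using I_l_closed by simp
  show 3: "- p \<in> J" if "p \<in> J" for p
    using additive_subgroup.a_inv_closed[OF additive_subgroup_axioms that]
      poly_ring_a_inv[OF subsetD[OF 1 that]] by argo
  show "p \<in> J \<Longrightarrow> q \<in> J \<Longrightarrow> p - q \<in> J" for p q using 2[of p "- q"] 3 by simp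
qed

lemma ideal_sum_closed:
  fixes J :: "('v, 'k::field) mvpoly set"
  assumes "ideal J (poly_ring V)" "\<And>i. i \<in> A \<Longrightarrow> f i \<in> J"
  shows "(\<Sum>i\<in>A. f i) \<in> J"
  using assms(2) by (induct A rule: infinite_finite_induct) (simp_all add: ideal_poly_ringD(2,3)[OF assms(1)])

lemma ideal_monomialsI:
  fixes J :: "('v, 'k::field) mvpoly set"
  assumes "ideal J (poly_ring V)" "\<And>m. m \<in> keys p \<Longrightarrow> single m 1 \<in> J"
  shows "p \<in> J"
proof -
  have "single m (lookup p m) \<in> J" if "m \<in> keys p" for m
  proof -
    have "single 0 (lookup p m) * single m 1 \<in> J"
      by (rule ideal_poly_ringD(4)[OF assms(1) assms(2)[OF that]]) auto
    then show ?thesis by (simp add: mult_single)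
  qed
  then show ?thesis by (subst poly_sum_singles) (auto intro: ideal_sum_closed[OF assms(1)])
qed

definition complex :: "'v set \<Rightarrow> 'v set set \<Rightarrow> bool" where
  "complex V \<Delta> \<longleftrightarrow> \<Delta> \<subseteq> Pow V \<and> (\<forall>F\<in>\<Delta>. \<forall>G\<subseteq>F. G \<in> \<Delta>)"

lemma complexD: "complex V \<Delta> \<Longrightarrow> F \<in> \<Delta> \<Longrightarrow> G \<subseteq> F \<Longrightarrow> G \<in> \<Delta>"
  by (auto simp: complex_def)

text \<open>The Stanley-Reisner ideal, given by its monomials instead of generators. Elements of
  \<open>V\<close> that are not vertices of the complex give variables in the ideal, so smaller
  complexes need no smaller ring. The complex without faces gives the whole ring.\<close>

definition sr_ideal :: "'v set \<Rightarrow> 'v set set \<Rightarrow> ('v, 'k::field) mvpoly set" where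
  "sr_ideal V \<Delta> = {p \<in> carrier (poly_ring V). \<forall>m\<in>keys p. keys m \<notin> \<Delta>}"

lemma ideal_sr: "complex V \<Delta> \<Longrightarrow> ideal (sr_ideal V \<Delta> :: ('v, 'k::field) mvpoly set) (poly_ring V)"
proof (rule ideal_poly_ringI)
  assume c: "complex V \<Delta>"
  fix p q :: "('v, 'k) mvpoly"
  assume p: "p \<in> sr_ideal V \<Delta>"
  { assume "q \<in> sr_ideal V \<Delta>"
    then have "m \<in> keys p \<union> keys q \<Longrightarrow> keys m \<notin> \<Delta> \<and> keys m \<subseteq> V" for m
      using p by (auto simp: sr_ideal_def)
    then show "p + q \<in> sr_ideal V \<Delta>"
      using subsetD[OF Poly_Mapping.keys_add[of p q]] by (auto simp: sr_ideal_def) }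
  { assume q: "q \<in> carrier (poly_ring V)"
    then have "keys m \<notin> \<Delta>" if "m \<in> keys (q * p)" for m
      using that p complexD[OF c] by (fastforce elim!: keys_mult_elem simp: keys_add_nat sr_ideal_def)
    then show "q * p \<in> sr_ideal V \<Delta>"
      using carrier_closed(2)[OF q, of p] p by (simp add: sr_ideal_def) }
qed (auto simp: sr_ideal_def)

definition sqfree :: "'v set \<Rightarrow> 'v \<Rightarrow>\<^sub>0 nat" where
  "sqfree S = (\<Sum>v\<in>S. single v 1)"

lemma lookup_sqfree: "finite S \<Longrightarrow> lookup (sqfree S) v = (if v \<in> S then 1 else 0)"
  by (simp add: sqfree_def lookup_sum lookup_single when_def sum.delta)

lemma keys_sqfree [simp]: "finite S \<Longrightarrow> keys (sqfree S) = S"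
  by (auto simp: in_keys_iff lookup_sqfree split: if_splits)

lemma sqfree_dvd_iff:
  assumes "finite S"
  shows "(\<exists>n. m = sqfree S + n) \<longleftrightarrow> S \<subseteq> keys m"
proof
  assume S: "S \<subseteq> keys m"
  have "m = sqfree S + (m - sqfree S)"
  proof (rule poly_mapping_eqI)
    fix k
    have "k \<in> S \<Longrightarrow> lookup m k \<noteq> 0" using S by (auto simp: in_keys_iff)
    then show "lookup m k = lookup (sqfree S + (m - sqfree S)) k"
      using assms by (simp add: lookup_add lookup_minus lookup_sqfree)
  qed
  then show "\<exists>n. m = sqfree S + n" ..
qed (use assms in \<open>auto simp: keys_add_nat\<close>)

lemma sqfree_minus_add: "finite S \<Longrightarrow> S \<subseteq> keys m \<Longrightarrow> sqfree S + (m - sqfree S) = m"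
  using sqfree_dvd_iff[of S m] by fastforce

lemma sqfree_single: "sqfree {v} = single v 1"
  by (simp add: sqfree_def)

lemma pvar_sqfree: "pvar v = single (sqfree {v}) 1"
  by (simp add: pvar_def sqfree_single)

lemma pvar_in_carrier: "v \<in> V \<Longrightarrow> pvar v \<in> carrier (poly_ring V)"
  by (simp add: pvar_def)

lemma ideal_single_sqfree_dvd:
  fixes J :: "('v, 'k::field) mvpoly set"
  assumes "ideal J (poly_ring V)" "single (sqfree S) 1 \<in> J" "finite S" "S \<subseteq> keys m" "keys m \<subseteq> V"
  shows "single m 1 \<in> J"
proof -
  obtain n where n: "m = sqfree S + n" using sqfree_dvd_iff[of S m] assms by blast
  have "single n 1 * single (sqfree S) (1::'k) \<in> J"
    by (rule ideal_poly_ringD(4)[OF assms(1,2)]) (use assms(5) n in \<open>auto simp: keys_add_nat\<close>)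
  then show ?thesis by (simp add: mult_single n add.commute)
qed

definition independent_sets :: "'v set \<Rightarrow> 'v set set \<Rightarrow> 'v set set" where
  "independent_sets V E = {F. F \<subseteq> V \<and> (\<forall>e\<in>E. \<not> e \<subseteq> F)}"

lemma complex_independent_sets: "complex V (independent_sets V E)"
  by (auto simp: complex_def independent_sets_def)

lemma genideal_ideal_poly: "A \<subseteq> carrier (poly_ring V) \<Longrightarrow> ideal (genideal (poly_ring V) A) (poly_ring V)"
  using ring.genideal_ideal[OF ring_poly_ring] .

lemma genideal_self_poly: "A \<subseteq> carrier (poly_ring V) \<Longrightarrow> A \<subseteq> genideal (poly_ring V) A"
  using ring.genideal_self[OF ring_poly_ring] .

lemma genideal_minimal_poly: "ideal I (poly_ring V) \<Longrightarrow> A \<subseteq> I \<Longrightarrow> genideal (poly_ring V) A \<subseteq> I"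
  using ring.genideal_minimal[OF ring_poly_ring] .

text \<open>A monomial is divisible by the product of the ends of an edge iff its support contains
  the edge, and the sets containing no edge are the independent ones.\<close>

lemma edge_ideal_eq_sr:
  assumes "fin_simple_graph V E"
  shows "edge_ideal V E = (sr_ideal V (independent_sets V E) :: ('v, 'k::field) mvpoly set)"
proof -
  let ?G = "{pvar x * pvar y | x y. {x, y} \<in> E} :: ('v, 'k) mvpoly set"
  have gen: "?G = (\<lambda>e. single (sqfree e) 1) ` E"
  proof -
    have 1: "pvar x * pvar y = (single (sqfree {x, y}) 1 :: ('v, 'k) mvpoly)" if "{x, y} \<in> E" for x y
    proof -
      have "x \<noteq> y" using assms that by (auto simp: fin_simple_graph_def)
      then show ?thesis by (simp add: pvar_def mult_single sqfree_def)
    qed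
    have "\<exists>x y. e = {x, y}" if "e \<in> E" for e
    proof -
      have "card e = 2" using assms that by (simp add: fin_simple_graph_def)
      then show ?thesis by (metis card_2_iff)
    qed
    note 2 = this
    show ?thesis
    proof
      show "?G \<subseteq> (\<lambda>e. single (sqfree e) 1) ` E" using 1 by blast
      show "(\<lambda>e. single (sqfree e) 1) ` E \<subseteq> ?G"
      proof
        fix p :: "('v, 'k) mvpoly" assume "p \<in> (\<lambda>e. single (sqfree e) 1) ` E"
        then obtain e where e: "e \<in> E" "p = single (sqfree e) 1" by blast
        then obtain x y where "e = {x, y}" using 2 by blast
        then have "p = pvar x * pvar y \<and> {x, y} \<in> E" using 1[of x y] e by simp
        then show "p \<in> ?G" by blast
      qed
    qed
  qed
  have fin: "finite e" "e \<subseteq> V" "e \<noteq> {}" if "e \<in> E" for e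
    using assms that by (auto simp: fin_simple_graph_def card_eq_0_iff[symmetric])
       (metis card.infinite zero_neq_numeral)
  have sub: "?G \<subseteq> carrier (poly_ring V)" unfolding gen using fin by auto
  have id: "ideal (genideal (poly_ring V) ?G) (poly_ring V)" using genideal_ideal_poly[OF sub] .
  show ?thesis
  proof
    show "edge_ideal V E \<subseteq> (sr_ideal V (independent_sets V E) :: ('v, 'k) mvpoly set)"
      unfolding edge_ideal_def
      by (rule genideal_minimal_poly[OF ideal_sr[OF complex_independent_sets]], unfold gen)
         (auto simp: fin sr_ideal_def independent_sets_def dest: subsetD[OF fin(2)])
    show "(sr_ideal V (independent_sets V E) :: ('v, 'k) mvpoly set) \<subseteq> edge_ideal V E"
    proof
      fix p :: "('v, 'k) mvpoly"
      assume p: "p \<in> sr_ideal V (independent_sets V E)"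
      show "p \<in> edge_ideal V E" unfolding edge_ideal_def
      proof (rule ideal_monomialsI[OF id])
        fix m assume m: "m \<in> keys p"
        then have "keys m \<subseteq> V" "keys m \<notin> independent_sets V E" using p by (auto simp: sr_ideal_def)
        then obtain e where e: "e \<in> E" "e \<subseteq> keys m" "keys m \<subseteq> V"
          unfolding independent_sets_def by blast
        have "single (sqfree e) 1 \<in> genideal (poly_ring V) ?G"
          using subsetD[OF genideal_self_poly[OF sub]] e(1) unfolding gen by blast
        then show "single m 1 \<in> genideal (poly_ring V) ?G"
          using ideal_single_sqfree_dvd[OF id] fin e by blast
      qed
    qed
  qed
qed

text \<open>A monomial becomes zero either because its support is a nonface or because it involves a
  variable from \<open>Y\<close>. The lemma computes the irrelevant ideal and the ideals along the
  regular sequence of isolated vertices.\<close>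

lemma genideal_sr_vars:
  assumes "complex V \<Delta>" "Y \<subseteq> V"
  shows "genideal (poly_ring V) (sr_ideal V \<Delta> \<union> pvar ` Y)
    = (sr_ideal V {F\<in>\<Delta>. F \<inter> Y = {}} :: ('v, 'k::field) mvpoly set)" (is "?L = ?R")
proof
  have c: "complex V {F\<in>\<Delta>. F \<inter> Y = {}}"
    using assms(1) by (auto simp: complex_def)
  have sub: "(sr_ideal V \<Delta> \<union> pvar ` Y :: ('v, 'k) mvpoly set) \<subseteq> carrier (poly_ring V)"
    using assms(2) by (auto simp: sr_ideal_def pvar_def)
  show "?L \<subseteq> ?R"
    by (rule genideal_minimal_poly[OF ideal_sr[OF c]])
       (use assms(2) in \<open>auto simp: sr_ideal_def pvar_def\<close>)
  note id = genideal_ideal_poly[OF sub]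
  show "?R \<subseteq> ?L"
  proof
    fix p :: "('v, 'k) mvpoly"
    assume p: "p \<in> ?R"
    show "p \<in> ?L"
    proof (rule ideal_monomialsI[OF id])
      fix m assume m: "m \<in> keys p"
      then have V: "keys m \<subseteq> V" using p by (auto simp: sr_ideal_def)
      have "keys m \<notin> {F\<in>\<Delta>. F \<inter> Y = {}}" using p m by (simp add: sr_ideal_def)
      then consider "keys m \<notin> \<Delta>" | y where "y \<in> Y" "y \<in> keys m" by blast
      then show "single m 1 \<in> ?L"
      proof cases
        case 1
        then have "(single m 1 :: ('v, 'k) mvpoly) \<in> sr_ideal V \<Delta>" using V by (simp add: sr_ideal_def)
        then show ?thesis using genideal_self_poly[OF sub] by blast
      next
        case 2
        then have "single (sqfree {y}) 1 \<in> ?L"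
          using genideal_self_poly[OF sub] unfolding pvar_sqfree by blast
        then show ?thesis using ideal_single_sqfree_dvd[OF id, of "{y}" m] 2 V by simp
      qed
    qed
  qed
qed

lemma irrelevant_ideal_eq_sr: "irrelevant_ideal V = (sr_ideal V {{}} :: ('v, 'k::field) mvpoly set)"
proof -
  have 0: "(sr_ideal V (Pow V) :: ('v, 'k) mvpoly set) = {0}"
    by (auto simp: sr_ideal_def)
  have c: "complex V (Pow V)" by (auto simp: complex_def)
  have sub: "(pvar ` V :: ('v, 'k) mvpoly set) \<subseteq> carrier (poly_ring V)" by (auto simp: pvar_def)
  \<comment> \<open>The zero ideal is the Stanley-Reisner ideal of the full simplex on
    \<open>V\<close>; adjoining 0 to the generators makes \<open>genideal_sr_vars\<close>
    applicable.\<close>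
  have "genideal (poly_ring V) (pvar ` V) = genideal (poly_ring V) ({0} \<union> pvar ` V :: ('v, 'k) mvpoly set)"
  proof
    show "genideal (poly_ring V) (pvar ` V) \<subseteq> genideal (poly_ring V) ({0} \<union> pvar ` V :: ('v, 'k) mvpoly set)"
      using sub genideal_self_poly[of "{0} \<union> pvar ` V" V]
      by (intro genideal_minimal_poly genideal_ideal_poly) auto
    show "genideal (poly_ring V) ({0} \<union> pvar ` V :: ('v, 'k) mvpoly set) \<subseteq> genideal (poly_ring V) (pvar ` V)"
      using genideal_self_poly[OF sub] ideal_poly_ringD(2)[OF genideal_ideal_poly[OF sub]]
      by (intro genideal_minimal_poly genideal_ideal_poly[OF sub]) auto
  qed
  also have "\<dots> = sr_ideal V {F\<in>Pow V. F \<inter> V = {}}"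
    using genideal_sr_vars[OF c subset_refl, where 'k = 'k] unfolding 0 .
  also have "{F\<in>Pow V. F \<inter> V = {}} = {{}}" by auto
  finally show ?thesis unfolding irrelevant_ideal_def .
qed

section \<open>The Hilbert function of a Stanley-Reisner ring\<close>

lemma quot_map_image: "quot_map V I p = (\<lambda>i. i + p) ` I"
  by (auto simp: quot_map_def a_r_coset_def')

lemma quot_map_eq_iff:
  fixes I :: "('v, 'k::field) mvpoly set"
  assumes "ideal I (poly_ring V)"
  shows "quot_map V I p = quot_map V I q \<longleftrightarrow> p - q \<in> I"
proof
  note D = ideal_poly_ringD[OF assms]
  { assume "quot_map V I p = quot_map V I q"
    moreover have "p \<in> quot_map V I p" unfolding quot_map_image using D(2) by force
    ultimately obtain i where "i \<in> I" "p = i + q" unfolding quot_map_image by auto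
    then show "p - q \<in> I" by simp }
  { assume pq: "p - q \<in> I"
    have "i + p \<in> quot_map V I q" if "i \<in> I" for i
      using D(3)[OF that pq] unfolding quot_map_image by (auto simp: image_iff intro!: bexI[of _ "i + (p - q)"])
    moreover have "i + q \<in> quot_map V I p" if "i \<in> I" for i
      using D(6)[OF that pq] unfolding quot_map_image by (auto simp: image_iff intro!: bexI[of _ "i - (p - q)"])
    ultimately show "quot_map V I p = quot_map V I q"
      unfolding quot_map_image[of V I p] quot_map_image[of V I q]
      unfolding quot_map_image by auto }
qed

lemma ring_hom_quot_map:
  fixes I :: "('v, 'k::field) mvpoly set"
  assumes "ideal I (poly_ring V)"
  shows "ring_hom_ring (poly_ring V) (quot_ring V I) (quot_map V I)"
proof -
  have "quot_map V I = (+>\<^bsub>poly_ring V\<^esub>) I" by (rule ext) (simp add: quot_map_def)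
  then show ?thesis using ideal.rcos_ring_hom_ring[OF assms] unfolding quot_ring_def by simp
qed

lemma carrier_quot_ring: "carrier (quot_ring V I) = quot_map V I ` carrier (poly_ring V)"
  by (auto simp: quot_ring_def quot_map_def FactRing_def A_RCOSETS_def')

lemma
  fixes I :: "('v, 'k::field) mvpoly set"
  assumes "ideal I (poly_ring V)"
  shows quot_map_mult: "p \<in> carrier (poly_ring V) \<Longrightarrow> q \<in> carrier (poly_ring V) \<Longrightarrow>
      quot_map V I p \<otimes>\<^bsub>quot_ring V I\<^esub> quot_map V I q = quot_map V I (p * q)"
    and quot_map_add: "p \<in> carrier (poly_ring V) \<Longrightarrow> q \<in> carrier (poly_ring V) \<Longrightarrow>
      quot_map V I p \<oplus>\<^bsub>quot_ring V I\<^esub> quot_map V I q = quot_map V I (p + q)"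
    and quot_map_zero: "\<zero>\<^bsub>quot_ring V I\<^esub> = quot_map V I 0"
    and quot_map_one: "\<one>\<^bsub>quot_ring V I\<^esub> = quot_map V I 1"
proof -
  interpret h: ring_hom_ring "poly_ring V" "quot_ring V I" "quot_map V I"
    by (rule ring_hom_quot_map[OF assms])
  show "p \<in> carrier (poly_ring V) \<Longrightarrow> q \<in> carrier (poly_ring V) \<Longrightarrow>
      quot_map V I p \<otimes>\<^bsub>quot_ring V I\<^esub> quot_map V I q = quot_map V I (p * q)"
    using h.hom_mult[of p q] by (simp del: poly_ring_simps(1))
  show "p \<in> carrier (poly_ring V) \<Longrightarrow> q \<in> carrier (poly_ring V) \<Longrightarrow>
      quot_map V I p \<oplus>\<^bsub>quot_ring V I\<^esub> quot_map V I q = quot_map V I (p + q)"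
    using h.hom_add[of p q] by (simp del: poly_ring_simps(1))
  show "\<zero>\<^bsub>quot_ring V I\<^esub> = quot_map V I 0" using h.hom_zero by simp
  show "\<one>\<^bsub>quot_ring V I\<^esub> = quot_map V I 1" using h.hom_one by simp
qed

lemma subfield_pconst: "subfield (range pconst) (poly_ring V :: ('v, 'k::field) mvpoly ring)"
proof -
  interpret cring "poly_ring V :: ('v, 'k) mvpoly ring" by (rule cring_poly_ring)
  let ?K = "range pconst :: ('v, 'k) mvpoly set"
  have ops: "pconst a * pconst b = (pconst (a * b) :: ('v, 'k) mvpoly)"
    "pconst a + pconst b = (pconst (a + b) :: ('v, 'k) mvpoly)"
    "pconst 1 = (1 :: ('v, 'k) mvpoly)" "pconst 0 = (0 :: ('v, 'k) mvpoly)"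
    "- pconst a = (pconst (- a) :: ('v, 'k) mvpoly)" for a b :: 'k
    by (simp_all add: pconst_def mult_single single_add single_uminus)
  have car: "pconst a \<in> carrier (poly_ring V)" for a :: 'k
    by (simp add: pconst_def)
  have inj: "pconst a = (pconst b :: ('v, 'k) mvpoly) \<longleftrightarrow> a = b" for a b :: 'k
    unfolding pconst_def by (metis lookup_single_eq)
  have "subring ?K (poly_ring V)"
  proof (rule subringI)
    show "\<one>\<^bsub>poly_ring V\<^esub> \<in> ?K" by (simp flip: ops(3))
    show "\<ominus>\<^bsub>poly_ring V\<^esub> h \<in> ?K" if "h \<in> ?K" for h
      using that car by (auto simp: poly_ring_a_inv ops simp del: poly_ring_simps(1))
  qed (use car in \<open>auto simp: ops simp del: poly_ring_simps(1)\<close>)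
  then have sub: "subcring ?K (poly_ring V)" by (rule subcringI')
  show ?thesis
  proof (rule subfieldI[OF sub])
    have "pconst a \<in> Units (poly_ring V\<lparr>carrier := ?K\<rparr>)" if "a \<noteq> 0" for a :: 'k
      unfolding Units_def using that
      by (auto simp: ops intro!: exI[of _ "inverse a"])
    moreover have "0 \<notin> Units (poly_ring V\<lparr>carrier := ?K\<rparr>)"
      by (auto simp: Units_def)
    ultimately show "Units (poly_ring V\<lparr>carrier := ?K\<rparr>) = ?K - {\<zero>\<^bsub>poly_ring V\<^esub>}"
      by (auto simp: Units_def ops(4)[symmetric] inj)
  qed
qed

lemma subfield_quot_pconst:
  fixes I :: "('v, 'k::field) mvpoly set"
  assumes "ideal I (poly_ring V)" "1 \<notin> I"
  shows "subfield (quot_map V I ` range pconst) (quot_ring V I)"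
proof -
  interpret h: ring_hom_ring "poly_ring V" "quot_ring V I" "quot_map V I"
    by (rule ring_hom_quot_map[OF assms(1)])
  have "\<one>\<^bsub>quot_ring V I\<^esub> \<noteq> \<zero>\<^bsub>quot_ring V I\<^esub>"
    unfolding quot_map_one[OF assms(1)] quot_map_zero[OF assms(1)] quot_map_eq_iff[OF assms(1)]
    using assms(2) by simp
  then show ?thesis using h.img_is_subfield(2)[OF subfield_pconst] by simp
qed

text \<open>Each new monomial is a line extension of the span of the earlier ones: a relation would
  be a polynomial in \<open>I\<close> with a nonzero coefficient at a monomial supported on a
  face.\<close>

lemma dimension_span_monomials:
  fixes V :: "'v set"
  assumes "complex V \<Delta>" "finite B" "\<And>m. m \<in> B \<Longrightarrow> keys m \<in> \<Delta>"
  defines "I \<equiv> sr_ideal V \<Delta> :: ('v, 'k::field) mvpoly set"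
  shows "ring.dimension (quot_ring V I) (card B) (quot_map V I ` range pconst)
    (quot_map V I ` {p. keys p \<subseteq> B})"
proof -
  have id: "ideal I (poly_ring V)" unfolding I_def by (rule ideal_sr[OF assms(1)])
  interpret ring "quot_ring V I"
    unfolding quot_ring_def by (rule ideal.quotient_is_ring[OF id])
  let ?K = "quot_map V I ` range pconst" and ?E = "\<lambda>B. quot_map V I ` {p. keys p \<subseteq> B}"
  have car: "p \<in> carrier (poly_ring V)" if "keys p \<subseteq> B" "\<And>m. m \<in> B \<Longrightarrow> keys m \<in> \<Delta>"
    for p :: "('v, 'k) mvpoly" and B
    using that assms(1) by (auto simp: complex_def)
  have carc: "pconst c \<in> carrier (poly_ring V)" for c :: 'k by (simp add: pconst_def)
  show ?thesis using assms(2,3)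
  proof (induct B)
    case empty
    have "?E {} = {\<zero>\<^bsub>quot_ring V I\<^esub>}" by (simp add: quot_map_zero[OF id])
    then show ?case by simp
  next
    case (insert m B)
    let ?v = "quot_map V I (single m 1)"
    have carm: "single m c \<in> carrier (poly_ring V)" for c :: 'k
      using insert.prems car[of "single m c" "insert m B"] by auto
    have "?v \<notin> ?E B"
    proof
      assume "?v \<in> ?E B"
      then obtain p :: "('v, 'k) mvpoly" where p: "keys p \<subseteq> B" "single m 1 - p \<in> I"
        using quot_map_eq_iff[OF id] by (auto simp del: poly_ring_simps)
      have "m \<notin> keys p" using p(1) insert(2) by blast
      then have "lookup (single m 1 - p) m \<noteq> 0" by (simp add: lookup_minus in_keys_iff)
      then have "m \<in> keys (single m 1 - p)" by (simp add: in_keys_iff)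
      then show False using p(2) insert.prems unfolding I_def sr_ideal_def by auto
    qed
    moreover have "?v \<in> carrier (quot_ring V I)"
      using carm unfolding carrier_quot_ring by blast
    moreover have "dimension (card B) ?K (?E B)" using insert by simp
    ultimately have "dimension (Suc (card B)) ?K (line_extension ?K ?v (?E B))"
      using Suc_dim by blast
    moreover have "line_extension ?K ?v (?E B) = ?E (insert m B)"
    proof (rule Set.set_eqI)
      fix u
      have 1: "quot_map V I (pconst c) \<otimes>\<^bsub>quot_ring V I\<^esub> ?v \<oplus>\<^bsub>quot_ring V I\<^esub> quot_map V I p
        = quot_map V I (single m c + p)" if "keys p \<subseteq> B" for c p
      proof -
        have "p \<in> carrier (poly_ring V)" using car[OF that] insert.prems by blast
        then show ?thesis
          using quot_map_mult[OF id carc carm, of c 1]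
            quot_map_add[OF id carm[of c], of p] by (simp add: pconst_def mult_single)
      qed
      have "u \<in> line_extension ?K ?v (?E B) \<longleftrightarrow>
        (\<exists>c. \<exists>p. keys p \<subseteq> B \<and> u = quot_map V I (single m c + p))"
        unfolding line_extension_mem_iff using 1 by (auto; blast)
      also have "\<dots> \<longleftrightarrow> u \<in> ?E (insert m B)"
      proof
        assume "\<exists>c. \<exists>p. keys p \<subseteq> B \<and> u = quot_map V I (single m c + p)"
        then obtain c p where "keys p \<subseteq> B" "u = quot_map V I (single m c + p)" by blast
        moreover have "keys (single m c + p) \<subseteq> insert m B"
          by (rule keys_add_subset) (use calculation in auto)
        ultimately show "u \<in> ?E (insert m B)" by blast
      next
        assume "u \<in> ?E (insert m B)"
        then obtain p where p: "keys p \<subseteq> insert m B" "u = quot_map V I p" by blast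
        have "p = single m (lookup p m) + pfilter (\<lambda>k. k \<noteq> m) p"
          by (rule poly_mapping_eqI) (auto simp: lookup_add lookup_pfilter lookup_single when_def)
        moreover have "keys (pfilter (\<lambda>k. k \<noteq> m) p) \<subseteq> B" using p(1) by (auto simp: keys_pfilter)
        ultimately show "\<exists>c. \<exists>p. keys p \<subseteq> B \<and> u = quot_map V I (single m c + p)"
          using p(2) by metis
      qed
      finally show "u \<in> line_extension ?K ?v (?E B) \<longleftrightarrow> u \<in> ?E (insert m B)" .
    qed
    ultimately show ?case using insert by simp
  qed
qed

lemma bounded_monomials:
  assumes "finite F"
  shows "finite {m. keys m \<subseteq> F \<and> (\<forall>v. lookup m v \<le> (M::nat))}" (is "finite ?A")
    and "card {m. keys m \<subseteq> F \<and> (\<forall>v. lookup m v \<le> M)} \<le> (M + 1) ^ card F"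
proof -
  let ?f = "\<lambda>m. restrict (lookup m) F"
  have inj: "inj_on ?f ?A"
  proof (rule inj_onI)
    fix m n assume mn: "m \<in> ?A" "n \<in> ?A" "?f m = ?f n"
    show "m = n"
    proof (rule poly_mapping_eqI)
      fix k show "lookup m k = lookup n k"
      proof (cases "k \<in> F")
        case True then show ?thesis using fun_cong[OF mn(3), of k] by simp
      next
        case False
        then have "k \<notin> keys m" "k \<notin> keys n" using mn by auto
        then show ?thesis by (simp add: in_keys_iff)
      qed
    qed
  qed
  have sub: "?f ` ?A \<subseteq> PiE F (\<lambda>_. {..M})" by auto
  have fin: "finite (PiE F (\<lambda>_. {..M}))" using assms by (simp add: finite_PiE)
  show "finite ?A" using inj_on_finite[OF inj sub fin] .
  show "card ?A \<le> (M + 1) ^ card F"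
    using card_inj_on_le[OF inj sub fin] assms by (simp add: card_PiE)
qed

definition degree_monomials :: "'v set set \<Rightarrow> nat \<Rightarrow> ('v \<Rightarrow>\<^sub>0 nat) set" where
  "degree_monomials \<Delta> n = {m. keys m \<in> \<Delta> \<and> mon_degree m = n}"

lemma lookup_le_mon_degree: "lookup m v \<le> mon_degree m"
  unfolding mon_degree_def
  by (cases "v \<in> keys m") (auto simp: in_keys_iff intro: member_le_sum)

lemma finite_degree_monomials:
  assumes "complex V \<Delta>" "finite V"
  shows "finite (degree_monomials \<Delta> n)"
  by (rule finite_subset[OF _ bounded_monomials(1)[OF assms(2), of n]])
     (use assms(1) lookup_le_mon_degree in \<open>fastforce simp: degree_monomials_def complex_def\<close>)

text \<open>Discarding the monomials supported on nonfaces does not change a residue class, so the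
  monomials of degree n supported on faces form a basis of the graded component.\<close>

lemma hilbert_function_sr:
  fixes V :: "'v set"
  assumes "complex V \<Delta>" "finite V" "{} \<in> \<Delta>"
  shows "hilbert_function V (sr_ideal V \<Delta> :: ('v, 'k::field) mvpoly set) n = card (degree_monomials \<Delta> n)"
proof -
  let ?I = "sr_ideal V \<Delta> :: ('v, 'k) mvpoly set"
  let ?B = "degree_monomials \<Delta> n" and ?K = "quot_map V ?I ` range pconst"
  have id: "ideal ?I (poly_ring V)" by (rule ideal_sr[OF assms(1)])
  have "1 \<notin> ?I" using assms(3) by (simp add: sr_ideal_def)
  note sf = subfield_quot_pconst[OF id this]
  interpret ring "quot_ring V ?I"
    unfolding quot_ring_def by (rule ideal.quotient_is_ring[OF id])
  have "quot_map V ?I ` homog V (int n) = quot_map V ?I ` {p. keys p \<subseteq> ?B}"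
  proof
    show "quot_map V ?I ` {p. keys p \<subseteq> ?B} \<subseteq> quot_map V ?I ` homog V (int n)"
      using assms(1) by (intro image_mono) (auto simp: degree_monomials_def homog_def complex_def)
    show "quot_map V ?I ` homog V (int n) \<subseteq> quot_map V ?I ` {p. keys p \<subseteq> ?B}"
    proof (rule image_subsetI)
      fix p :: "('v, 'k) mvpoly" assume p: "p \<in> homog V (int n)"
      let ?q = "pfilter (\<lambda>m. keys m \<in> \<Delta>) p"
      have "p - ?q = pfilter (\<lambda>m. keys m \<notin> \<Delta>) p"
        using pfilter_split[of p "\<lambda>m. keys m \<in> \<Delta>"] by (metis add_diff_cancel_left')
      then have "p - ?q \<in> ?I" using p by (simp add: sr_ideal_def keys_pfilter homog_def)
      moreover have "keys ?q \<subseteq> ?B" using p by (auto simp: keys_pfilter homog_def degree_monomials_def)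
      ultimately show "quot_map V ?I p \<in> quot_map V ?I ` {p. keys p \<subseteq> ?B}"
        using quot_map_eq_iff[OF id] by blast
    qed
  qed
  then have "dimension (card ?B) ?K (quot_map V ?I ` homog V (int n))"
    using dimension_span_monomials[OF assms(1) finite_degree_monomials[OF assms(1,2)], of n]
    by (simp add: degree_monomials_def)
  then show ?thesis using dimI[OF sf] unfolding hilbert_function_def over_def by simp
qed

section \<open>Krull dimension, depth and the h-polynomial\<close>

lemma exists_nontrivial_solution:
  fixes M :: "'a \<Rightarrow> 'b \<Rightarrow> 'k::field"
  assumes "finite B" "finite A" "card B < card A"
  shows "\<exists>c. (\<exists>a\<in>A. c a \<noteq> 0) \<and> (\<forall>b\<in>B. (\<Sum>a\<in>A. c a * M a b) = 0)"
  using assms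
proof (induct B arbitrary: A M)
  case empty
  then obtain a where "a \<in> A" by fastforce
  then show ?case by (intro exI[of _ "\<lambda>_. 1"]) auto
next
  case (insert b B)
  show ?case
  proof (cases "\<forall>a\<in>A. M a b = 0")
    case True
    have "card B < card A" using insert.prems insert.hyps(1,2) by simp
    then obtain c where c: "\<exists>a\<in>A. c a \<noteq> 0" "\<forall>b\<in>B. (\<Sum>a\<in>A. c a * M a b) = 0"
      using insert.hyps(3)[of A M] insert.prems by blast
    then show ?thesis using True by (intro exI[of _ c]) simp
  next
    case False
    then obtain a0 where a0: "a0 \<in> A" "M a0 b \<noteq> 0" by blast
    \<comment> \<open>One step of Gaussian elimination: equation \<open>b\<close> determines the
      coefficient at the pivot \<open>a0\<close>, and substituting it turns the other equations into
      those of \<open>?M\<close>.\<close>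
    let ?A = "A - {a0}" and ?M = "\<lambda>a b'. M a b' - M a b / M a0 b * M a0 b'"
    have "card B < card ?A" using insert a0 by (auto simp: card_Diff_singleton)
    then obtain c where c: "\<exists>a\<in>?A. c a \<noteq> 0" "\<forall>b\<in>B. (\<Sum>a\<in>?A. c a * ?M a b) = 0"
      using insert.hyps(3)[of ?A ?M] insert.prems by auto
    let ?c = "\<lambda>a. if a = a0 then - (\<Sum>a\<in>?A. c a * (M a b / M a0 b)) else c a"
    have s: "(\<Sum>a\<in>A. ?c a * M a b') = (\<Sum>a\<in>?A. c a * ?M a b')" for b'
    proof -
      have "(\<Sum>a\<in>A. ?c a * M a b') = ?c a0 * M a0 b' + (\<Sum>a\<in>?A. ?c a * M a b')"
        using insert.prems a0 by (intro sum.remove) auto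
      also have "(\<Sum>a\<in>?A. ?c a * M a b') = (\<Sum>a\<in>?A. c a * M a b')"
        by (rule sum.cong) auto
      also have "?c a0 * M a0 b' = - (\<Sum>a\<in>?A. c a * (M a b / M a0 b * M a0 b'))"
        by (simp add: sum_distrib_right mult.assoc)
      finally show ?thesis by (simp add: right_diff_distrib sum_subtractf)
    qed
    have "(\<Sum>a\<in>A. ?c a * M a b) = 0" unfolding s using a0(2) by simp
    then have "\<forall>b'\<in>insert b B. (\<Sum>a\<in>A. ?c a * M a b') = 0" using c(2) s by auto
    moreover have "\<exists>a\<in>A. ?c a \<noteq> 0" using c(1) by auto
    ultimately show ?thesis by (intro exI[of _ ?c]) blast
  qed
qed

lemma ideal_carrier: "ideal (carrier (poly_ring V)) (poly_ring V :: ('v, 'k::field) mvpoly ring)"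
  using ring.oneideal[OF ring_poly_ring] .

lemma ideal_eq_carrier:
  fixes J :: "('v, 'k::field) mvpoly set"
  assumes "ideal J (poly_ring V)" "1 \<in> J"
  shows "J = carrier (poly_ring V)"
proof
  show "carrier (poly_ring V) \<subseteq> J"
  proof
    fix p :: "('v, 'k) mvpoly" assume "p \<in> carrier (poly_ring V)"
    then have "p * 1 \<in> J" by (rule ideal_poly_ringD(4)[OF assms])
    then show "p \<in> J" by simp
  qed
qed (rule ideal_poly_ringD(1)[OF assms(1)])

lemma carrier_sum:
  "(\<And>i. i \<in> A \<Longrightarrow> f i \<in> carrier (poly_ring V)) \<Longrightarrow> (\<Sum>i\<in>A. f i :: ('v, 'k::field) mvpoly) \<in> carrier (poly_ring V)"
  by (rule ideal_sum_closed[OF ideal_carrier])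

lemma carrier_power:
  "p \<in> carrier (poly_ring V) \<Longrightarrow> (p :: ('v, 'k::field) mvpoly) ^ n \<in> carrier (poly_ring V)"
  by (induct n) (auto simp del: poly_ring_simps intro: carrier_closed, simp)

text \<open>The family is shifted along with the list, which matches dropping the first ideal of a
  chain in the induction of \<open>power_products_independent\<close>.\<close>

fun power_product :: "(nat \<Rightarrow> 'a::comm_monoid_mult) \<Rightarrow> nat list \<Rightarrow> 'a" where
  "power_product f [] = 1"
| "power_product f (a # as) = f 0 ^ a * power_product (\<lambda>i. f (Suc i)) as"

lemma power_product_carrier:
  assumes "\<And>i. i < length as \<Longrightarrow> f i \<in> carrier (poly_ring V)"
  shows "power_product f as \<in> carrier (poly_ring V :: ('v, 'k::field) mvpoly ring)"
  using assms
proof (induct as arbitrary: f)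
  case (Cons a as)
  have "f 0 \<in> carrier (poly_ring V)" using Cons.prems[of 0] by auto
  moreover have "power_product (\<lambda>i. f (Suc i)) as \<in> carrier (poly_ring V)"
    by (rule Cons.hyps) (use Cons.prems in force)
  ultimately show ?case unfolding power_product.simps by (intro carrier_closed(2) carrier_power)
qed simp

text \<open>The common core of a chain of primes and a regular sequence. For primes,
  \<open>f i\<close> is any element of \<open>J (Suc i)\<close> outside \<open>J i\<close>; for a
  regular sequence, \<open>J i\<close> is generated by \<open>I\<close> and the first i
  elements.\<close>

definition nzd_chain :: "'v set \<Rightarrow> (nat \<Rightarrow> ('v, 'k::field) mvpoly set) \<Rightarrow> (nat \<Rightarrow> ('v, 'k) mvpoly) \<Rightarrow> nat \<Rightarrow> bool" where
  "nzd_chain V J f n \<longleftrightarrow> (\<forall>i\<le>n. ideal (J i) (poly_ring V)) \<and> 1 \<notin> J n \<and>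
     (\<forall>i<n. J i \<subseteq> J (Suc i) \<and> f i \<in> J (Suc i) \<and> (\<forall>g\<in>carrier (poly_ring V). f i * g \<in> J i \<longrightarrow> g \<in> J i))"

lemma sum_lists_Suc:
  "(\<Sum>as | set as \<subseteq> {..N::nat} \<and> length as = Suc n. h as)
    = (\<Sum>a\<le>N. \<Sum>as | set as \<subseteq> {..N} \<and> length as = n. h (a # as))"
proof -
  let ?L = "\<lambda>n. {as. set as \<subseteq> {..N} \<and> length as = n}"
  have fin: "finite (?L n)" for n by (rule finite_lists_length_eq) simp
  have "bij_betw (\<lambda>(a, as). a # as) ({..N} \<times> ?L n) (?L (Suc n))"
    by (rule bij_betwI[where g = "\<lambda>as. (hd as, tl as)"])
       (auto simp: length_Suc_conv)
  then have "(\<Sum>as\<in>?L (Suc n). h as) = (\<Sum>(a, as)\<in>{..N} \<times> ?L n. h (a # as))"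
    by (simp add: sum.reindex_bij_betw[symmetric] case_prod_beta)
  also have "\<dots> = (\<Sum>a\<le>N. \<Sum>as\<in>?L n. h (a # as))" by (simp add: sum.cartesian_product)
  finally show ?thesis .
qed

text \<open>Sort a relation by the exponent a of \<open>f 0\<close>, with coefficients
  \<open>?G a\<close> in the remaining elements. Once the terms below a vanish,
  \<open>f 0 ^ a\<close> cancels modulo \<open>J 0\<close>. All summands but \<open>?G a\<close>
  then still contain \<open>f 0\<close>, which lies in \<open>J 1\<close>; so \<open>?G a\<close>
  lies in \<open>J 1\<close>, and the induction hypothesis for the shifted chain applies.\<close>

lemma power_products_independent:
  fixes J :: "nat \<Rightarrow> ('v, 'k::field) mvpoly set"
  assumes "nzd_chain V J f n"
    and "(\<Sum>as | set as \<subseteq> {..N} \<and> length as = n. pconst (c as) * power_product f as) \<in> J 0"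
    and "set as \<subseteq> {..N}" "length as = n"
  shows "c as = 0"
  using assms
proof (induct n arbitrary: J f c as)
  case 0
  have id: "ideal (J 0) (poly_ring V)" and 1: "1 \<notin> J 0" using 0(1) by (auto simp: nzd_chain_def)
  have "{as. set as \<subseteq> {..N} \<and> length as = 0} = {[]}" by auto
  then have c: "pconst (c []) \<in> J 0" using 0(2) by simp
  show ?case
  proof (rule ccontr)
    assume "c as \<noteq> 0"
    then have "c [] \<noteq> 0" using 0(4) by simp
    moreover have "pconst (inverse (c [])) * pconst (c []) \<in> J 0"
      by (rule ideal_poly_ringD(4)[OF id c]) (simp add: pconst_def)
    ultimately have "pconst 1 \<in> J 0" by (simp add: pconst_def mult_single)
    then show False using 1 by (simp add: pconst_def)
  qed
next
  case (Suc n)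
  let ?L = "{as. set as \<subseteq> {..N} \<and> length as = n}"
  let ?f = "\<lambda>i. f (Suc i)" and ?J = "\<lambda>i. J (Suc i)"
  let ?G = "\<lambda>a. \<Sum>as\<in>?L. pconst (c (a # as)) * power_product ?f as"
  have id: "ideal (J 0) (poly_ring V)" "ideal (J 1) (poly_ring V)"
    and J01: "J 0 \<subseteq> J 1" "f 0 \<in> J 1"
    and nzd: "\<And>g. g \<in> carrier (poly_ring V) \<Longrightarrow> f 0 * g \<in> J 0 \<Longrightarrow> g \<in> J 0"
    using Suc.prems(1) by (auto simp: nzd_chain_def simp del: poly_ring_simps)
  have ch: "nzd_chain V ?J ?f n" using Suc.prems(1) by (simp add: nzd_chain_def)
  have fcar: "f i \<in> carrier (poly_ring V)" if "i < Suc n" for i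
  proof -
    have "f i \<in> J (Suc i)" "ideal (J (Suc i)) (poly_ring V)"
      using Suc.prems(1) that by (auto simp: nzd_chain_def)
    then show ?thesis using ideal_poly_ringD(1) by blast
  qed
  have Gcar: "?G a \<in> carrier (poly_ring V)" for a
  proof (rule carrier_sum)
    fix as assume "as \<in> ?L"
    then show "pconst (c (a # as)) * power_product ?f as \<in> carrier (poly_ring V)"
      by (intro carrier_closed(2) power_product_carrier fcar) (simp_all add: pconst_def)
  qed
  have sum: "(\<Sum>a\<le>N. f 0 ^ a * ?G a) \<in> J 0"
  proof -
    have "(\<Sum>a\<le>N. f 0 ^ a * ?G a) = (\<Sum>a\<le>N. \<Sum>as\<in>?L. pconst (c (a # as)) * power_product f (a # as))"
      by (simp add: sum_distrib_left mult_ac)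
    then show ?thesis using Suc.prems(2) unfolding sum_lists_Suc by simp
  qed
  have cancel: "g \<in> J 0" if "f 0 ^ a * g \<in> J 0" "g \<in> carrier (poly_ring V)" for a g
    using that
  proof (induct a)
    case (Suc a)
    have "f 0 ^ a * g \<in> J 0"
      by (rule nzd) (use Suc fcar[of 0] in \<open>auto simp del: poly_ring_simps simp: mult_ac intro!: carrier_closed carrier_power\<close>)
    then show ?case using Suc by simp
  qed simp
  have zero: "\<forall>as\<in>?L. c (a # as) = 0" if "a \<le> N" for a
    using that
  proof (induct a rule: less_induct)
    case (less a)
    have "?G b = 0" if "b < a" for b
      using less(1)[OF that] less(2) that by (intro sum.neutral) (auto simp: pconst_def)
    then have "(\<Sum>b\<le>N. f 0 ^ b * ?G b) = (\<Sum>b\<in>{a..N}. f 0 ^ b * ?G b)"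
      by (intro sum.mono_neutral_right) auto
    also have "\<dots> = (\<Sum>b\<in>{a..N}. f 0 ^ a * (f 0 ^ (b - a) * ?G b))"
      by (rule sum.cong) (auto simp: mult.assoc[symmetric] power_add[symmetric])
    also have "\<dots> = f 0 ^ a * (\<Sum>b\<in>{a..N}. f 0 ^ (b - a) * ?G b)"
      by (simp add: sum_distrib_left)
    finally have "f 0 ^ a * (\<Sum>b\<in>{a..N}. f 0 ^ (b - a) * ?G b) \<in> J 0" using sum by simp
    then have S: "(\<Sum>b\<in>{a..N}. f 0 ^ (b - a) * ?G b) \<in> J 0"
      by (rule cancel) (intro carrier_sum carrier_closed(2) carrier_power fcar Gcar, simp)
    have e: "(\<Sum>b\<in>{a..N}. f 0 ^ (b - a) * ?G b) = ?G a + (\<Sum>b\<in>{a<..N}. f 0 ^ (b - a) * ?G b)"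
    proof -
      have "{a..N} = insert a {a<..N}" using less(2) by auto
      then show ?thesis by simp
    qed
    have R: "(\<Sum>b\<in>{a<..N}. f 0 ^ (b - a) * ?G b) \<in> J 1"
    proof (rule ideal_sum_closed[OF id(2)])
      fix b assume "b \<in> {a<..N}"
      then have "f 0 ^ (b - a) * ?G b = (f 0 ^ (b - a - 1) * ?G b) * f 0"
        by (cases "b - a") (auto simp: mult_ac)
      also have "\<dots> \<in> J 1"
        by (rule ideal_poly_ringD(4)[OF id(2) J01(2)]) (intro carrier_closed(2) carrier_power fcar Gcar, simp)
      finally show "f 0 ^ (b - a) * ?G b \<in> J 1" .
    qed
    have "?G a \<in> J 1"
      using ideal_poly_ringD(6)[OF id(2) subsetD[OF J01(1) S] R] unfolding e by simp
    then have "?G a \<in> ?J 0" by simp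
    from Suc.hyps[OF ch this] show ?case by auto
  qed
  obtain a as' where "as = a # as'" using Suc.prems(4) by (cases as) auto
  then show ?case using zero[of a] Suc.prems(3,4) by auto
qed

text \<open>Exponents are bounded variable by variable, so that the monomials supported on a face F
  form a box whose size is a power with exponent the size of F.\<close>

definition expo_le :: "nat \<Rightarrow> ('v, 'k::field) mvpoly \<Rightarrow> bool" where
  "expo_le D p \<longleftrightarrow> (\<forall>m\<in>keys p. \<forall>v. lookup m v \<le> D)"

lemma expo_le_mult: "expo_le C p \<Longrightarrow> expo_le D q \<Longrightarrow> expo_le (C + D) (p * q)"
  unfolding expo_le_def
proof (intro ballI allI)
  fix m v assume *: "\<forall>m\<in>keys p. \<forall>v. lookup m v \<le> C" "\<forall>m\<in>keys q. \<forall>v. lookup m v \<le> D"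
    and "m \<in> keys (p * q)"
  then obtain a b where "a \<in> keys p" "b \<in> keys q" "m = a + b" by (elim keys_mult_elem)
  then show "lookup m v \<le> C + D" using * by (simp add: lookup_add add_mono)
qed

lemma expo_le_mono: "expo_le C p \<Longrightarrow> C \<le> D \<Longrightarrow> expo_le D p"
  unfolding expo_le_def by (meson le_trans)

lemma expo_le_power: "expo_le D p \<Longrightarrow> expo_le (a * D) (p ^ a)"
proof (induct a)
  case (Suc a) then show ?case using expo_le_mult[of D p "a * D" "p ^ a"] by simp
qed (simp add: expo_le_def)

lemma expo_le_power_product:
  assumes "\<And>i. i < length as \<Longrightarrow> expo_le D (f i)" "set as \<subseteq> {..N}"
  shows "expo_le (length as * (N * D)) (power_product f as)"
  using assms
proof (induct as arbitrary: f)
  case (Cons a as)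
  have "expo_le (a * D) (f 0 ^ a)" using Cons.prems(1)[of 0] by (intro expo_le_power) auto
  then have "expo_le (N * D) (f 0 ^ a)" by (rule expo_le_mono) (use Cons.prems in auto)
  moreover have "expo_le (length as * (N * D)) (power_product (\<lambda>i. f (Suc i)) as)"
    by (rule Cons.hyps) (use Cons.prems in auto)
  ultimately show ?case using expo_le_mult[of "N * D" "f 0 ^ a"] by simp
qed (simp add: expo_le_def)

lemma expo_le_sum: "(\<And>i. i \<in> A \<Longrightarrow> expo_le D (f i)) \<Longrightarrow> expo_le D (\<Sum>i\<in>A. f i)"
  unfolding expo_le_def using subsetD[OF Poly_Mapping.keys_sum[of f A]] by blast

lemma exists_expo_le: "\<exists>D. \<forall>i<n. expo_le D (f (i::nat) :: ('v, 'k::field) mvpoly)"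
proof (induct n)
  case (Suc n)
  then obtain D where D: "\<forall>i<n. expo_le D (f i)" by blast
  let ?E = "\<Sum>m\<in>keys (f n). mon_degree m"
  have "expo_le ?E (f n)"
    unfolding expo_le_def
    using member_le_sum[of _ "keys (f n)" mon_degree] lookup_le_mon_degree order_trans
    by (metis Poly_Mapping.finite_keys zero_le)
  then have "\<forall>i<Suc n. expo_le (D + ?E) (f i)"
    using D by (auto simp: less_Suc_eq intro: expo_le_mono)
  then show ?case by blast
qed simp

lemma lookup_pconst_mult: "lookup (pconst c * p) m = c * lookup (p :: ('v, 'k::field) mvpoly) m"
  using lookup_single_mult_add[of 0 c p m] by (simp add: pconst_def)

text \<open>Power products of the \<open>f i\<close> are linearly independent modulo \<open>J 0\<close>, and the number of those
  with exponents at most \<open>N\<close> grows like \<open>N ^ n\<close>; but the standard monomials span a space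
  that grows only like \<open>N\<close> to the largest size of a face.\<close>

lemma nzd_chain_length_le:
  fixes J :: "nat \<Rightarrow> ('v, 'k::field) mvpoly set"
  assumes "complex V \<Delta>" "finite V" "\<And>F. F \<in> \<Delta> \<Longrightarrow> card F \<le> \<alpha>"
    and "nzd_chain V J f n" "sr_ideal V \<Delta> \<subseteq> J 0"
  shows "n \<le> \<alpha>"
proof (rule ccontr)
  assume "\<not> n \<le> \<alpha>"
  obtain D where D: "\<forall>i<n. expo_le D (f i)" using exists_expo_le by blast
  \<comment> \<open>The choice makes the comparison close: with exponents up to \<open>C\<close>
    there are \<open>(C + 1) ^ n\<close> power products, while the standard monomials number at most
    \<open>C * (C + 1) ^ \<alpha>\<close>, which is less than
    \<open>(C + 1) ^ Suc \<alpha>\<close>.\<close>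
  define C where "C = card \<Delta> * (n * D + 1) ^ \<alpha>"
  let ?M = "n * (C * D)"
  let ?A = "{as. set as \<subseteq> {..C} \<and> length as = n}"
  let ?B = "{m. keys m \<in> \<Delta> \<and> (\<forall>v. lookup m v \<le> ?M)}"
  have fin\<Delta>: "finite \<Delta>" using assms(1,2) by (meson complex_def finite_Pow_iff finite_subset)
  have finF: "finite F" if "F \<in> \<Delta>" for F
    using assms(1,2) that by (meson PowD complex_def finite_subset subsetD)
  have Beq: "?B \<subseteq> (\<Union>F\<in>\<Delta>. {m. keys m \<subseteq> F \<and> (\<forall>v. lookup m v \<le> ?M)})" by auto
  have fin: "finite (\<Union>F\<in>\<Delta>. {m. keys m \<subseteq> F \<and> (\<forall>v. lookup m v \<le> ?M)})"
    using fin\<Delta> finF bounded_monomials(1) by blast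
  have "card ?B \<le> card (\<Union>F\<in>\<Delta>. {m. keys m \<subseteq> F \<and> (\<forall>v. lookup m v \<le> ?M)})"
    by (rule card_mono[OF fin Beq])
  also have "\<dots> \<le> (\<Sum>F\<in>\<Delta>. card {m. keys m \<subseteq> F \<and> (\<forall>v. lookup m v \<le> ?M)})"
    by (rule card_UN_le[OF fin\<Delta>])
  also have "\<dots> \<le> (\<Sum>F\<in>\<Delta>. (?M + 1) ^ \<alpha>)"
  proof (rule sum_mono)
    fix F assume F: "F \<in> \<Delta>"
    have "card {m. keys m \<subseteq> F \<and> (\<forall>v. lookup m v \<le> ?M)} \<le> (?M + 1) ^ card F"
      by (rule bounded_monomials(2)[OF finF[OF F]])
    also have "\<dots> \<le> (?M + 1) ^ \<alpha>" using assms(3)[OF F] by (intro power_increasing) auto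
    finally show "card {m. keys m \<subseteq> F \<and> (\<forall>v. lookup m v \<le> ?M)} \<le> (?M + 1) ^ \<alpha>" .
  qed
  also have "\<dots> = card \<Delta> * (?M + 1) ^ \<alpha>" by simp
  also have "\<dots> \<le> card \<Delta> * ((n * D + 1) * (C + 1)) ^ \<alpha>"
    by (intro mult_left_mono power_mono) (auto simp: algebra_simps)
  also have "\<dots> = C * (C + 1) ^ \<alpha>" unfolding power_mult_distrib by (simp only: C_def mult.assoc)
  also have "\<dots> < (C + 1) ^ Suc \<alpha>" by simp
  also have "\<dots> \<le> (C + 1) ^ n" using \<open>\<not> n \<le> \<alpha>\<close> by (intro power_increasing) auto
  also have "\<dots> = card ?A" by (subst card_lists_length_eq) auto
  finally have "card ?B < card ?A" .
  moreover have "finite ?B" by (rule finite_subset[OF Beq fin])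
  moreover have "finite ?A" by (rule finite_lists_length_eq) simp
  ultimately obtain c where c: "\<exists>as\<in>?A. c as \<noteq> 0"
      "\<forall>m\<in>?B. (\<Sum>as\<in>?A. c as * lookup (power_product f as) m) = 0"
    using exists_nontrivial_solution[of ?B ?A "\<lambda>as. lookup (power_product f as)"] by blast
  have fcar: "f i \<in> carrier (poly_ring V)" if "i < n" for i
  proof -
    have "f i \<in> J (Suc i)" "ideal (J (Suc i)) (poly_ring V)"
      using assms(4) that by (auto simp: nzd_chain_def)
    then show ?thesis using ideal_poly_ringD(1) by blast
  qed
  let ?P = "\<Sum>as\<in>?A. pconst (c as) * power_product f as"
  have lookP: "lookup ?P m = (\<Sum>as\<in>?A. c as * lookup (power_product f as) m)" for m
    by (simp add: lookup_sum lookup_pconst_mult)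
  have "?P \<in> sr_ideal V \<Delta>"
    unfolding sr_ideal_def
  proof (intro CollectI conjI ballI)
    show "?P \<in> carrier (poly_ring V)"
    proof (rule carrier_sum)
      fix as assume "as \<in> ?A"
      then show "pconst (c as) * power_product f as \<in> carrier (poly_ring V)"
        by (intro carrier_closed(2) power_product_carrier fcar) (simp_all add: pconst_def)
    qed
    have "expo_le ?M ?P"
    proof (rule expo_le_sum)
      fix as assume as: "as \<in> ?A"
      then have "expo_le ?M (power_product f as)"
        using expo_le_power_product[of as D f C] D by auto
      moreover have "expo_le 0 (pconst (c as))" by (simp add: expo_le_def pconst_def)
      ultimately show "expo_le ?M (pconst (c as) * power_product f as)"
        using expo_le_mult[of 0 "pconst (c as)" ?M] by simp
    qed
    then have bd: "lookup m v \<le> ?M" if "m \<in> keys ?P" for m v using that unfolding expo_le_def by blast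
    fix m assume m: "m \<in> keys ?P"
    show "keys m \<notin> \<Delta>"
    proof
      assume "keys m \<in> \<Delta>"
      then have "m \<in> ?B" using bd[OF m] by blast
      then have "lookup ?P m = 0" unfolding lookP using c(2) by blast
      then show False using m by (simp add: in_keys_iff)
    qed
  qed
  then have "?P \<in> J 0" using assms(5) by blast
  then have "c as = 0" if "as \<in> ?A" for as
    using power_products_independent[OF assms(4)] that by blast
  then show False using c(1) by blast
qed

section \<open>Krull dimension and the upper bound for the depth\<close>

lemma pfilter_mult:
  fixes p q :: "('v, 'k::field) mvpoly"
  assumes "\<And>m n. P (m + n) \<longleftrightarrow> P m \<and> P n"
  shows "pfilter P (p * q) = pfilter P p * pfilter P q"
proof -
  let ?s = "\<lambda>p m. single m (lookup p m)"
  have "p * q = (\<Sum>m\<in>keys p. ?s p m) * (\<Sum>n\<in>keys q. ?s q n)"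
    by (simp flip: poly_sum_singles)
  also have "\<dots> = (\<Sum>m\<in>keys p. \<Sum>n\<in>keys q. ?s p m * ?s q n)" by (rule sum_product)
  finally have "pfilter P (p * q) = (\<Sum>m\<in>keys p. \<Sum>n\<in>keys q. pfilter P (?s p m * ?s q n))"
    by (simp add: pfilter_sum)
  also have "\<dots> = (\<Sum>m\<in>keys p. \<Sum>n\<in>keys q. pfilter P (?s p m) * pfilter P (?s q n))"
    by (intro sum.cong refl) (simp add: mult_single pfilter_single assms)
  also have "\<dots> = pfilter P (\<Sum>m\<in>keys p. ?s p m) * pfilter P (\<Sum>n\<in>keys q. ?s q n)"
    by (simp add: pfilter_sum sum_product)
  finally show ?thesis by (simp flip: poly_sum_singles)
qed

lemma sr_ideal_Pow_iff:
  "p \<in> sr_ideal V (Pow U) \<longleftrightarrow> p \<in> carrier (poly_ring V) \<and> pfilter (\<lambda>m. keys m \<subseteq> U) p = 0"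
proof -
  have "pfilter (\<lambda>m. keys m \<subseteq> U) p = 0 \<longleftrightarrow> keys (pfilter (\<lambda>m. keys m \<subseteq> U) p) = {}" by simp
  then show ?thesis unfolding keys_pfilter by (auto simp: sr_ideal_def)
qed

text \<open>The ideal is the kernel of the substitution of 0 for the variables outside
  \<open>U\<close>, a ring homomorphism by \<open>pfilter_mult\<close>. The order on the variables
  orders the monomials, and thereby the product of nonzero polynomials is nonzero.\<close>

lemma sr_ideal_Pow_prime:
  fixes p q :: "('v::linorder, 'k::field) mvpoly"
  assumes "p * q \<in> sr_ideal V (Pow U)" "p \<in> carrier (poly_ring V)" "q \<in> carrier (poly_ring V)"
  shows "p \<in> sr_ideal V (Pow U) \<or> q \<in> sr_ideal V (Pow U)"
proof -
  have "pfilter (\<lambda>m. keys m \<subseteq> U) p * pfilter (\<lambda>m. keys m \<subseteq> U) q = 0"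
    using assms(1) unfolding sr_ideal_Pow_iff by (subst (asm) pfilter_mult) (auto simp: keys_add_nat)
  then show ?thesis using assms(2,3) unfolding sr_ideal_Pow_iff by auto
qed

lemma krull_dim_sr:
  fixes V :: "'v::linorder set"
  assumes "complex V \<Delta>" "finite V" "\<And>F. F \<in> \<Delta> \<Longrightarrow> card F \<le> \<alpha>" "F \<in> \<Delta>" "card F = \<alpha>"
  shows "krull_dim (quot_ring V (sr_ideal V \<Delta> :: ('v, 'k::field) mvpoly set)) = enat \<alpha>"
proof -
  let ?I = "sr_ideal V \<Delta> :: ('v, 'k) mvpoly set" and ?R = "poly_ring V :: ('v, 'k) mvpoly ring"
  let ?Q = "quot_ring V ?I" and ?h = "quot_map V ?I"
  note id = ideal_sr[OF assms(1), where 'k = 'k]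
  note heq = quot_map_eq_iff[OF id]
  interpret h: ring_hom_ring ?R ?Q ?h by (rule ring_hom_quot_map[OF id])
  have up: "n \<le> \<alpha>" if P: "\<forall>i\<le>n. primeideal (P i) ?Q" "\<forall>i<n. P i \<subset> P (Suc i)" for n P
  proof -
    \<comment> \<open>The chain of primes is pulled back to the polynomial ring, where an element of
      the larger prime outside the smaller one is a nonzerodivisor modulo the smaller one.\<close>
    define J where "J = (\<lambda>i. {p \<in> carrier ?R. ?h p \<in> P i})"
    have J: "primeideal (J i) ?R" if "i \<le> n" for i
      unfolding J_def using h.primeideal_vimage[OF cring_poly_ring, of "P i"] P that by blast
    have "\<exists>p. p \<in> J (Suc i) \<and> p \<notin> J i" if i: "i < n" for i
    proof -
      obtain y where y: "y \<in> P (Suc i)" "y \<notin> P i" using P(2) i by blast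
      have "ideal (P (Suc i)) ?Q" using P(1) i by (simp add: primeideal_def)
      then have "y \<in> carrier ?Q" using y ideal.axioms(1) additive_subgroup.a_subset by blast
      then obtain p where "p \<in> carrier ?R" "y = ?h p" unfolding carrier_quot_ring by blast
      then show ?thesis using y unfolding J_def by blast
    qed
    then obtain f where f: "f i \<in> J (Suc i) \<and> f i \<notin> J i" if "i < n" for i by metis
    have idJ: "ideal (J i) ?R" if "i \<le> n" for i using J[OF that] by (simp add: primeideal_def)
    have "nzd_chain V J f n"
      unfolding nzd_chain_def
    proof (intro conjI allI impI ballI)
      show "1 \<notin> J n"
      proof
        assume "1 \<in> J n"
        then show False
          using primeideal.I_notcarr[OF J[of n]] ideal_eq_carrier[OF idJ[of n]] by simp
      qed
      fix i assume i: "i < n"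
      show "J i \<subseteq> J (Suc i)" using P(2) i by (auto simp: J_def)
      show "f i \<in> J (Suc i)" using f i by blast
      fix g assume g: "g \<in> carrier ?R" "f i * g \<in> J i"
      have "f i \<in> carrier ?R" using f[OF i] by (simp add: J_def)
      then show "g \<in> J i" using primeideal.I_prime[OF J[of i], of "f i" g] g f[OF i] i by simp
    qed (use idJ in auto)
    moreover have "?I \<subseteq> J 0"
    proof
      fix p assume p: "p \<in> ?I"
      have "ideal (P 0) ?Q" using P(1) by (simp add: primeideal_def)
      then have "\<zero>\<^bsub>?Q\<^esub> \<in> P 0" using additive_subgroup.zero_closed ideal.axioms(1) by blast
      moreover have "?h p = \<zero>\<^bsub>?Q\<^esub>" unfolding quot_map_zero[OF id] heq using p by simp
      moreover have "p \<in> carrier ?R" using p by (simp add: sr_ideal_def)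
      ultimately show "p \<in> J 0" by (simp add: J_def del: poly_ring_simps)
    qed
    ultimately show ?thesis using nzd_chain_length_le[OF assms(1-3)] by blast
  qed
  have finF: "finite F" and FV: "F \<subseteq> V"
    using assms(1,2,4) by (auto simp: complex_def intro: finite_subset)
  obtain vs where vs: "set vs = F" "distinct vs" using finite_distinct_list[OF finF] by blast
  have len: "length vs = \<alpha>" using vs assms(5) distinct_card by fastforce
  \<comment> \<open>Dropping the vertices of a largest face one at a time gives ever smaller
    simplices, hence growing prime ideals. All contain \<open>?I\<close> because subsets of
    \<open>F\<close> are faces, and each step adds the variable of the dropped vertex.\<close>
  define P where "P = (\<lambda>i. sr_ideal V (Pow (set (drop i vs))) :: ('v, 'k) mvpoly set)"
  have dropF: "set (drop i vs) \<subseteq> F" for i using set_drop_subset vs(1) by fast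
  have idP: "ideal (P i) ?R" for i
    unfolding P_def by (rule ideal_sr) (use dropF[of i] FV in \<open>auto simp: complex_def\<close>)
  have IP: "?I \<subseteq> P i" for i
    unfolding P_def sr_ideal_def using dropF[of i] complexD[OF assms(1,4)] by (blast dest: order_trans)
  have inP: "?h p \<in> ?h ` P i \<longleftrightarrow> p \<in> P i" for p i
  proof
    assume "?h p \<in> ?h ` P i"
    then obtain q where q: "q \<in> P i" "p - q \<in> ?I" using heq by blast
    then have "(p - q) + q \<in> P i" using IP[of i] ideal_poly_ringD(3)[OF idP] by blast
    then show "p \<in> P i" by simp
  qed simp
  have "primeideal (?h ` P i) ?Q" for i
  proof (rule primeidealI)
    have "?h ` P i = (+>\<^bsub>?R\<^esub>) ?I ` P i" by (simp add: quot_map_def[abs_def])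
    then show "ideal (?h ` P i) ?Q"
      using ring.ring_ideal_imp_quot_ideal[OF ring_poly_ring id idP, of i] unfolding quot_ring_def by simp
    show "cring ?Q" unfolding quot_ring_def by (rule ideal.quotient_is_cring[OF id cring_poly_ring])
    show "carrier ?Q \<noteq> ?h ` P i"
    proof
      assume "carrier ?Q = ?h ` P i"
      then have "?h 1 \<in> ?h ` P i" using h.hom_closed[of 1] by simp
      then show False unfolding inP by (simp add: P_def sr_ideal_def)
    qed
    fix a b assume "a \<in> carrier ?Q" "b \<in> carrier ?Q" and ab: "a \<otimes>\<^bsub>?Q\<^esub> b \<in> ?h ` P i"
    then obtain p q where pq: "p \<in> carrier ?R" "q \<in> carrier ?R" "a = ?h p" "b = ?h q"
      unfolding carrier_quot_ring by blast
    then have "p * q \<in> P i" using ab by (simp add: quot_map_mult[OF id] inP del: poly_ring_simps)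
    then show "a \<in> ?h ` P i \<or> b \<in> ?h ` P i"
      using sr_ideal_Pow_prime[OF _ pq(1,2)] unfolding P_def pq(3,4) by blast
  qed
  moreover have "?h ` P i \<subset> ?h ` P (Suc i)" if i: "i < \<alpha>" for i
  proof
    show "?h ` P i \<subseteq> ?h ` P (Suc i)"
      unfolding P_def sr_ideal_def using set_drop_subset_set_drop[of i "Suc i" vs] by fastforce
    have v: "vs ! i \<in> set (drop i vs)" "vs ! i \<notin> set (drop (Suc i) vs)"
      using vs(2) i len Cons_nth_drop_Suc[of i vs] by (metis distinct.simps(2) distinct_drop list.set_intros(1))+
    have "vs ! i \<in> V" using v(1) dropF FV by blast
    then have "pvar (vs ! i) \<in> P (Suc i)" "pvar (vs ! i) \<notin> P i"
      using v by (auto simp: P_def sr_ideal_def pvar_def)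
    then show "?h ` P i \<noteq> ?h ` P (Suc i)" using inP by (metis imageI)
  qed
  ultimately have "\<exists>P. (\<forall>i\<le>\<alpha>. primeideal (P i) ?Q) \<and> (\<forall>i<\<alpha>. P i \<subset> P (Suc i))"
    by (intro exI[of _ "\<lambda>i. ?h ` P i"]) blast
  then show ?thesis unfolding krull_dim_def
    by (intro antisym Sup_least Sup_upper) (use up in auto)
qed

lemma depth_sr_le:
  fixes V :: "'v set"
  assumes "complex V \<Delta>" "finite V" "\<And>F. F \<in> \<Delta> \<Longrightarrow> card F \<le> \<alpha>"
  shows "depth_quot V (sr_ideal V \<Delta> :: ('v, 'k::field) mvpoly set) \<le> enat \<alpha>"
  unfolding depth_quot_def
proof (rule Sup_least)
  let ?I = "sr_ideal V \<Delta> :: ('v, 'k) mvpoly set"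
  fix x assume "x \<in> {enat (length fs) | fs. set fs \<subseteq> irrelevant_ideal V \<and> regular_sequence_quot (poly_ring V) ?I fs}"
  then obtain fs where x: "x = enat (length fs)" and reg: "regular_sequence_quot (poly_ring V) ?I fs" by blast
  let ?G = "\<lambda>i. ?I \<union> set (take i fs)"
  let ?J = "\<lambda>i. genideal (poly_ring V) (?G i)"
  have "set fs \<subseteq> carrier (poly_ring V)" using reg by (simp add: regular_sequence_quot_def del: poly_ring_simps)
  then have sub: "?G i \<subseteq> carrier (poly_ring V)" for i
    using set_take_subset[of i fs] by (fastforce simp: sr_ideal_def)
  note idJ = genideal_ideal_poly[OF sub]
  have "nzd_chain V ?J (\<lambda>i. fs ! i) (length fs)"
    unfolding nzd_chain_def
  proof (intro conjI allI impI ballI)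
    show "1 \<notin> ?J (length fs)"
    proof
      assume "1 \<in> ?J (length fs)"
      then have "?J (length fs) = carrier (poly_ring V)" by (rule ideal_eq_carrier[OF idJ])
      then show False using reg by (simp add: regular_sequence_quot_def)
    qed
    fix i assume i: "i < length fs"
    have "set (take i fs) \<subseteq> set (take (Suc i) fs)" by (rule set_take_subset_set_take) simp
    then have "?G i \<subseteq> ?J (Suc i)" using genideal_self_poly[OF sub[of "Suc i"]] by blast
    then show "?J i \<subseteq> ?J (Suc i)" by (rule genideal_minimal_poly[OF idJ])
    have "fs ! i \<in> ?G (Suc i)" using i by (simp add: take_Suc_conv_app_nth)
    then show "fs ! i \<in> ?J (Suc i)" using genideal_self_poly[OF sub[of "Suc i"]] by blast
    fix g assume "g \<in> carrier (poly_ring V)" "fs ! i * g \<in> ?J i"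
    then show "g \<in> ?J i" using reg i by (simp add: regular_sequence_quot_def del: poly_ring_simps(1))
  qed (use idJ in auto)
  moreover have "?I \<subseteq> ?J 0" using genideal_self_poly[OF sub[of 0]] by simp
  ultimately have "length fs \<le> \<alpha>" using nzd_chain_length_le[OF assms] by blast
  then show "x \<le> enat \<alpha>" using x by simp
qed

section \<open>Hilbert series by supports, and the h-polynomial\<close>

lemma mon_degree_add: "mon_degree (m + n) = mon_degree m + mon_degree n"
proof -
  have *: "mon_degree k = (\<Sum>v\<in>keys m \<union> keys n. lookup k v)" if "keys k \<subseteq> keys m \<union> keys n" for k :: "'a \<Rightarrow>\<^sub>0 nat"
    unfolding mon_degree_def using that by (intro sum.mono_neutral_left) (auto simp: in_keys_iff)
  have "mon_degree (m + n) = (\<Sum>v\<in>keys m \<union> keys n. lookup (m + n) v)"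
    by (rule *) (simp add: keys_add_nat)
  also have "\<dots> = (\<Sum>v\<in>keys m \<union> keys n. lookup m v) + (\<Sum>v\<in>keys m \<union> keys n. lookup n v)"
    by (simp add: lookup_add sum.distrib)
  also have "\<dots> = mon_degree m + mon_degree n" using *[of m] *[of n] by simp
  finally show ?thesis .
qed

lemma mon_degree_single [simp]: "mon_degree (single v k) = k"
  by (cases "k = 0") (auto simp: mon_degree_def)

lemma mon_degree_sqfree: "finite S \<Longrightarrow> mon_degree (sqfree S) = card S"
  by (simp add: mon_degree_def lookup_sqfree)

definition support_monomials :: "'v set \<Rightarrow> nat \<Rightarrow> ('v \<Rightarrow>\<^sub>0 nat) set" where
  "support_monomials F n = {m. keys m = F \<and> mon_degree m = n}"

lemma finite_support_monomials: "finite F \<Longrightarrow> finite (support_monomials F n)"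
  by (rule finite_subset[OF _ finite_degree_monomials[of F "Pow F" n]])
     (auto simp: support_monomials_def degree_monomials_def complex_def)

text \<open>Division by \<open>v\<close> is a bijection onto monomials of degree one less, whose
  support either keeps \<open>v\<close> or loses it.\<close>

lemma card_support_monomials_Suc:
  assumes "finite F" "v \<notin> F"
  shows "card (support_monomials (insert v F) (Suc n))
    = card (support_monomials (insert v F) n) + card (support_monomials F n)"
proof -
  let ?A = "support_monomials (insert v F)" and ?B = "support_monomials F"
  have "bij_betw (\<lambda>m. m + single v 1) (?A n \<union> ?B n) (?A (Suc n))"
  proof (rule bij_betw_imageI)
    show "inj_on (\<lambda>m. m + single v 1) (?A n \<union> ?B n)" by (auto simp: inj_on_def)
    show "(\<lambda>m. m + single v 1) ` (?A n \<union> ?B n) = ?A (Suc n)"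
    proof
      show "(\<lambda>m. m + single v 1) ` (?A n \<union> ?B n) \<subseteq> ?A (Suc n)"
      proof (rule image_subsetI)
        fix m assume "m \<in> ?A n \<union> ?B n"
        then have "keys m \<union> {v} = insert v F" "mon_degree m = n"
          unfolding support_monomials_def by blast+
        then show "m + single v 1 \<in> ?A (Suc n)"
          by (simp add: support_monomials_def keys_add_nat mon_degree_add)
      qed
      show "?A (Suc n) \<subseteq> (\<lambda>m. m + single v 1) ` (?A n \<union> ?B n)"
      proof
        fix m assume m: "m \<in> ?A (Suc n)"
        let ?k = "m - single v 1"
        have e: "?k + single v 1 = m"
          using sqfree_minus_add[of "{v}" m] m by (simp add: support_monomials_def sqfree_single add.commute)
        have "insert v (keys ?k) = insert v F"
          using arg_cong[OF e, of keys] m by (simp add: keys_add_nat support_monomials_def)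
        then have "keys ?k = insert v F \<or> keys ?k = F"
          using assms(2) by (metis insert_absorb insert_ident)
        moreover have "mon_degree ?k = n"
          using arg_cong[OF e, of mon_degree] m by (simp add: mon_degree_add support_monomials_def)
        ultimately have "?k \<in> ?A n \<union> ?B n" unfolding support_monomials_def by simp
        then show "m \<in> (\<lambda>m. m + single v 1) ` (?A n \<union> ?B n)" using e by (metis imageI)
      qed
    qed
  qed
  then have "card (?A (Suc n)) = card (?A n \<union> ?B n)" by (simp add: bij_betw_same_card)
  also have "\<dots> = card (?A n) + card (?B n)"
    using assms finite_support_monomials[of F n] finite_support_monomials[of "insert v F" n]
    by (intro card_Un_disjoint) (auto simp: support_monomials_def)
  finally show ?thesis .
qed

definition support_series :: "'v set \<Rightarrow> int fps" where
  "support_series F = Abs_fps (\<lambda>n. int (card (support_monomials F n)))"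

text \<open>The monomials with support exactly F have generating function (t/(1-t))^|F|: each
  variable of F occurs with a positive exponent.\<close>

lemma support_series:
  fixes F :: "'v set"
  shows "finite F \<Longrightarrow> support_series F * (1 - fps_X) ^ card F = fps_X ^ card F"
proof (induct F rule: finite_induct)
  case empty
  have "support_monomials ({} :: 'v set) n = (if n = 0 then {0} else {})" for n
    by (auto simp: support_monomials_def mon_degree_def)
  then have "support_series ({} :: 'v set) = 1" by (simp add: support_series_def fps_eq_iff)
  then show ?case by simp
next
  case (insert v F)
  have "support_series (insert v F) * (1 - fps_X) = support_series F * fps_X"
  proof (rule fps_ext)
    fix n
    have "support_monomials (insert v F) 0 = {}"
    proof -
      have False if m: "keys m = insert v F" "mon_degree m = 0" for m
      proof -
        have "v \<in> keys m" using m(1) by blast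
        then show False using lookup_le_mon_degree[of m v] m(2) by (simp add: in_keys_iff)
      qed
      then show ?thesis unfolding support_monomials_def by blast
    qed
    then show "fps_nth (support_series (insert v F) * (1 - fps_X)) n = fps_nth (support_series F * fps_X) n"
      by (cases n) (simp_all add: right_diff_distrib support_series_def card_support_monomials_Suc[OF insert(1,2)])
  qed
  then have "support_series (insert v F) * (1 - fps_X) ^ card (insert v F)
      = fps_X * (support_series F * (1 - fps_X) ^ card F)"
    using insert(1,2) by (simp add: mult.assoc[symmetric])
  then show ?case using insert by simp
qed

text \<open>The sum of (t/(1-t))^|F| over all faces, multiplied by (1-t)^\<alpha>; the polynomial
  \<open>[:1, -1:]\<close> is 1 - t.\<close>

definition h_poly_of_complex :: "nat \<Rightarrow> 'v set set \<Rightarrow> int poly" where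
  "h_poly_of_complex \<alpha> \<Delta> = (\<Sum>F\<in>\<Delta>. monom 1 (card F) * [:1, -1:] ^ (\<alpha> - card F))"

lemma h_poly_sr:
  fixes V :: "'v::linorder set"
  assumes "complex V \<Delta>" "finite V" "\<And>F. F \<in> \<Delta> \<Longrightarrow> card F \<le> \<alpha>" "F0 \<in> \<Delta>" "card F0 = \<alpha>"
  shows "h_poly V (sr_ideal V \<Delta> :: ('v, 'k::field) mvpoly set) = h_poly_of_complex \<alpha> \<Delta>"
proof -
  have fin\<Delta>: "finite \<Delta>" using assms(1,2) by (meson complex_def finite_Pow_iff finite_subset)
  have finF: "finite F" if "F \<in> \<Delta>" for F
    using assms(1,2) that by (meson PowD complex_def finite_subset subsetD)
  let ?I = "sr_ideal V \<Delta> :: ('v, 'k) mvpoly set"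
  have "{} \<in> \<Delta>" using complexD[OF assms(1,4)] by simp
  then have "hilbert_series V ?I = (\<Sum>F\<in>\<Delta>. support_series F)"
  proof (intro fps_ext)
    fix n
    have "degree_monomials \<Delta> n = (\<Union>F\<in>\<Delta>. support_monomials F n)"
      by (auto simp: degree_monomials_def support_monomials_def)
    also have "card \<dots> = (\<Sum>F\<in>\<Delta>. card (support_monomials F n))"
      using fin\<Delta> finF finite_support_monomials
      by (intro card_UN_disjoint) (auto simp: support_monomials_def)
    finally show "fps_nth (hilbert_series V ?I) n = fps_nth (\<Sum>F\<in>\<Delta>. support_series F) n"
      using hilbert_function_sr[OF assms(1,2) \<open>{} \<in> \<Delta>\<close>, where 'k = 'k]
      by (simp add: hilbert_series_def fps_sum_nth support_series_def)
  qed
  then have "hilbert_series V ?I * (1 - fps_X) ^ \<alpha> = (\<Sum>F\<in>\<Delta>. support_series F * (1 - fps_X) ^ \<alpha>)"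
    by (simp add: sum_distrib_right)
  also have "\<dots> = (\<Sum>F\<in>\<Delta>. fps_X ^ card F * (1 - fps_X) ^ (\<alpha> - card F))"
  proof (rule sum.cong[OF refl])
    fix F assume F: "F \<in> \<Delta>"
    have "(1 - fps_X :: int fps) ^ \<alpha> = (1 - fps_X) ^ card F * (1 - fps_X) ^ (\<alpha> - card F)"
      using assms(3)[OF F] by (simp add: power_add[symmetric])
    then show "support_series F * (1 - fps_X) ^ \<alpha> = fps_X ^ card F * (1 - fps_X) ^ (\<alpha> - card F)"
      using support_series[OF finF[OF F]] by (metis mult.assoc)
  qed
  also have "\<dots> = fps_of_poly (h_poly_of_complex \<alpha> \<Delta>)"
  proof -
    have *: "fps_of_poly [:1, -1:] = (1 - fps_X :: int fps)"
      by (simp add: fps_of_poly_pCons fps_eq_iff)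
    show ?thesis
      unfolding h_poly_of_complex_def fps_of_poly_sum fps_of_poly_mult fps_of_poly_power fps_of_poly_monom' * ..
  qed
  finally have "hilbert_series V ?I * (1 - fps_X) ^ \<alpha> = fps_of_poly (h_poly_of_complex \<alpha> \<Delta>)" .
  note H = this
  have "the_enat (krull_dim (quot_ring V ?I)) = \<alpha>"
    using krull_dim_sr[OF assms, where 'k = 'k] by simp
  \<comment> \<open>The definite description in \<open>h_poly\<close> has this as its only solution
    because \<open>fps_of_poly\<close> is injective.\<close>
  then show ?thesis unfolding h_poly_def using H by (simp add: fps_of_poly_eq_iff)
qed

text \<open>At t = 1 every factor 1 - t vanishes, so only the summands without such a factor
  survive: the multiplicity counts the faces of maximal size.\<close>

lemma poly_h_poly_of_complex_1:
  assumes "finite \<Delta>" "\<And>F. F \<in> \<Delta> \<Longrightarrow> card F \<le> \<alpha>"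
  shows "poly (h_poly_of_complex \<alpha> \<Delta>) 1 = int (card {F\<in>\<Delta>. card F = \<alpha>})"
proof -
  have "poly (h_poly_of_complex \<alpha> \<Delta>) 1 = (\<Sum>F\<in>\<Delta>. 0 ^ (\<alpha> - card F))"
    by (simp add: h_poly_of_complex_def poly_sum poly_monom)
  also have "\<dots> = (\<Sum>F\<in>\<Delta>. if card F = \<alpha> then 1 else 0)"
    by (rule sum.cong[OF refl]) (use assms(2) in \<open>auto simp: power_0_left dest: le_antisym\<close>)
  also have "\<dots> = int (card {F\<in>\<Delta>. card F = \<alpha>})"
    using assms(1) by (simp add: sum.If_cases Int_def)
  finally show ?thesis .
qed

text \<open>Every summand has degree exactly \<alpha>, so the degree can drop only by cancellation
  of leading coefficients. Their sum is, up to sign, the reduced Euler characteristic.\<close>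

lemma degree_h_poly_of_complex:
  assumes "finite \<Delta>" "\<And>F. F \<in> \<Delta> \<Longrightarrow> card F \<le> \<alpha>" "(\<Sum>F\<in>\<Delta>. (-1) ^ (\<alpha> - card F)) \<noteq> (0::int)"
  shows "Polynomial.degree (h_poly_of_complex \<alpha> \<Delta>) = \<alpha>"
proof (rule antisym)
  let ?p = "\<lambda>F. monom 1 (card F) * [:1, -1:] ^ (\<alpha> - card F) :: int poly"
  have deg: "Polynomial.degree (?p F) = \<alpha>" if "F \<in> \<Delta>" for F
  proof -
    have "Polynomial.degree (?p F)
        = Polynomial.degree (monom (1 :: int) (card F)) + Polynomial.degree ([:1, -1:] ^ (\<alpha> - card F) :: int poly)"
      by (rule degree_mult_eq) auto
    also have "\<dots> = card F + (\<alpha> - card F)"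
      by (subst Polynomial.degree_monom_eq) (auto simp: degree_power_eq)
    finally show ?thesis using assms(2)[OF that] by simp
  qed
  have "lead_coeff (?p F) = (-1) ^ (\<alpha> - card F)" for F
    by (simp add: lead_coeff_mult lead_coeff_power Polynomial.degree_monom_eq)
  then have "poly.coeff (?p F) \<alpha> = (-1) ^ (\<alpha> - card F)" if "F \<in> \<Delta>" for F
    using deg[OF that] by metis
  then have "poly.coeff (h_poly_of_complex \<alpha> \<Delta>) \<alpha> = (\<Sum>F\<in>\<Delta>. (-1) ^ (\<alpha> - card F))"
    by (simp add: h_poly_of_complex_def coeff_sum)
  then show "\<alpha> \<le> Polynomial.degree (h_poly_of_complex \<alpha> \<Delta>)" using assms(3) by (intro le_degree) simp
  show "Polynomial.degree (h_poly_of_complex \<alpha> \<Delta>) \<le> \<alpha>"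
    unfolding h_poly_of_complex_def by (rule degree_sum_le[OF assms(1)]) (simp only: deg order_refl)
qed

section \<open>Koszul complexes\<close>

text \<open>The sign of moving \<open>v\<close> to its place in the increasing order of the elements
  of \<open>S\<close>.\<close>

definition esign :: "'i::linorder \<Rightarrow> 'i set \<Rightarrow> 'a::comm_ring_1" where
  "esign v S = (- 1) ^ card {w\<in>S. w < v}"

lemma esign_cases: "esign (v :: 'i::linorder) S = (1 :: 'a::comm_ring_1) \<or> esign v S = (- 1 :: 'a)"
  unfolding esign_def using neg_one_even_power neg_one_odd_power by (cases "even (card {w\<in>S. w < v})") auto

text \<open>The Koszul differential on the elements \<open>c v\<close>, read off at the target: a
  chain is the function T -> coefficient of e_T, and the value at \<open>S\<close> collects the
  basis elements one larger. For constant \<open>c = 1\<close> it is the augmented chain complex of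
  a simplex, the form used for the Taylor resolution.\<close>

definition kos :: "'i::linorder set \<Rightarrow> ('i \<Rightarrow> 'a::comm_ring_1) \<Rightarrow> ('i set \<Rightarrow> 'a) \<Rightarrow> 'i set \<Rightarrow> 'a" where
  "kos W c g S = (\<Sum>v\<in>W - S. esign v S * c v * g (insert v S))"

text \<open>Exterior multiplication by e_x, the contracting homotopy of the Koszul complex.\<close>

definition kcone :: "'i::linorder \<Rightarrow> ('i set \<Rightarrow> 'a::comm_ring_1) \<Rightarrow> 'i set \<Rightarrow> 'a" where
  "kcone x g T = (if x \<in> T then esign x T * g (T - {x}) else 0)"

lemma esign_square: "esign (v :: 'i::linorder) S * esign v S = (1 :: 'a::comm_ring_1)"
  using esign_cases[of v S, where 'a = 'a] by auto

lemma esign_insert_self: "esign v (insert v S) = esign v S"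
proof -
  have "{w \<in> insert v S. w < v} = {w\<in>S. w < v}" by auto
  then show ?thesis by (simp add: esign_def)
qed

lemma esign_remove_self: "esign v (S - {v}) = esign v S"
  by (metis esign_insert_self insert_Diff_single)

lemma esign_insert:
  assumes "finite S" "u \<notin> S"
  shows "esign v (insert u S) = (if u < v then - esign v S else esign v S)"
proof -
  have "{w \<in> insert u S. w < v} = (if u < v then insert u {w\<in>S. w < v} else {w\<in>S. w < v})"
    by auto
  then show ?thesis using assms by (simp add: esign_def)
qed

lemma esign_swap:
  assumes "finite S" "u \<notin> S" "v \<notin> S" "u \<noteq> v"
  shows "esign v S * esign u (insert v S) = - (esign u S * esign v (insert u S))"
  using assms by (auto simp: esign_insert)

text \<open>Swapping the indices only yields that the sum equals its negative, which is not enough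
  in characteristic 2; the terms are therefore cancelled in pairs by induction.\<close>

lemma sum_antisymmetric:
  fixes t :: "'i \<Rightarrow> 'i \<Rightarrow> 'a::ab_group_add"
  assumes "finite A" "\<And>u v. u \<in> A \<Longrightarrow> v \<in> A \<Longrightarrow> u \<noteq> v \<Longrightarrow> t u v = - t v u"
  shows "(\<Sum>u\<in>A. \<Sum>v\<in>A - {u}. t u v) = 0"
  using assms
proof (induct A)
  case (insert a A)
  have "(\<Sum>u\<in>insert a A. \<Sum>v\<in>insert a A - {u}. t u v)
      = (\<Sum>v\<in>A. t a v) + (\<Sum>u\<in>A. \<Sum>v\<in>insert a A - {u}. t u v)"
    using insert(1,2) by simp
  also have "(\<Sum>u\<in>A. \<Sum>v\<in>insert a A - {u}. t u v) = (\<Sum>u\<in>A. t u a + (\<Sum>v\<in>A - {u}. t u v))"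
  proof (rule sum.cong[OF refl])
    fix u assume "u \<in> A"
    then have "insert a A - {u} = insert a (A - {u})" using insert(2) by auto
    then show "(\<Sum>v\<in>insert a A - {u}. t u v) = t u a + (\<Sum>v\<in>A - {u}. t u v)"
      using insert(1,2) by simp
  qed
  also have "\<dots> = (\<Sum>u\<in>A. t u a)"
  proof -
    have "(\<Sum>u\<in>A. \<Sum>v\<in>A - {u}. t u v) = 0" by (rule insert(3)) (rule insert(4), simp_all)
    then show ?thesis by (simp add: sum.distrib)
  qed
  also have "(\<Sum>u\<in>A. t u a) = (\<Sum>u\<in>A. - t a u)"
    using insert(2) insert(4)[of _ a] by (intro sum.cong refl) auto
  finally show ?case by (simp add: sum_negf)
qed simp

lemma kos_kos:
  assumes "finite W" "finite S"
  shows "kos W c (kos W c g) S = 0"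
proof -
  let ?t = "\<lambda>v u. esign v S * c v * (esign u (insert v S) * c u * g (insert u (insert v S)))"
  have "kos W c (kos W c g) S = (\<Sum>v\<in>W - S. \<Sum>u\<in>W - S - {v}. ?t v u)"
    unfolding kos_def sum_distrib_left
    by (intro sum.cong refl) auto
  also have "\<dots> = 0"
  proof (rule sum_antisymmetric)
    fix u v assume *: "u \<in> W - S" "v \<in> W - S" "u \<noteq> v"
    have "?t u v = (esign u S * esign v (insert u S)) * (c v * c u * g (insert u (insert v S)))"
      by (simp add: insert_commute mult_ac)
    also have "esign u S * esign v (insert u S) = - (esign v S * esign u (insert v S) :: 'b)"
      using esign_swap[OF assms(2), of v u] * by auto
    finally show "?t u v = - ?t v u" by (simp add: insert_commute mult_ac)
  qed (use assms in auto)
  finally show ?thesis .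
qed

text \<open>The homotopy identity d h + h d = c x. Outside sets containing \<open>x\<close> only the
  summand v = x survives; on sets containing \<open>x\<close> all other summands cancel by the sign
  rule for two insertions. Consequently \<open>c x\<close> annihilates Koszul homology.\<close>

lemma kos_kcone:
  assumes "finite W" "finite S" "x \<in> W"
  shows "kos W c (kcone x g) S + kcone x (kos W c g) S = c x * (g S :: 'a::comm_ring_1)"
proof (cases "x \<in> S")
  case False
  have "kos W c (kcone x g) S = (\<Sum>v\<in>W - S. if v = x then c x * g S else 0)"
    unfolding kos_def
  proof (rule sum.cong[OF refl])
    fix v assume "v \<in> W - S"
    have "esign x S * c x * (esign x (insert x S) * g (insert x S - {x})) = c x * g S"
    proof -
      have "esign x S * c x * (esign x S * g S) = esign x S * esign x S * (c x * g S)" by (simp add: mult_ac)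
      then show ?thesis using False by (simp add: esign_insert_self esign_square)
    qed
    then show "esign v S * c v * kcone x g (insert v S) = (if v = x then c x * g S else 0)"
      using False by (auto simp: kcone_def)
  qed
  also have "\<dots> = c x * g S" using assms False by (simp add: sum.delta)
  finally show ?thesis using False by (simp add: kcone_def)
next
  case True
  define S' where "S' = S - {x}"
  have S: "S = insert x S'" "x \<notin> S'" "finite S'" using True assms(2) by (auto simp: S'_def)
  have "kos W c (kcone x g) S = (\<Sum>v\<in>W - S. - (esign x S * (esign v S' * c v * g (insert v S'))))"
    unfolding kos_def
  proof (rule sum.cong[OF refl])
    fix v assume v: "v \<in> W - S"
    then have 1: "insert v S - {x} = insert v S'" using S by auto
    have 2: "esign v (insert x S') * esign x (insert v S') = - (esign x S' * esign v S' :: 'a)"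
      using v S by (auto simp: esign_insert)
    have 3: "esign x (insert v S) = (esign x (insert v S') :: 'a)"
      using S by (metis esign_insert_self insert_commute)
    have "esign v S * c v * kcone x g (insert v S) = (esign v S * esign x (insert v S)) * (c v * g (insert v S'))"
      using True 1 by (simp add: kcone_def mult_ac)
    also have "esign v S * esign x (insert v S) = - (esign x S' * esign v S' :: 'a)"
      unfolding 3 using 2 S(1) by simp
    also have "esign x S' = (esign x S :: 'a)" unfolding S'_def by (rule esign_remove_self)
    finally show "esign v S * c v * kcone x g (insert v S) = - (esign x S * (esign v S' * c v * g (insert v S')))"
      by (simp add: mult_ac)
  qed
  moreover have "kcone x (kos W c g) S
      = c x * g S + (\<Sum>v\<in>W - S. esign x S * (esign v S' * c v * g (insert v S')))"
  proof -
    have "W - S' = insert x (W - S)" using True assms(3) by (auto simp: S'_def)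
    then have "kos W c g S' = (\<Sum>v\<in>insert x (W - S). esign v S' * c v * g (insert v S'))"
      unfolding kos_def by simp
    also have "\<dots> = esign x S' * c x * g S + (\<Sum>v\<in>W - S. esign v S' * c v * g (insert v S'))"
      using True assms(1) by (simp flip: S(1))
    finally have "kos W c g S' = esign x S' * c x * g S + (\<Sum>v\<in>W - S. esign v S' * c v * g (insert v S'))" .
    moreover have "esign x S' = (esign x S :: 'a)" unfolding S'_def by (rule esign_remove_self)
    ultimately have "kcone x (kos W c g) S = esign x S * esign x S * (c x * g S)
        + (\<Sum>v\<in>W - S. esign x S * (esign v S' * c v * g (insert v S')))"
      using True by (simp add: kcone_def S'_def[symmetric] distrib_left sum_distrib_left mult.assoc)
    then show ?thesis by (simp add: esign_square)
  qed
  ultimately show ?thesis by (simp add: sum_negf)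
qed

lemma kos_add: "kos W c (\<lambda>T. f T + g T) S = kos W c f S + kos W c g S"
  by (simp add: kos_def distrib_left sum.distrib)

lemma kos_diff: "kos W c (\<lambda>T. f T - g T) S = kos W c f S - kos W c g S"
  by (simp add: kos_def right_diff_distrib sum_subtractf)

lemma kos_scale: "kos W c (\<lambda>T. a * g T) S = a * kos W c g S"
  by (simp add: kos_def sum_distrib_left mult_ac)

lemma kos_sum: "kos W c (\<lambda>T. \<Sum>i\<in>I. g i T) S = (\<Sum>i\<in>I. kos W c (g i) S)"
  unfolding kos_def sum_distrib_left by (rule sum.swap)

lemma kos_cong: "(\<And>v. v \<in> W - S \<Longrightarrow> f (insert v S) = g (insert v S)) \<Longrightarrow> kos W c f S = kos W c g S"
  unfolding kos_def by (rule sum.cong) auto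

section \<open>Homogeneous Koszul chains and the vanishing of their homology\<close>

lemma homog_iff: "p \<in> homog V c \<longleftrightarrow> (\<forall>m\<in>keys p. keys m \<subseteq> V \<and> int (mon_degree m) = c)"
  by (auto simp: homog_def)

lemma homog_carrier: "p \<in> homog V c \<Longrightarrow> p \<in> carrier (poly_ring V)"
  by (simp add: homog_def)

lemma homog_zero [simp]: "0 \<in> homog V c"
  by (simp add: homog_iff)

lemma homog_add: "p \<in> homog V c \<Longrightarrow> q \<in> homog V c \<Longrightarrow> p + q \<in> homog V c"
  unfolding homog_iff using subsetD[OF Poly_Mapping.keys_add[of p q]] by blast

lemma homog_uminus: "p \<in> homog V c \<Longrightarrow> - p \<in> homog V c"
  unfolding homog_iff by (simp add: in_keys_iff)

lemma homog_diff: "p \<in> homog V c \<Longrightarrow> q \<in> homog V c \<Longrightarrow> p - q \<in> homog V c"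
  using homog_add[of p V c "- q"] homog_uminus by fastforce

lemma homog_sum: "(\<And>i. i \<in> A \<Longrightarrow> f i \<in> homog V c) \<Longrightarrow> (\<Sum>i\<in>A. f i) \<in> homog V c"
  by (induct A rule: infinite_finite_induct) (auto intro: homog_add)

lemma homog_mult:
  assumes "p \<in> homog V a" "q \<in> homog V b"
  shows "p * q \<in> homog V (a + b)"
  unfolding homog_iff
proof
  fix m assume "m \<in> keys (p * q)"
  then obtain k l where kl: "k \<in> keys p" "l \<in> keys q" "m = k + l" by (rule keys_mult_elem)
  have "keys k \<subseteq> V \<and> int (mon_degree k) = a" "keys l \<subseteq> V \<and> int (mon_degree l) = b"
    using assms kl(1,2) unfolding homog_iff by blast+
  then show "keys m \<subseteq> V \<and> int (mon_degree m) = a + b"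
    unfolding kl(3) by (simp add: keys_add_nat mon_degree_add)
qed

lemma homog_pvar: "v \<in> V \<Longrightarrow> pvar v \<in> homog V 1"
  by (simp add: homog_iff pvar_def)

lemma homog_esign: "p \<in> homog V c \<Longrightarrow> esign v S * p \<in> homog V c"
  for p :: "('v, 'k::field) mvpoly"
  using esign_cases[of v S, where 'a = "('v, 'k) mvpoly"] homog_uminus by auto

text \<open>Here \<open>c\<close> is the degree of the coefficients, so the internal degree of the
  chain is q + c; the differential lowers q and raises c by one. Prescribing zero elsewhere makes a
  chain determined by its values on the sets of size q.\<close>

definition kchain :: "'v set \<Rightarrow> nat \<Rightarrow> int \<Rightarrow> ('v set \<Rightarrow> ('v, 'k::field) mvpoly) set" where
  "kchain V q c = {z. \<forall>T. (T \<subseteq> V \<and> card T = q \<longrightarrow> z T \<in> homog V c) \<and> (\<not> (T \<subseteq> V \<and> card T = q) \<longrightarrow> z T = 0)}"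

lemma kchain_homog: "z \<in> kchain V q c \<Longrightarrow> z T \<in> homog V c"
  unfolding kchain_def by (metis (mono_tags, lifting) homog_zero mem_Collect_eq)

lemma kchain_zero: "z \<in> kchain V q c \<Longrightarrow> \<not> (T \<subseteq> V \<and> card T = q) \<Longrightarrow> z T = 0"
  unfolding kchain_def by blast

lemma kchainI:
  assumes "\<And>T. z T \<in> homog V c" "\<And>T. \<not> (T \<subseteq> V \<and> card T = q) \<Longrightarrow> z T = 0"
  shows "z \<in> kchain V q c"
  using assms unfolding kchain_def by blast

lemma kchain_add: "f \<in> kchain V q c \<Longrightarrow> g \<in> kchain V q c \<Longrightarrow> (\<lambda>T. f T + g T) \<in> kchain V q c"
  by (rule kchainI) (simp_all add: homog_add kchain_homog kchain_zero)

lemma kchain_diff: "f \<in> kchain V q c \<Longrightarrow> g \<in> kchain V q c \<Longrightarrow> (\<lambda>T. f T - g T) \<in> kchain V q c"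
  by (rule kchainI) (simp_all add: homog_diff kchain_homog kchain_zero)

lemma kchain_scale: "p \<in> homog V a \<Longrightarrow> g \<in> kchain V q c \<Longrightarrow> (\<lambda>T. p * g T) \<in> kchain V q (a + c)"
  by (rule kchainI) (simp_all add: homog_mult kchain_homog kchain_zero)

lemma kos_kchain:
  assumes "finite V" "z \<in> kchain V (Suc q) c"
  shows "kos V pvar z \<in> kchain V q (c + 1)"
proof (rule kchainI)
  fix T
  show "kos V pvar z T \<in> homog V (c + 1)"
    unfolding kos_def
  proof (rule homog_sum)
    fix v assume "v \<in> V - T"
    then have "pvar v * z (insert v T) \<in> homog V (1 + c)"
      using homog_mult[OF homog_pvar kchain_homog[OF assms(2)]] by blast
    then show "esign v T * pvar v * z (insert v T) \<in> homog V (c + 1)"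
      using homog_esign by (simp add: add.commute mult.assoc)
  qed
  assume T: "\<not> (T \<subseteq> V \<and> card T = q)"
  have "z (insert v T) = 0" if v: "v \<in> V - T" for v
  proof (rule kchain_zero[OF assms(2)])
    show "\<not> (insert v T \<subseteq> V \<and> card (insert v T) = Suc q)"
    proof
      assume *: "insert v T \<subseteq> V \<and> card (insert v T) = Suc q"
      then have "T \<subseteq> V" by simp
      then have "finite T" by (rule finite_subset[OF _ assms(1)])
      then show False using T * v by auto
    qed
  qed
  then show "kos V pvar z T = 0" unfolding kos_def by (simp add: sum.neutral)
qed

lemma kcone_kchain:
  assumes "finite V" "x \<in> V" "z \<in> kchain V q c"
  shows "kcone x z \<in> kchain V (Suc q) c"
proof (rule kchainI)
  fix T
  show "kcone x z T \<in> homog V c"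
    unfolding kcone_def by (simp add: homog_esign kchain_homog[OF assms(3)])
  assume T: "\<not> (T \<subseteq> V \<and> card T = Suc q)"
  have "z (T - {x}) = 0" if x: "x \<in> T"
  proof (rule kchain_zero[OF assms(3)])
    show "\<not> (T - {x} \<subseteq> V \<and> card (T - {x}) = q)"
    proof
      assume *: "T - {x} \<subseteq> V \<and> card (T - {x}) = q"
      then have "finite (T - {x})" by (intro finite_subset[OF _ assms(1)]) simp
      then have "card T = Suc q" using * x by (metis card_Suc_Diff1 finite_Diff2 finite.emptyI finite_insert)
      then show False using T * assms(2) by auto
    qed
  qed
  then show "kcone x z T = 0" by (simp add: kcone_def)
qed

text \<open>The Koszul homology \<open>H_q(x; S/J)\<close> vanishes in internal degrees \<open>> q + r\<close>.\<close>

definition koszul_vanishing :: "'v::linorder set \<Rightarrow> ('v, 'k::field) mvpoly set \<Rightarrow> int \<Rightarrow> bool" where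
  "koszul_vanishing V J r \<longleftrightarrow> (\<forall>q c. \<forall>z\<in>kchain V q c. r < c \<longrightarrow> (\<forall>S\<subseteq>V. kos V pvar z S \<in> J) \<longrightarrow>
     (\<exists>w\<in>kchain V (Suc q) (c - 1). \<forall>S\<subseteq>V. z S - kos V pvar w S \<in> J))"

text \<open>For a vertex x, the Stanley-Reisner ideal of the star is I : x and that of the deletion
  is (I, x); these are the two ideals of the induction on the vertices.\<close>

definition star :: "'v \<Rightarrow> 'v set set \<Rightarrow> 'v set set" where
  "star x \<Delta> = {F. insert x F \<in> \<Delta>}"

definition deletion :: "'v \<Rightarrow> 'v set set \<Rightarrow> 'v set set" where
  "deletion x \<Delta> = {F\<in>\<Delta>. x \<notin> F}"

lemma sr_ideal_carrier: "p \<in> sr_ideal V \<Delta> \<Longrightarrow> p \<in> carrier (poly_ring V)"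
  by (simp add: sr_ideal_def)

lemma pvar_mult_sr_iff:
  assumes "x \<in> V" "p \<in> carrier (poly_ring V)"
  shows "pvar x * p \<in> sr_ideal V \<Delta> \<longleftrightarrow> p \<in> sr_ideal V (star x \<Delta>)"
  using assms carrier_closed(2)[OF pvar_in_carrier[OF assms(1)] assms(2)]
  by (auto simp: sr_ideal_def star_def keys_add_nat keys_single_mult pvar_def simp del: poly_ring_simps)

text \<open>Division by x, with the monomials that x does not divide thrown away.\<close>

definition var_quotient :: "'v \<Rightarrow> ('v, 'k::field) mvpoly \<Rightarrow> ('v, 'k) mvpoly" where
  "var_quotient x p = Poly_Mapping.map_key (\<lambda>m. single x 1 + m) p"

lemma lookup_var_quotient: "lookup (var_quotient x p) m = lookup p (single x 1 + m)"
  unfolding var_quotient_def by (subst map_key.rep_eq) (auto simp: inj_on_def)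

lemma pvar_mult_var_quotient:
  assumes "\<And>m. m \<in> keys p \<Longrightarrow> x \<in> keys m"
  shows "pvar x * var_quotient x p = p"
proof (rule poly_mapping_eqI)
  fix m
  show "lookup (pvar x * var_quotient x p) m = lookup p m"
  proof (cases "\<exists>n. m = single x 1 + n")
    case True
    then show ?thesis by (auto simp: pvar_def lookup_single_mult_add lookup_var_quotient)
  next
    case False
    then have "x \<notin> keys m" using sqfree_dvd_iff[of "{x}" m] by (simp add: sqfree_single)
    then have "lookup p m = 0" using assms by (metis in_keys_iff)
    moreover have "lookup (pvar x * var_quotient x p) m = 0"
      unfolding pvar_def by (rule lookup_single_mult_not) (use False in blast)
    ultimately show ?thesis by simp
  qed
qed

lemma homog_var_quotient: "p \<in> homog V c \<Longrightarrow> var_quotient x p \<in> homog V (c - 1)"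
proof -
  assume p: "p \<in> homog V c"
  show ?thesis unfolding homog_iff
  proof
    fix m assume "m \<in> keys (var_quotient x p)"
    then have "single x 1 + m \<in> keys p" by (simp add: in_keys_iff lookup_var_quotient)
    then have "keys (single x 1 + m) \<subseteq> V \<and> int (mon_degree (single x 1 + m)) = c"
      using p unfolding homog_iff by blast
    then show "keys m \<subseteq> V \<and> int (mon_degree m) = c - 1"
      by (simp add: keys_add_nat mon_degree_add)
  qed
qed

lemma ideal_esign_mult:
  fixes J :: "('v, 'k::field) mvpoly set"
  assumes "ideal J (poly_ring V)" "p \<in> J"
  shows "esign v S * p \<in> J"
  using esign_cases[of v S, where 'a = "('v, 'k) mvpoly"] assms(2) ideal_poly_ringD(5)[OF assms]
  by (elim disjE) simp_all

lemma kos_mem_ideal: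
  fixes J :: "('v::linorder, 'k::field) mvpoly set"
  assumes "ideal J (poly_ring V)" "S \<subseteq> V" "\<And>T. T \<subseteq> V \<Longrightarrow> z T \<in> J"
  shows "kos V pvar z S \<in> J"
  unfolding kos_def
proof (rule ideal_sum_closed[OF assms(1)])
  fix v assume v: "v \<in> V - S"
  then have "z (insert v S) \<in> J" using assms(2,3) by auto
  then have "pvar v * z (insert v S) \<in> J"
    by (rule ideal_poly_ringD(4)[OF assms(1)]) (use v in \<open>simp add: pvar_def\<close>)
  then show "esign v S * pvar v * z (insert v S) \<in> J"
    unfolding mult.assoc by (rule ideal_esign_mult[OF assms(1)])
qed

text \<open>Modulo (I, x) the cycle z is the boundary of some w. The remainder z - dw lies in (I,
  x), so modulo I it is x y with y of degree one less. As z and dw are cycles modulo I, so is x y,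
  which makes y a cycle modulo I : x.\<close>

lemma koszul_decompose:
  fixes z :: "'v::linorder set \<Rightarrow> ('v, 'k::field) mvpoly"
  assumes "complex V \<Delta>" "finite V" "x \<in> V"
    and "koszul_vanishing V (sr_ideal V (deletion x \<Delta>) :: ('v, 'k) mvpoly set) r"
    and "z \<in> kchain V q c" "r < c" "\<And>S. S \<subseteq> V \<Longrightarrow> kos V pvar z S \<in> sr_ideal V \<Delta>"
  obtains w y where "w \<in> kchain V (Suc q) (c - 1)" "y \<in> kchain V q (c - 1)"
    and "\<And>S. S \<subseteq> V \<Longrightarrow> z S - kos V pvar w S - pvar x * y S \<in> sr_ideal V \<Delta>"
    and "\<And>S. S \<subseteq> V \<Longrightarrow> kos V pvar y S \<in> sr_ideal V (star x \<Delta>)"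
proof -
  let ?D = "kos V pvar :: ('v set \<Rightarrow> ('v, 'k) mvpoly) \<Rightarrow> 'v set \<Rightarrow> ('v, 'k) mvpoly"
  note id = ideal_sr[OF assms(1), where 'k = 'k]
  have "?D z S \<in> sr_ideal V (deletion x \<Delta>)" if "S \<subseteq> V" for S
    using assms(7)[OF that] by (auto simp: sr_ideal_def deletion_def)
  then obtain w where w: "w \<in> kchain V (Suc q) (c - 1)"
      "\<And>S. S \<subseteq> V \<Longrightarrow> z S - ?D w S \<in> sr_ideal V (deletion x \<Delta>)"
    using assms(4-6) unfolding koszul_vanishing_def by blast
  define u where "u = (\<lambda>S. z S - ?D w S)"
  have "?D w \<in> kchain V q (c - 1 + 1)" by (rule kos_kchain[OF assms(2) w(1)])
  then have u: "u \<in> kchain V q c" unfolding u_def using kchain_diff[OF assms(5)] by simp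
  \<comment> \<open>Only the part of u on faces of \<Delta> matters modulo I. Since u lies in the
    ideal of the deletion, those faces contain x and the division is exact.\<close>
  define y where "y = (\<lambda>S. var_quotient x (pfilter (\<lambda>m. keys m \<in> \<Delta>) (u S)))"
  have y: "y \<in> kchain V q (c - 1)"
  proof (rule kchainI)
    fix T
    have "pfilter (\<lambda>m. keys m \<in> \<Delta>) (u T) \<in> homog V c"
      using kchain_homog[OF u, of T] unfolding homog_iff keys_pfilter by blast
    then show "y T \<in> homog V (c - 1)" unfolding y_def by (rule homog_var_quotient)
    assume "\<not> (T \<subseteq> V \<and> card T = q)"
    then have "u T = 0" by (rule kchain_zero[OF u])
    then show "y T = 0" unfolding y_def by (simp add: var_quotient_def)
  qed
  have rest: "u S - pvar x * y S \<in> sr_ideal V \<Delta>" if "S \<subseteq> V" for S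
  proof -
    have "u S \<in> sr_ideal V (deletion x \<Delta>)" using w(2)[OF that] by (simp add: u_def)
    then have "pvar x * y S = pfilter (\<lambda>m. keys m \<in> \<Delta>) (u S)"
      unfolding y_def by (intro pvar_mult_var_quotient) (auto simp: keys_pfilter sr_ideal_def deletion_def)
    then have "u S - pvar x * y S = pfilter (\<lambda>m. keys m \<notin> \<Delta>) (u S)"
      using pfilter_split[of "u S" "\<lambda>m. keys m \<in> \<Delta>"] by (metis add_diff_cancel_left')
    then show ?thesis using homog_carrier[OF kchain_homog[OF u, of S]] by (simp add: sr_ideal_def keys_pfilter)
  qed
  have "?D y S \<in> sr_ideal V (star x \<Delta>)" if S: "S \<subseteq> V" for S
  proof -
    have "finite S" by (rule finite_subset[OF S assms(2)])
    have "?D u S = ?D z S - ?D (?D w) S" unfolding u_def by (rule kos_diff)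
    also have "\<dots> = ?D z S" using kos_kos[OF assms(2) \<open>finite S\<close>] by simp
    finally have "?D u S \<in> sr_ideal V \<Delta>" using assms(7)[OF S] by simp
    moreover have "?D (\<lambda>S. u S - pvar x * y S) S \<in> sr_ideal V \<Delta>"
      by (rule kos_mem_ideal[OF id S rest])
    ultimately have "?D u S - ?D (\<lambda>S. u S - pvar x * y S) S \<in> sr_ideal V \<Delta>"
      by (rule ideal_poly_ringD(6)[OF id])
    then have "pvar x * ?D y S \<in> sr_ideal V \<Delta>" unfolding kos_diff kos_scale by simp
    moreover have "?D y S \<in> carrier (poly_ring V)"
    \<comment> \<open>For q = 0 the differential of y is zero by definition;
      \<open>kos_kchain\<close> covers the positive q.\<close>
    proof (cases q)
      case 0
      have "y (insert v S) = 0" if "v \<in> V - S" for v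
      proof (rule kchain_zero[OF y])
        show "\<not> (insert v S \<subseteq> V \<and> card (insert v S) = q)" using 0 \<open>finite S\<close> by simp
      qed
      then show ?thesis by (simp add: kos_def)
    next
      case (Suc q')
      then show ?thesis using y homog_carrier kchain_homog kos_kchain[OF assms(2)] by blast
    qed
    ultimately show ?thesis using pvar_mult_sr_iff[OF assms(3)] by blast
  qed
  then show ?thesis using that[OF w(1) y] rest unfolding u_def by blast
qed

text \<open>The long exact sequence of 0 -> S/(I : x)(-1) -> S/I -> S/(I, x) -> 0 on the level of
  chains: if y is the boundary of v modulo I : x, then x y is the boundary of x v modulo I. The
  shift by one accounts for \<open>r - 1\<close>.\<close>

lemma koszul_vanishing_colon:
  fixes V :: "'v::linorder set"
  assumes "complex V \<Delta>" "finite V" "x \<in> V"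
    and "koszul_vanishing V (sr_ideal V (deletion x \<Delta>) :: ('v, 'k::field) mvpoly set) r"
    and "koszul_vanishing V (sr_ideal V (star x \<Delta>) :: ('v, 'k) mvpoly set) (r - 1)"
  shows "koszul_vanishing V (sr_ideal V \<Delta> :: ('v, 'k) mvpoly set) r"
  unfolding koszul_vanishing_def
proof (intro allI ballI impI)
  fix q c and z :: "'v set \<Rightarrow> ('v, 'k) mvpoly"
  assume z: "z \<in> kchain V q c" "r < c" "\<forall>S\<subseteq>V. kos V pvar z S \<in> sr_ideal V \<Delta>"
  note id = ideal_sr[OF assms(1), where 'k = 'k]
  obtain w y where w: "w \<in> kchain V (Suc q) (c - 1)" and y: "y \<in> kchain V q (c - 1)"
    and zwy: "\<And>S. S \<subseteq> V \<Longrightarrow> z S - kos V pvar w S - pvar x * y S \<in> sr_ideal V \<Delta>"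
    and Dy: "\<And>S. S \<subseteq> V \<Longrightarrow> kos V pvar y S \<in> sr_ideal V (star x \<Delta>)"
    using koszul_decompose[OF assms(1-4) z(1,2)] z(3) by blast
  have "r - 1 < c - 1" using z(2) by simp
  then obtain v where v: "v \<in> kchain V (Suc q) (c - 1 - 1)"
      "\<And>S. S \<subseteq> V \<Longrightarrow> y S - kos V pvar v S \<in> sr_ideal V (star x \<Delta>)"
    using assms(5) y Dy unfolding koszul_vanishing_def by blast
  let ?w = "\<lambda>T. w T + pvar x * v T"
  have "?w \<in> kchain V (Suc q) (c - 1)"
    using kchain_add[OF w] kchain_scale[OF homog_pvar[OF assms(3)] v(1)] by simp
  moreover have "z S - kos V pvar ?w S \<in> sr_ideal V \<Delta>" if S: "S \<subseteq> V" for S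
  proof -
    have "pvar x * (y S - kos V pvar v S) \<in> sr_ideal V \<Delta>"
      using pvar_mult_sr_iff[OF assms(3)] v(2)[OF S] sr_ideal_carrier by blast
    from ideal_poly_ringD(3)[OF id zwy[OF S] this] show ?thesis
      by (simp add: kos_add kos_scale algebra_simps)
  qed
  ultimately show "\<exists>w\<in>kchain V (Suc q) (c - 1). \<forall>S\<subseteq>V. z S - kos V pvar w S \<in> sr_ideal V \<Delta>" by blast
qed

text \<open>For a cone point I : x is I itself, so \<open>koszul_vanishing_colon\<close> would be
  circular. Instead, y is already a cycle modulo I, and the homotopy \<open>kcone x\<close> exhibits
  x y as a boundary; no bound on the colon ideal is required.\<close>

lemma koszul_vanishing_cone:
  fixes V :: "'v::linorder set"
  assumes "complex V \<Delta>" "finite V" "x \<in> V"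
    and "koszul_vanishing V (sr_ideal V (deletion x \<Delta>) :: ('v, 'k::field) mvpoly set) r"
    and "star x \<Delta> = \<Delta>"
  shows "koszul_vanishing V (sr_ideal V \<Delta> :: ('v, 'k) mvpoly set) r"
  unfolding koszul_vanishing_def
proof (intro allI ballI impI)
  fix q c and z :: "'v set \<Rightarrow> ('v, 'k) mvpoly"
  assume z: "z \<in> kchain V q c" "r < c" "\<forall>S\<subseteq>V. kos V pvar z S \<in> sr_ideal V \<Delta>"
  note id = ideal_sr[OF assms(1), where 'k = 'k]
  obtain w y where w: "w \<in> kchain V (Suc q) (c - 1)" and y: "y \<in> kchain V q (c - 1)"
    and zwy: "\<And>S. S \<subseteq> V \<Longrightarrow> z S - kos V pvar w S - pvar x * y S \<in> sr_ideal V \<Delta>"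
    and Dy: "\<And>S. S \<subseteq> V \<Longrightarrow> kos V pvar y S \<in> sr_ideal V \<Delta>"
    using koszul_decompose[OF assms(1-4) z(1,2)] z(3) unfolding assms(5) by blast
  let ?w = "\<lambda>T. w T + kcone x y T"
  have "?w \<in> kchain V (Suc q) (c - 1)"
    using kchain_add[OF w kcone_kchain[OF assms(2,3) y]] .
  moreover have "z S - kos V pvar ?w S \<in> sr_ideal V \<Delta>" if S: "S \<subseteq> V" for S
  proof -
    have "kcone x (kos V pvar y) S \<in> sr_ideal V \<Delta>"
    proof -
      have "kos V pvar y (S - {x}) \<in> sr_ideal V \<Delta>" by (rule Dy) (use S in blast)
      then show ?thesis
        unfolding kcone_def by (simp add: ideal_esign_mult[OF id] ideal_poly_ringD(2)[OF id])
    qed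
    note mem = ideal_poly_ringD(3)[OF id zwy[OF S] this]
    have k: "kos V pvar (kcone x y) S = pvar x * y S - kcone x (kos V pvar y) S"
      using kos_kcone[OF assms(2) finite_subset[OF S assms(2)] assms(3), of pvar y] by (simp only: eq_diff_eq)
    have "z S - kos V pvar ?w S = (z S - kos V pvar w S - pvar x * y S) + kcone x (kos V pvar y) S"
      unfolding kos_add k by simp
    then show ?thesis using mem by (simp only:)
  qed
  ultimately show "\<exists>w\<in>kchain V (Suc q) (c - 1). \<forall>S\<subseteq>V. z S - kos V pvar w S \<in> sr_ideal V \<Delta>" by blast
qed

lemma koszul_vanishing_irrelevant:
  "koszul_vanishing V (sr_ideal V {{}} :: ('v::linorder, 'k::field) mvpoly set) 0"
  unfolding koszul_vanishing_def
proof (intro allI ballI impI)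
  fix q c and z :: "'v set \<Rightarrow> ('v, 'k) mvpoly"
  assume z: "z \<in> kchain V q c" "0 < c"
  have "z S \<in> sr_ideal V {{}}" for S
  proof -
    have "keys m \<noteq> {}" if "m \<in> keys (z S)" for m
    proof
      assume "keys m = {}"
      then have "mon_degree m = 0" by (simp add: mon_degree_def)
      then show False using kchain_homog[OF z(1), of S] that z(2) unfolding homog_iff by force
    qed
    then show ?thesis using homog_carrier[OF kchain_homog[OF z(1), of S]] by (simp add: sr_ideal_def)
  qed
  then have "\<forall>S\<subseteq>V. z S - kos V pvar (\<lambda>_. 0) S \<in> sr_ideal V {{}}" by (simp add: kos_def)
  moreover have "(\<lambda>_. 0) \<in> kchain V (Suc q) (c - 1)" by (rule kchainI) auto
  ultimately show "\<exists>w\<in>kchain V (Suc q) (c - 1). \<forall>S\<subseteq>V. z S - kos V pvar w S \<in> sr_ideal V {{}}" by blast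
qed

text \<open>A full simplex is an iterated cone over the complex whose only face is empty. The case U
  = V is the zero ideal and yields exactness of the Koszul complex of S.\<close>

lemma koszul_vanishing_Pow:
  assumes "finite V" "U \<subseteq> V"
  shows "koszul_vanishing V (sr_ideal V (Pow U) :: ('v::linorder, 'k::field) mvpoly set) 0"
proof -
  have "finite U" by (rule finite_subset[OF assms(2,1)])
  then show ?thesis using assms(2)
  proof (induct U)
    case empty
    then show ?case using koszul_vanishing_irrelevant by simp
  next
    case (insert x U)
    have "deletion x (Pow (insert x U)) = Pow U" using insert(2) by (auto simp: deletion_def)
    moreover have "star x (Pow (insert x U)) = Pow (insert x U)" by (auto simp: star_def)
    moreover have "complex V (Pow (insert x U))" using insert.prems by (auto simp: complex_def)
    ultimately show ?case using koszul_vanishing_cone[OF _ assms(1), of "Pow (insert x U)" x] insert by auto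
  qed
qed

text \<open>The vanishing bound 0 covers coefficients of positive degree. For
  \<open>c \<le> 0\<close> the coefficients are constants or zero, and then the coefficient of x_v
  in dz at T - {v} is that of z at T up to sign; hence the cycle is zero.\<close>

lemma koszul_exact:
  fixes z :: "'v::linorder set \<Rightarrow> ('v, 'k::field) mvpoly"
  assumes "finite V" "z \<in> kchain V (Suc q) c" "\<And>S. S \<subseteq> V \<Longrightarrow> kos V pvar z S = 0"
  obtains w where "w \<in> kchain V (Suc (Suc q)) (c - 1)" "\<And>S. S \<subseteq> V \<Longrightarrow> z S = kos V pvar w S"
proof (cases "c > 0")
  case True
  have "(sr_ideal V (Pow V) :: ('v, 'k) mvpoly set) = {0}" by (auto simp: sr_ideal_def)
  then have "koszul_vanishing V {0 :: ('v, 'k) mvpoly} 0"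
    using koszul_vanishing_Pow[OF assms(1) subset_refl, where 'k = 'k] by simp
  moreover have "\<forall>S\<subseteq>V. kos V pvar z S \<in> {0}" using assms(3) by simp
  ultimately have "\<exists>w\<in>kchain V (Suc (Suc q)) (c - 1). \<forall>S\<subseteq>V. z S - kos V pvar w S \<in> {0}"
    using assms(2) True unfolding koszul_vanishing_def by blast
  then obtain w where "w \<in> kchain V (Suc (Suc q)) (c - 1)" "\<forall>S\<subseteq>V. z S - kos V pvar w S = 0"
    by auto
  then show ?thesis using that by simp
next
  case False
  have "z T = 0" for T
  proof (cases "T \<subseteq> V \<and> card T = Suc q")
    case T: True
    then obtain v where v: "v \<in> T" by (metis card.empty equals0I nat.distinct(1))
    define S where "S = T - {v}"
    have S: "T = insert v S" "v \<notin> S" "S \<subseteq> V" "v \<in> V" using v T by (auto simp: S_def)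
    have k0: "m = 0" if "m \<in> keys (z U)" for m U
    proof -
      have "int (mon_degree m) = c" using kchain_homog[OF assms(2), of U] that unfolding homog_iff by blast
      then have "mon_degree m = 0" using False by simp
      then have "lookup m k = 0" for k using lookup_le_mon_degree[of m k] by simp
      then show ?thesis by (intro poly_mapping_eqI) simp
    qed
    have other: "lookup (esign u S * pvar u * z (insert u S)) (single v 1) = 0" if "u \<noteq> v" for u
    proof -
      have "lookup (pvar u * z (insert u S)) (single v 1) = 0"
        unfolding pvar_def
      proof (rule lookup_single_mult_not)
        fix n :: "'v \<Rightarrow>\<^sub>0 nat"
        show "single v 1 \<noteq> single u 1 + n"
        proof
          assume "single v (1::nat) = single u (1::nat) + n"
          then have "{v} = {u} \<union> keys n" using keys_add_nat[of "single u 1" n] by (metis keys_single one_neq_zero)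
          then show False using that by blast
        qed
      qed
      then show ?thesis using esign_cases[of u S, where 'a = "('v, 'k) mvpoly"] by (auto simp: mult.assoc)
    qed
    have "0 = lookup (kos V pvar z S) (single v 1)" using assms(3)[OF S(3)] by simp
    also have "\<dots> = (\<Sum>u\<in>V - S. if u = v then lookup (esign v S * pvar v * z (insert v S)) (single v 1) else 0)"
      unfolding kos_def lookup_sum using other by (intro sum.cong) auto
    also have "\<dots> = lookup (esign v S * pvar v * z T) (single v 1)"
      using S assms(1) by (simp add: sum.delta)
    finally have "lookup (pvar v * z T) (single v 1) = 0"
      using esign_cases[of v S, where 'a = "('v, 'k) mvpoly"] by (auto simp: mult.assoc)
    then have "lookup (z T) 0 = 0"
      using lookup_single_mult_add[of "single v 1" 1 "z T" 0] by (simp add: pvar_def)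
    then have "m \<notin> keys (z T)" for m using k0[of m T] by (metis in_keys_iff)
    then have "keys (z T) = {}" by blast
    then show ?thesis by simp
  qed (rule kchain_zero[OF assms(2)])
  then have "\<And>S. S \<subseteq> V \<Longrightarrow> z S = kos V pvar (\<lambda>_. 0) S" by (simp add: kos_def)
  moreover have "(\<lambda>_. 0) \<in> kchain V (Suc (Suc q)) (c - 1)" by (rule kchainI) auto
  ultimately show ?thesis using that by blast
qed

section \<open>The regularity bound from Koszul homology\<close>

definition hcomp :: "int \<Rightarrow> ('v, 'k::field) mvpoly \<Rightarrow> ('v, 'k) mvpoly" where
  "hcomp c p = pfilter (\<lambda>m. int (mon_degree m) = c) p"

lemma hcomp_homog: "p \<in> carrier (poly_ring V) \<Longrightarrow> hcomp c p \<in> homog V c"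
  by (simp add: hcomp_def homog_iff keys_pfilter)

lemma hcomp_id: "p \<in> homog V c \<Longrightarrow> hcomp c p = p"
  by (rule poly_mapping_eqI) (auto simp: hcomp_def homog_iff lookup_pfilter in_keys_iff)

lemma hcomp_sum: "hcomp c (\<Sum>i\<in>A. f i) = (\<Sum>i\<in>A. hcomp c (f i))"
  by (simp add: hcomp_def pfilter_sum)

lemma hcomp_mult:
  assumes "d \<in> homog V e"
  shows "hcomp c (d * p) = d * hcomp (c - e) p"
proof -
  let ?P = "\<lambda>m. int (mon_degree m) = c - e"
  have deg: "int (mon_degree k) = e" if "k \<in> keys d" for k
    using assms that unfolding homog_iff by blast
  have "pfilter (\<lambda>m. int (mon_degree m) = c) (d * pfilter ?P p) = d * pfilter ?P p"
  proof (rule poly_mapping_eqI)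
    fix m
    have "int (mon_degree m) = c" if "m \<in> keys (d * pfilter ?P p)"
      using that by (elim keys_mult_elem) (auto simp: keys_pfilter mon_degree_add dest: deg)
    then show "lookup (pfilter (\<lambda>m. int (mon_degree m) = c) (d * pfilter ?P p)) m = lookup (d * pfilter ?P p) m"
      unfolding lookup_pfilter in_keys_iff by auto
  qed
  moreover have "pfilter (\<lambda>m. int (mon_degree m) = c) (d * pfilter (\<lambda>m. \<not> ?P m) p) = 0"
  proof (rule poly_mapping_eqI)
    fix m
    have "int (mon_degree m) \<noteq> c" if "m \<in> keys (d * pfilter (\<lambda>m. \<not> ?P m) p)"
      using that by (elim keys_mult_elem) (auto simp: keys_pfilter mon_degree_add dest: deg)
    then show "lookup (pfilter (\<lambda>m. int (mon_degree m) = c) (d * pfilter (\<lambda>m. \<not> ?P m) p)) m = lookup 0 m"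
      unfolding lookup_pfilter in_keys_iff by auto
  qed
  moreover have "d * p = d * pfilter ?P p + d * pfilter (\<lambda>m. \<not> ?P m) p"
    using pfilter_split[of p ?P] by (metis distrib_left)
  ultimately show ?thesis unfolding hcomp_def by (simp add: pfilter_add)
qed

lemma mult_mat_vec_entry:
  assumes "A \<in> carrier_mat n m" "dim_vec w = m" "b < n"
  shows "(A *\<^sub>v w) $ b = (\<Sum>c\<in>{0..<m}. A $$ (b, c) * w $ c)"
  using assms by (simp add: scalar_prod_def)

text \<open>The setting is the double complex F tensor K, with F an arbitrary graded free resolution
  and K the Koszul complex of S, in a fixed internal degree \<open>j\<close>.\<close>

locale resolution =
  fixes V :: "'v::linorder set" and \<Delta> :: "'v set set" and a :: "nat \<Rightarrow> int list"
    and \<epsilon> :: "('v, 'k::field) mvpoly vec" and D :: "nat \<Rightarrow> ('v, 'k) mvpoly mat" and j :: int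
  assumes finite_V: "finite V" and complex: "complex V \<Delta>"
    and res: "graded_free_resolution V (sr_ideal V \<Delta>) a \<epsilon> D"
begin

abbreviation I :: "('v, 'k) mvpoly set" where "I \<equiv> sr_ideal V \<Delta>"

abbreviation len :: "nat \<Rightarrow> nat" where "len p \<equiv> length (a p)"

text \<open>The elements of F_p tensor K_q of internal degree \<open>j\<close>; \<open>b\<close>
  runs over the generators of F_p. Generator b has degree \<open>a p ! b\<close> and e_T has degree
  q, which leaves \<open>j - a p ! b - int q\<close> for the coefficient. Values are zero off the
  index range so that identities can be stated between functions.\<close>

definition bichain :: "nat \<Rightarrow> nat \<Rightarrow> (nat \<Rightarrow> 'v set \<Rightarrow> ('v, 'k) mvpoly) set" where
  "bichain q p = {z. \<forall>b. (b < len p \<longrightarrow> z b \<in> kchain V q (j - a p ! b - int q)) \<and> (\<not> b < len p \<longrightarrow> z b = (\<lambda>_. 0))}"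

definition Kd :: "(nat \<Rightarrow> 'v set \<Rightarrow> ('v, 'k) mvpoly) \<Rightarrow> nat \<Rightarrow> 'v set \<Rightarrow> ('v, 'k) mvpoly" where
  "Kd z b = kos V pvar (z b)"

definition Fd :: "nat \<Rightarrow> (nat \<Rightarrow> 'v set \<Rightarrow> ('v, 'k) mvpoly) \<Rightarrow> nat \<Rightarrow> 'v set \<Rightarrow> ('v, 'k) mvpoly" where
  "Fd p z b T = (if b < len p then \<Sum>c\<in>{0..<len (Suc p)}. D p $$ (b, c) * z c T else 0)"

text \<open>The augmentation to K tensor S/I, lifted to S through \<epsilon>; statements about it
  therefore hold modulo \<open>I\<close>.\<close>

definition aug :: "(nat \<Rightarrow> 'v set \<Rightarrow> ('v, 'k) mvpoly) \<Rightarrow> 'v set \<Rightarrow> ('v, 'k) mvpoly" where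
  "aug z T = (\<Sum>b\<in>{0..<len 0}. \<epsilon> $ b * z b T)"

lemma id: "ideal I (poly_ring V)"
  by (rule ideal_sr[OF complex])

lemma D_carrier: "D p \<in> carrier_mat (len p) (len (Suc p))"
  using res by (simp add: graded_free_resolution_def)

lemma D_homog: "b < len p \<Longrightarrow> c < len (Suc p) \<Longrightarrow> D p $$ (b, c) \<in> homog V (a (Suc p) ! c - a p ! b)"
  using res by (simp add: graded_free_resolution_def)

lemma eps_homog: "b < len 0 \<Longrightarrow> \<epsilon> $ b \<in> homog V (a 0 ! b)"
  using res by (simp add: graded_free_resolution_def)

lemma exact_D: "{u \<in> free_mod V (a (Suc i)). D i *\<^sub>v u = 0\<^sub>v (len i)} = (\<lambda>w. D (Suc i) *\<^sub>v w) ` free_mod V (a (Suc (Suc i)))"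
  using res by (simp add: graded_free_resolution_def)

lemma exact_aug: "{u \<in> free_mod V (a 0). \<epsilon> \<bullet> u \<in> I} = (\<lambda>w. D 0 *\<^sub>v w) ` free_mod V (a 1)"
proof -
  have "quot_map V I p = \<zero>\<^bsub>quot_ring V I\<^esub> \<longleftrightarrow> p \<in> I" for p
    unfolding quot_map_zero[OF id] quot_map_eq_iff[OF id] by simp
  then show ?thesis using res by (simp add: graded_free_resolution_def)
qed

lemma surj_aug:
  assumes "p \<in> carrier (poly_ring V)"
  obtains u where "u \<in> free_mod V (a 0)" "\<epsilon> \<bullet> u - p \<in> I"
proof -
  have "quot_map V I p \<in> carrier (quot_ring V I)" using assms unfolding carrier_quot_ring by blast
  also have "carrier (quot_ring V I) = (\<lambda>u. quot_map V I (\<epsilon> \<bullet> u)) ` free_mod V (a 0)"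
    using res by (simp add: graded_free_resolution_def)
  finally obtain u where "u \<in> free_mod V (a 0)" "quot_map V I p = quot_map V I (\<epsilon> \<bullet> u)" by blast
  then show ?thesis using that quot_map_eq_iff[OF id] by metis
qed

lemma bichain_kchain: "z \<in> bichain q p \<Longrightarrow> b < len p \<Longrightarrow> z b \<in> kchain V q (j - a p ! b - int q)"
  by (simp add: bichain_def)

lemma bichain_homog: "z \<in> bichain q p \<Longrightarrow> b < len p \<Longrightarrow> z b T \<in> homog V (j - a p ! b - int q)"
  using kchain_homog[OF bichain_kchain] by blast

lemma bichain_zero: "z \<in> bichain q p \<Longrightarrow> \<not> (b < len p \<and> T \<subseteq> V \<and> card T = q) \<Longrightarrow> z b T = 0"
proof (cases "b < len p")
  case True
  assume "z \<in> bichain q p" "\<not> (b < len p \<and> T \<subseteq> V \<and> card T = q)"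
  then show ?thesis using True kchain_zero[OF bichain_kchain] by blast
qed (simp add: bichain_def)

lemma bichainI:
  assumes "\<And>b T. b < len p \<Longrightarrow> T \<subseteq> V \<Longrightarrow> card T = q \<Longrightarrow> z b T \<in> homog V (j - a p ! b - int q)"
    and "\<And>b T. \<not> (b < len p \<and> T \<subseteq> V \<and> card T = q) \<Longrightarrow> z b T = 0"
  shows "z \<in> bichain q p"
  using assms unfolding bichain_def kchain_def by (auto intro!: ext)

lemma bichain_diff: "y \<in> bichain q p \<Longrightarrow> z \<in> bichain q p \<Longrightarrow> (\<lambda>b T. y b T - z b T) \<in> bichain q p"
  by (rule bichainI) (simp_all add: homog_diff bichain_homog bichain_zero)

lemma Kd_bichain:
  assumes "z \<in> bichain (Suc q) p"
  shows "Kd z \<in> bichain q p"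
proof (rule bichainI)
  fix b T
  have k: "kos V pvar (z b) \<in> kchain V q (j - a p ! b - int q)" if "b < len p"
  proof -
    have "j - a p ! b - int (Suc q) + 1 = j - a p ! b - int q" by simp
    then show ?thesis using kos_kchain[OF finite_V bichain_kchain[OF assms that]] by (simp only:)
  qed
  { assume "b < len p"
    from kchain_homog[OF k[OF this]] show "Kd z b T \<in> homog V (j - a p ! b - int q)" by (simp add: Kd_def) }
  assume n: "\<not> (b < len p \<and> T \<subseteq> V \<and> card T = q)"
  show "Kd z b T = 0"
  proof (cases "b < len p")
    case True
    then show ?thesis using kchain_zero[OF k] n by (simp add: Kd_def)
  next
    case False
    then have "z b = (\<lambda>_. 0)" using assms by (simp add: bichain_def)
    then show ?thesis by (simp add: Kd_def kos_def)
  qed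
qed

lemma Fd_bichain:
  assumes "z \<in> bichain q (Suc p)"
  shows "Fd p z \<in> bichain q p"
proof (rule bichainI)
  fix b T
  { assume b: "b < len p"
    have "(\<Sum>c\<in>{0..<len (Suc p)}. D p $$ (b, c) * z c T) \<in> homog V (j - a p ! b - int q)"
    proof (rule homog_sum)
      fix c assume "c \<in> {0..<len (Suc p)}"
      moreover have "a (Suc p) ! c - a p ! b + (j - a (Suc p) ! c - int q) = j - a p ! b - int q" by simp
      ultimately show "D p $$ (b, c) * z c T \<in> homog V (j - a p ! b - int q)"
        using homog_mult[OF D_homog[OF b] bichain_homog[OF assms], of c c T]
        by (simp only: atLeastLessThan_iff)
    qed
    then show "Fd p z b T \<in> homog V (j - a p ! b - int q)" using b by (simp add: Fd_def) }
  assume n: "\<not> (b < len p \<and> T \<subseteq> V \<and> card T = q)"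
  show "Fd p z b T = 0"
  proof (cases "b < len p")
    case True
    then have "z c T = 0" for c using bichain_zero[OF assms] n by blast
    then show ?thesis by (simp add: Fd_def)
  qed (simp add: Fd_def)
qed

lemma aug_kchain:
  assumes "z \<in> bichain q 0"
  shows "aug z \<in> kchain V q (j - int q)"
proof (rule kchainI)
  fix T
  show "aug z T \<in> homog V (j - int q)"
    unfolding aug_def
  proof (rule homog_sum)
    fix b assume "b \<in> {0..<len 0}"
    then show "\<epsilon> $ b * z b T \<in> homog V (j - int q)"
      using homog_mult[OF eps_homog bichain_homog[OF assms], of b b T] by simp
  qed
  assume "\<not> (T \<subseteq> V \<and> card T = q)"
  then have "z b T = 0" for b using bichain_zero[OF assms] by blast
  then show "aug z T = 0" by (simp add: aug_def)
qed

text \<open>The differentials commute instead of anticommuting: the argument chases elements of the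
  double complex and never forms the total complex, so no sign is put in.\<close>

lemma Kd_Fd: "Kd (Fd p z) = Fd p (Kd z)"
proof (intro ext)
  fix b T
  show "Kd (Fd p z) b T = Fd p (Kd z) b T"
  proof (cases "b < len p")
    case True
    then have "Fd p z b = (\<lambda>T. \<Sum>c\<in>{0..<len (Suc p)}. D p $$ (b, c) * z c T)"
      by (auto simp: Fd_def)
    then show ?thesis using True by (simp add: Kd_def kos_sum kos_scale Fd_def)
  next
    case False
    then have "Fd p z b = (\<lambda>_. 0)" by (auto simp: Fd_def)
    then show ?thesis using False by (simp add: Kd_def kos_def Fd_def)
  qed
qed

lemma kos_aug: "kos V pvar (aug z) T = aug (Kd z) T"
proof -
  have "aug z = (\<lambda>T. \<Sum>b\<in>{0..<len 0}. \<epsilon> $ b * z b T)" by (auto simp: aug_def)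
  then show ?thesis by (simp add: kos_sum kos_scale aug_def Kd_def)
qed

lemma Kd_Kd:
  assumes "z \<in> bichain (Suc (Suc q)) p"
  shows "Kd (Kd z) = (\<lambda>_ _. 0)"
proof (intro ext)
  fix b T
  show "Kd (Kd z) b T = 0"
  proof (cases "finite T")
    case True
    have "Kd z b = kos V pvar (z b)" by (rule ext) (simp add: Kd_def)
    then show ?thesis using kos_kos[OF finite_V True] by (simp add: Kd_def)
  next
    case False
    then have "\<not> T \<subseteq> V" using finite_V finite_subset by metis
    then show ?thesis using bichain_zero[OF Kd_bichain[OF Kd_bichain[OF assms]]] by blast
  qed
qed

definition column :: "nat \<Rightarrow> (nat \<Rightarrow> 'v set \<Rightarrow> ('v, 'k) mvpoly) \<Rightarrow> 'v set \<Rightarrow> ('v, 'k) mvpoly vec" where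
  "column p z T = vec (len p) (\<lambda>b. z b T)"

lemma column_free: "z \<in> bichain q p \<Longrightarrow> column p z T \<in> free_mod V (a p)"
  unfolding free_mod_def column_def using homog_carrier[OF bichain_homog] by simp

lemma D_column: "D p *\<^sub>v column (Suc p) z T = vec (len p) (\<lambda>b. Fd p z b T)"
proof (rule eq_vecI)
  fix b assume "b < dim_vec (vec (len p) (\<lambda>b. Fd p z b T))"
  then show "(D p *\<^sub>v column (Suc p) z T) $ b = vec (len p) (\<lambda>b. Fd p z b T) $ b"
    using mult_mat_vec_entry[OF D_carrier, of "column (Suc p) z T" p b] by (simp add: column_def Fd_def)
qed (use D_carrier[of p] in auto)

lemma eps_column: "\<epsilon> \<bullet> column 0 z T = aug z T"
  by (simp add: scalar_prod_def column_def aug_def)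

text \<open>Exactness of the resolution yields preimages T by T that need not be homogeneous. Since
  the entries of the matrices are homogeneous, taking in each coordinate the component of the
  expected degree gives again a preimage.\<close>

lemma Fd_lift:
  assumes "\<And>T. T \<subseteq> V \<Longrightarrow> card T = q \<Longrightarrow> w T \<in> free_mod V (a (Suc p))"
    and "z \<in> bichain q p"
    and "\<And>T. T \<subseteq> V \<Longrightarrow> card T = q \<Longrightarrow> D p *\<^sub>v w T = column p z T"
  shows "\<exists>y\<in>bichain q (Suc p). Fd p y = z"
proof
  let ?n = "len (Suc p)"
  let ?y = "\<lambda>b T. if b < ?n \<and> T \<subseteq> V \<and> card T = q then hcomp (j - a (Suc p) ! b - int q) (w T $ b) else 0"
  show "?y \<in> bichain q (Suc p)"
  proof (rule bichainI)
    fix b T assume "b < ?n" "T \<subseteq> V" "card T = q"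
    then show "?y b T \<in> homog V (j - a (Suc p) ! b - int q)"
      using assms(1)[of T] by (auto simp: free_mod_def simp del: poly_ring_simps intro!: hcomp_homog)
  qed auto
  show "Fd p ?y = z"
  proof (intro ext)
    fix b T
    show "Fd p ?y b T = z b T"
    proof (cases "b < len p \<and> T \<subseteq> V \<and> card T = q")
      case True
      let ?c = "j - a p ! b - int q"
      have w: "w T \<in> free_mod V (a (Suc p))" "D p *\<^sub>v w T = column p z T" using assms(1,3) True by blast+
      have "z b T = column p z T $ b" using True by (simp add: column_def)
      also have "\<dots> = (\<Sum>c\<in>{0..<?n}. D p $$ (b, c) * w T $ c)"
        unfolding w(2)[symmetric] using w(1) True
        by (intro mult_mat_vec_entry[OF D_carrier]) (auto simp: free_mod_def)
      finally have "hcomp ?c (z b T) = hcomp ?c (\<Sum>c\<in>{0..<?n}. D p $$ (b, c) * w T $ c)" by simp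
      moreover have "hcomp ?c (z b T) = z b T" using hcomp_id[OF bichain_homog[OF assms(2)]] True by blast
      ultimately have "z b T = (\<Sum>c\<in>{0..<?n}. D p $$ (b, c) * hcomp (?c - (a (Suc p) ! c - a p ! b)) (w T $ c))"
        using True by (simp add: hcomp_sum hcomp_mult[OF D_homog])
      also have "\<dots> = (\<Sum>c\<in>{0..<?n}. D p $$ (b, c) * ?y c T)"
        using True by (intro sum.cong refl) (simp add: algebra_simps)
      finally show ?thesis using True by (simp add: Fd_def)
    next
      case False
      then have "z b T = 0" by (rule bichain_zero[OF assms(2)])
      moreover have "Fd p ?y b T = 0"
      proof (cases "b < len p")
        case True
        have "?y c T = 0" for c by (rule if_not_P) (use False True in blast)
        then show ?thesis unfolding Fd_def by (simp only: mult_zero_right sum.neutral_const if_cancel)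
      qed (simp add: Fd_def)
      ultimately show ?thesis by simp
    qed
  qed
qed

lemma Fd_exact:
  assumes "z \<in> bichain q (Suc p)" "Fd p z = (\<lambda>_ _. 0)"
  shows "\<exists>y\<in>bichain q (Suc (Suc p)). Fd (Suc p) y = z"
proof -
  have "\<exists>w. w \<in> free_mod V (a (Suc (Suc p))) \<and> D (Suc p) *\<^sub>v w = column (Suc p) z T" for T
  proof -
    have "D p *\<^sub>v column (Suc p) z T = 0\<^sub>v (len p)"
      unfolding D_column assms(2) by (auto simp: zero_vec_def)
    then have "column (Suc p) z T \<in> (\<lambda>w. D (Suc p) *\<^sub>v w) ` free_mod V (a (Suc (Suc p)))"
      using column_free[OF assms(1)] unfolding exact_D[symmetric] by simp
    then show ?thesis by auto
  qed
  then obtain w where "\<And>T. w T \<in> free_mod V (a (Suc (Suc p))) \<and> D (Suc p) *\<^sub>v w T = column (Suc p) z T"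
    by metis
  then show ?thesis using Fd_lift[of q w "Suc p" z] assms(1) by blast
qed

lemma aug_exact:
  assumes "z \<in> bichain q 0" "\<And>T. T \<subseteq> V \<Longrightarrow> aug z T \<in> I"
  shows "\<exists>y\<in>bichain q (Suc 0). Fd 0 y = z"
proof -
  have "\<exists>w. T \<subseteq> V \<longrightarrow> w \<in> free_mod V (a (Suc 0)) \<and> D 0 *\<^sub>v w = column 0 z T" for T
  proof (cases "T \<subseteq> V")
    case True
    have "column 0 z T \<in> {u \<in> free_mod V (a 0). \<epsilon> \<bullet> u \<in> I}"
      using column_free[OF assms(1)] assms(2)[OF True] unfolding eps_column[symmetric] by blast
    then show ?thesis unfolding exact_aug by auto
  qed simp
  then obtain w where "\<And>T. T \<subseteq> V \<longrightarrow> w T \<in> free_mod V (a (Suc 0)) \<and> D 0 *\<^sub>v w T = column 0 z T"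
    by metis
  then show ?thesis using Fd_lift[of q w 0 z] assms(1) by blast
qed

lemma Fd_Fd:
  assumes "z \<in> bichain q (Suc (Suc p))"
  shows "Fd p (Fd (Suc p) z) = (\<lambda>_ _. 0)"
proof (intro ext)
  fix b T
  show "Fd p (Fd (Suc p) z) b T = 0"
  proof (cases "b < len p")
    case True
    have "D (Suc p) *\<^sub>v column (Suc (Suc p)) z T = column (Suc p) (Fd (Suc p) z) T"
      unfolding D_column unfolding column_def ..
    then have "column (Suc p) (Fd (Suc p) z) T \<in> {u \<in> free_mod V (a (Suc p)). D p *\<^sub>v u = 0\<^sub>v (len p)}"
      unfolding exact_D using column_free[OF assms] by (metis imageI)
    then have "D p *\<^sub>v column (Suc p) (Fd (Suc p) z) T = 0\<^sub>v (len p)" by blast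
    then have "vec (len p) (\<lambda>b. Fd p (Fd (Suc p) z) b T) = 0\<^sub>v (len p)" unfolding D_column .
    then have "vec (len p) (\<lambda>b. Fd p (Fd (Suc p) z) b T) $ b = 0\<^sub>v (len p) $ b" by (rule arg_cong)
    then show ?thesis using True by simp
  qed (simp add: Fd_def)
qed

lemma aug_Fd:
  assumes "z \<in> bichain q (Suc 0)"
  shows "aug (Fd 0 z) T \<in> I"
proof -
  have "D 0 *\<^sub>v column (Suc 0) z T = column 0 (Fd 0 z) T"
    unfolding D_column unfolding column_def ..
  then have "column 0 (Fd 0 z) T \<in> {u \<in> free_mod V (a 0). \<epsilon> \<bullet> u \<in> I}"
    unfolding exact_aug using column_free[OF assms] by (metis One_nat_def imageI)
  then show ?thesis by (simp add: eps_column)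
qed

lemma aug_lift:
  assumes "v \<in> kchain V q (j - int q)"
  shows "\<exists>y\<in>bichain q 0. \<forall>T\<subseteq>V. aug y T - v T \<in> I"
proof -
  have "\<exists>u. u \<in> free_mod V (a 0) \<and> \<epsilon> \<bullet> u - v T \<in> I" for T
    using surj_aug[OF homog_carrier[OF kchain_homog[OF assms]]] by metis
  then obtain u where u: "\<And>T. u T \<in> free_mod V (a 0)" "\<And>T. \<epsilon> \<bullet> u T - v T \<in> I" by metis
  let ?y = "\<lambda>b T. if b < len 0 \<and> T \<subseteq> V \<and> card T = q then hcomp (j - a 0 ! b - int q) (u T $ b) else 0"
  have "?y \<in> bichain q 0"
  proof (rule bichainI)
    fix b T assume "b < len 0" "T \<subseteq> V" "card T = q"
    then show "?y b T \<in> homog V (j - a 0 ! b - int q)"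
      using u(1)[of T] by (auto simp: free_mod_def simp del: poly_ring_simps intro!: hcomp_homog)
  qed auto
  moreover have "aug ?y T - v T \<in> I" if T: "T \<subseteq> V" for T
  proof (cases "card T = q")
    case True
    \<comment> \<open>A monomial ideal contains the homogeneous components of its elements, so the
      congruence modulo \<open>I\<close> survives the passage to components.\<close>
    have "hcomp (j - int q) (\<epsilon> \<bullet> u T - v T) \<in> I"
      using u(2)[of T] by (auto simp: sr_ideal_def hcomp_def keys_pfilter)
    moreover have "hcomp (j - int q) (\<epsilon> \<bullet> u T - v T) = hcomp (j - int q) (\<epsilon> \<bullet> u T) - hcomp (j - int q) (v T)"
      unfolding hcomp_def by (rule poly_mapping_eqI) (simp add: lookup_pfilter lookup_minus)
    moreover have "hcomp (j - int q) (v T) = v T" by (rule hcomp_id[OF kchain_homog[OF assms]])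
    moreover have "\<epsilon> \<bullet> u T = (\<Sum>b\<in>{0..<len 0}. \<epsilon> $ b * u T $ b)"
    proof -
      have "dim_vec (u T) = len 0" using u(1)[of T] by (auto simp: free_mod_def)
      then show ?thesis by (simp add: scalar_prod_def)
    qed
    moreover have "hcomp (j - int q) (\<Sum>b\<in>{0..<len 0}. \<epsilon> $ b * u T $ b) = aug ?y T"
      unfolding aug_def hcomp_sum using True T
      by (intro sum.cong refl) (simp add: hcomp_mult[OF eps_homog] algebra_simps)
    ultimately show ?thesis by simp
  next
    case False
    then have "v T = 0" using kchain_zero[OF assms] by blast
    moreover have "aug ?y T = 0" using False by (simp add: aug_def)
    ultimately show ?thesis using ideal_poly_ringD(2)[OF id] by simp
  qed
  ultimately show ?thesis by blast
qed

lemma Kd_exact: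
  assumes "z \<in> bichain (Suc q) p" "Kd z = (\<lambda>_ _. 0)"
  shows "\<exists>y\<in>bichain (Suc (Suc q)) p. Kd y = z"
proof -
  have "\<exists>w. b < len p \<longrightarrow> w \<in> kchain V (Suc (Suc q)) (j - a p ! b - int (Suc (Suc q))) \<and> (\<forall>S\<subseteq>V. z b S = kos V pvar w S)" for b
  proof (cases "b < len p")
    case True
    have "kos V pvar (z b) S = 0" for S using fun_cong[OF fun_cong[OF assms(2)], of b S] by (simp add: Kd_def)
    then obtain w where "w \<in> kchain V (Suc (Suc q)) (j - a p ! b - int (Suc q) - 1)" "\<And>S. S \<subseteq> V \<Longrightarrow> z b S = kos V pvar w S"
      using koszul_exact[OF finite_V bichain_kchain[OF assms(1) True]] by blast
    moreover have "j - a p ! b - int (Suc q) - 1 = j - a p ! b - int (Suc (Suc q))" by simp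
    ultimately show ?thesis by metis
  qed simp
  then obtain w where w: "\<And>b. b < len p \<longrightarrow> w b \<in> kchain V (Suc (Suc q)) (j - a p ! b - int (Suc (Suc q))) \<and> (\<forall>S\<subseteq>V. z b S = kos V pvar (w b) S)"
    by metis
  let ?y = "\<lambda>b. if b < len p then w b else (\<lambda>_. 0)"
  have y: "?y \<in> bichain (Suc (Suc q)) p" unfolding bichain_def using w by simp
  moreover have "Kd ?y = z"
  proof (intro ext)
    fix b S
    show "Kd ?y b S = z b S"
    proof (cases "b < len p \<and> S \<subseteq> V")
      case True then show ?thesis using w[of b] by (simp add: Kd_def)
    next
      case False
      have "z b S = 0" by (rule bichain_zero[OF assms(1)]) (use False in blast)
      moreover have "Kd ?y b S = 0" by (rule bichain_zero[OF Kd_bichain[OF y]]) (use False in blast)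
      ultimately show ?thesis by (simp only:)
    qed
  qed
  ultimately show ?thesis by blast
qed

lemma Fd_diff: "Fd p (\<lambda>b T. y b T - z b T) = (\<lambda>b T. Fd p y b T - Fd p z b T)"
  by (intro ext) (simp add: Fd_def right_diff_distrib sum_subtractf)

lemma Kd_add: "Kd (\<lambda>b T. y b T + z b T) = (\<lambda>b T. Kd y b T + Kd z b T)"
  by (intro ext) (simp add: Kd_def kos_add)

lemma aug_diff: "aug (\<lambda>b T. y b T - z b T) T = aug y T - aug z T"
  by (simp add: aug_def right_diff_distrib sum_subtractf)

text \<open>If Fd w = Kd x, then x lives at p - 1 and q + 1, so the degree condition on p + q is
  preserved and the induction hypothesis splits x. At p = 0 the augmentation of w is a Koszul cycle
  modulo I in a degree where homology vanishes; lifting the chain that bounds it through the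
  augmentation gives the Koszul part of w. The last hypothesis is what makes this augmentation a
  cycle.\<close>

lemma zigzag:
  assumes "koszul_vanishing V I r" "int (p + q) + r < j" "w \<in> bichain q p"
    and "\<And>p'. p = Suc p' \<Longrightarrow> \<exists>x\<in>bichain (Suc q) p'. Fd p' w = Kd x"
    and "\<And>q'. p = 0 \<Longrightarrow> q = Suc q' \<Longrightarrow> \<exists>x\<in>bichain q' (Suc 0). Kd w = Fd 0 x"
  shows "\<exists>y\<in>bichain q (Suc p). \<exists>x\<in>bichain (Suc q) p. w = (\<lambda>b T. Fd p y b T + Kd x b T)"
  using assms(2-)
proof (induct p arbitrary: q w)
  case 0
  have k: "aug w \<in> kchain V q (j - int q)" by (rule aug_kchain[OF 0(2)])
  have "kos V pvar (aug w) S \<in> I" if S: "S \<subseteq> V" for S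
  proof (cases q)
    case 0
    have "aug w (insert v S) = 0" for v
    proof (rule kchain_zero[OF k])
      show "\<not> (insert v S \<subseteq> V \<and> card (insert v S) = q)" using 0 finite_subset[OF S finite_V] by simp
    qed
    then show ?thesis using ideal_poly_ringD(2)[OF id] by (simp add: kos_def)
  next
    case (Suc q')
    then obtain x where "x \<in> bichain q' (Suc 0)" "Kd w = Fd 0 x" using 0(4) by blast
    then show ?thesis unfolding kos_aug using aug_Fd by simp
  qed
  \<comment> \<open>The coefficients of \<open>aug w\<close> have degree j - q, the quantity that
    \<open>koszul_vanishing\<close> compares with r.\<close>
  moreover have "r < j - int q" using 0(1) by simp
  ultimately obtain u where u: "u \<in> kchain V (Suc q) (j - int q - 1)" "\<And>S. S \<subseteq> V \<Longrightarrow> aug w S - kos V pvar u S \<in> I"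
    using assms(1) k unfolding koszul_vanishing_def by blast
  have "j - int q - 1 = j - int (Suc q)" by simp
  then obtain x where x: "x \<in> bichain (Suc q) 0" "\<And>T. T \<subseteq> V \<Longrightarrow> aug x T - u T \<in> I"
    using aug_lift u(1) by metis
  let ?v = "\<lambda>b T. w b T - Kd x b T"
  have "?v \<in> bichain q 0" by (rule bichain_diff[OF 0(2) Kd_bichain[OF x(1)]])
  moreover have "aug ?v S \<in> I" if S: "S \<subseteq> V" for S
  proof -
    have "kos V pvar (\<lambda>T. aug x T - u T) S \<in> I" by (rule kos_mem_ideal[OF id S x(2)])
    then have "aug (Kd x) S - kos V pvar u S \<in> I" unfolding kos_diff kos_aug .
    from ideal_poly_ringD(6)[OF id u(2)[OF S] this] show ?thesis unfolding aug_diff by simp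
  qed
  ultimately obtain y where "y \<in> bichain q (Suc 0)" "Fd 0 y = ?v" using aug_exact by blast
  then have "w = (\<lambda>b T. Fd 0 y b T + Kd x b T)" by simp
  then show ?case using \<open>y \<in> bichain q (Suc 0)\<close> x(1) by blast
next
  case (Suc p)
  obtain x where x: "x \<in> bichain (Suc q) p" "Fd p w = Kd x" using Suc.prems(3) by blast
  have "\<exists>y\<in>bichain (Suc q) (Suc p). \<exists>x'\<in>bichain (Suc (Suc q)) p. x = (\<lambda>b T. Fd p y b T + Kd x' b T)"
  proof (rule Suc.hyps[OF _ x(1)])
    show "int (p + Suc q) + r < j" using Suc.prems(1) by simp
    fix p' assume p': "p = Suc p'"
    have "Kd (Fd p' x) = Fd p' (Fd p w)" unfolding Kd_Fd x(2) ..
    also have "\<dots> = (\<lambda>_ _. 0)" unfolding p' by (rule Fd_Fd) (use Suc.prems(2) p' in simp)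
    finally show "\<exists>x'\<in>bichain (Suc (Suc q)) p'. Fd p' x = Kd x'"
      using Kd_exact[OF Fd_bichain] x(1) p' by metis
  next
    fix q' assume "p = 0" "Suc q = Suc q'"
    then show "\<exists>x'\<in>bichain q' (Suc 0). Kd x = Fd 0 x'"
      using x(2) Suc.prems(2) by (intro bexI[of _ w]) auto
  qed
  then obtain y x' where y: "y \<in> bichain (Suc q) (Suc p)" "x' \<in> bichain (Suc (Suc q)) p"
    "x = (\<lambda>b T. Fd p y b T + Kd x' b T)" by blast
  \<comment> \<open>With x = Fd y + Kd x' the second summand dies under Kd, so Fd w = Kd x = Fd (Kd
    y). Thus w - Kd y is a cycle of the resolution and hence a boundary.\<close>
  have "Fd p w = Fd p (Kd y)"
    unfolding x(2) y(3) Kd_add Kd_Kd[OF y(2)] by (simp add: Kd_Fd)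
  then have "Fd p (\<lambda>b T. w b T - Kd y b T) = (\<lambda>_ _. 0)" unfolding Fd_diff by simp
  moreover have "(\<lambda>b T. w b T - Kd y b T) \<in> bichain q (Suc p)"
    by (rule bichain_diff[OF Suc.prems(2) Kd_bichain[OF y(1)]])
  ultimately obtain v where "v \<in> bichain q (Suc (Suc p))" "Fd (Suc p) v = (\<lambda>b T. w b T - Kd y b T)"
    using Fd_exact by blast
  then have "w = (\<lambda>b T. Fd (Suc p) v b T + Kd y b T)" by simp
  then show ?case using \<open>v \<in> bichain q (Suc (Suc p))\<close> y(1) by blast
qed

end

section \<open>From Tor classes to the double complex; the irrelevant ideal enters as the image of
  K_1 in K_0\<close>

lemma irrelevant_homog_lift:
  fixes V :: "'v::linorder set" and f :: "('v, 'k::field) mvpoly"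
  assumes "finite V" "f \<in> irrelevant_ideal V" "f \<in> homog V c"
  shows "\<exists>x\<in>kchain V 1 (c - 1). \<forall>S\<subseteq>V. kos V pvar x S = (if S = {} then f else 0)"
proof (cases "c > 0")
  case True
  let ?z = "\<lambda>S. if S = {} then f else 0"
  have z: "?z \<in> kchain V 0 c"
  proof (rule kchainI)
    fix T assume "\<not> (T \<subseteq> V \<and> card T = 0)"
    then show "?z T = 0" by auto
  qed (use assms(3) in simp)
  have "(sr_ideal V (Pow V) :: ('v, 'k) mvpoly set) = {0}" by (auto simp: sr_ideal_def)
  then have "koszul_vanishing V {0 :: ('v, 'k) mvpoly} 0"
    using koszul_vanishing_Pow[OF assms(1) subset_refl, where 'k = 'k] by simp
  moreover have "\<forall>S\<subseteq>V. kos V pvar ?z S \<in> {0}" by (simp add: kos_def)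
  ultimately have "\<exists>w\<in>kchain V (Suc 0) (c - 1). \<forall>S\<subseteq>V. ?z S - kos V pvar w S \<in> {0}"
    using z True unfolding koszul_vanishing_def by blast
  then obtain w where w: "w \<in> kchain V (Suc 0) (c - 1)" "\<forall>S\<subseteq>V. ?z S - kos V pvar w S \<in> {0}" by blast
  have "kos V pvar w S = ?z S" if "S \<subseteq> V" for S
    using w(2)[rule_format, OF that] unfolding singleton_iff right_minus_eq by (rule sym)
  then show ?thesis using w(1) by (intro bexI[of _ w]) simp_all
next
  case False
  have "keys m = {}" if "m \<in> keys f" for m
  proof -
    have "int (mon_degree m) = c" using assms(3) that unfolding homog_iff by blast
    then have "mon_degree m = 0" using False by simp
    then have "lookup m k = 0" for k using lookup_le_mon_degree[of m k] by simp
    then have "m = 0" by (intro poly_mapping_eqI) simp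
    then show ?thesis by simp
  qed
  moreover have "keys m \<noteq> {}" if "m \<in> keys f" for m
    using assms(2) that unfolding irrelevant_ideal_eq_sr sr_ideal_def by blast
  ultimately have "keys f = {}" by blast
  then have "f = 0" by simp
  moreover have "(\<lambda>_. 0) \<in> kchain V 1 (c - 1)" by (rule kchainI) auto
  ultimately show ?thesis by (intro bexI[of _ "\<lambda>_. 0"]) (auto simp: kos_def)
qed

lemma kos_pvar_irrelevant:
  assumes "x \<in> kchain V q c" "S \<subseteq> V"
  shows "kos V pvar x S \<in> (irrelevant_ideal V :: ('v::linorder, 'k::field) mvpoly set)"
  unfolding kos_def
proof (rule ideal_sum_closed)
  show id: "ideal (irrelevant_ideal V :: ('v, 'k) mvpoly set) (poly_ring V)"
    unfolding irrelevant_ideal_eq_sr by (rule ideal_sr) (simp add: complex_def)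
  fix v assume v: "v \<in> V - S"
  have "pvar v \<in> (irrelevant_ideal V :: ('v, 'k) mvpoly set)"
    using v by (simp add: irrelevant_ideal_eq_sr sr_ideal_def pvar_def del: keys_eq_empty)
  from ideal_poly_ringD(4)[OF id this homog_carrier[OF kchain_homog[OF assms(1)]], of "insert v S"]
  have "pvar v * x (insert v S) \<in> irrelevant_ideal V" by (simp add: mult.commute)
  then show "esign v S * pvar v * x (insert v S) \<in> irrelevant_ideal V"
    unfolding mult.assoc by (rule ideal_esign_mult[OF id])
qed

lemma tor_nonzero_le:
  fixes V :: "'v::linorder set"
  assumes "finite V" "complex V \<Delta>" "koszul_vanishing V (sr_ideal V \<Delta> :: ('v, 'k::field) mvpoly set) r"
    and "tor_nonzero V (sr_ideal V \<Delta> :: ('v, 'k) mvpoly set) i j"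
  shows "j \<le> int i + r"
proof (rule ccontr)
  assume "\<not> j \<le> int i + r"
  then have j: "int (i + 0) + r < j" by simp
  let ?m = "irrelevant_ideal V :: ('v, 'k) mvpoly set"
  obtain a \<epsilon> and D :: "nat \<Rightarrow> ('v, 'k) mvpoly mat" and u where
    res: "graded_free_resolution V (sr_ideal V \<Delta>) a \<epsilon> D" and u: "u \<in> free_mod_piece V (a i) j"
    and cyc: "case i of 0 \<Rightarrow> True | Suc l \<Rightarrow> D l *\<^sub>v u \<in> free_mod_irr V (a l)"
    and nbd: "\<not> (\<exists>w \<in> free_mod V (a (Suc i)). u - D i *\<^sub>v w \<in> free_mod_irr V (a i))"
    using assms(4) unfolding tor_nonzero_def by blast
  interpret resolution V \<Delta> a \<epsilon> D j by unfold_locales (use assms res in auto)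
  have uh: "u $ b \<in> homog V (j - a i ! b)" if "b < len i" for b
    using u that by (simp add: free_mod_piece_def)
  have ud: "dim_vec u = len i" using u by (simp add: free_mod_piece_def)
  let ?w = "\<lambda>b T. if b < len i \<and> T = {} then u $ b else 0"
  have w: "?w \<in> bichain 0 i"
  proof (rule bichainI)
    fix b and T :: "'v set" assume "\<not> (b < len i \<and> T \<subseteq> V \<and> card T = 0)"
    then show "?w b T = 0" by auto
  qed (use uh in auto)
  have col: "column i ?w {} = u"
    by (rule eq_vecI) (use ud in \<open>auto simp: column_def\<close>)
  have "\<exists>x\<in>bichain (Suc 0) p'. Fd p' ?w = Kd x" if i: "i = Suc p'" for p'
  proof -
    have du: "vec (len p') (\<lambda>b. Fd p' ?w b {}) \<in> free_mod_irr V (a p')"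
      using cyc col unfolding i by (simp add: D_column[symmetric])
    have "\<exists>x. b < len p' \<longrightarrow> x \<in> kchain V 1 (j - a p' ! b - 1) \<and>
        (\<forall>S\<subseteq>V. kos V pvar x S = (if S = {} then Fd p' ?w b {} else 0))" for b
    proof (cases "b < len p'")
      case True
      have "Fd p' ?w b {} \<in> ?m" using du True by (simp add: free_mod_irr_def)
      moreover have "Fd p' ?w b {} \<in> homog V (j - a p' ! b)"
        using bichain_homog[OF Fd_bichain, of ?w 0 p' b "{}"] w True unfolding i by simp
      ultimately show ?thesis using irrelevant_homog_lift[OF assms(1)] by blast
    qed simp
    then have "\<forall>b. \<exists>x. b < len p' \<longrightarrow> x \<in> kchain V 1 (j - a p' ! b - 1) \<and>
        (\<forall>S\<subseteq>V. kos V pvar x S = (if S = {} then Fd p' ?w b {} else 0))" by (rule allI)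
    from choice[OF this] obtain x where "\<forall>b. b < len p' \<longrightarrow> x b \<in> kchain V 1 (j - a p' ! b - 1) \<and>
        (\<forall>S\<subseteq>V. kos V pvar (x b) S = (if S = {} then Fd p' ?w b {} else 0))" by (elim exE) (rule that)
    note x = spec[OF this]
    let ?x = "\<lambda>b. if b < len p' then x b else (\<lambda>_. 0)"
    have bx: "?x \<in> bichain (Suc 0) p'" unfolding bichain_def using x by simp
    have "Fd p' ?w = Kd ?x"
    proof (intro ext)
      fix b S
      have F: "Fd p' ?w \<in> bichain 0 p'" by (rule Fd_bichain) (use w i in simp)
      show "Fd p' ?w b S = Kd ?x b S"
      proof (cases "b < len p' \<and> S \<subseteq> V")
        case True
        have "Fd p' ?w b S = (if S = {} then Fd p' ?w b {} else 0)" by (auto simp: Fd_def)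
        then show ?thesis using True x[of b] by (simp add: Kd_def)
      next
        case False
        have "Fd p' ?w b S = 0" by (rule bichain_zero[OF F]) (use False in blast)
        moreover have "Kd ?x b S = 0" by (rule bichain_zero[OF Kd_bichain[OF bx]]) (use False in blast)
        ultimately show ?thesis by (simp only:)
      qed
    qed
    then show ?thesis using bx by blast
  qed
  then obtain y x where y: "y \<in> bichain 0 (Suc i)" and x: "x \<in> bichain (Suc 0) i"
    and wyx: "?w = (\<lambda>b T. Fd i y b T + Kd x b T)"
    using zigzag[OF assms(3) j w] by blast
  have "u - D i *\<^sub>v column (Suc i) y {} \<in> free_mod_irr V (a i)"
    unfolding free_mod_irr_def
  proof (intro CollectI conjI allI impI)
    show "u - D i *\<^sub>v column (Suc i) y {} \<in> carrier_vec (len i)"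
      using ud D_carrier[of i] by (intro carrier_vecI) simp
    fix b assume b: "b < len i"
    have "u $ b = Fd i y b {} + Kd x b {}" using fun_cong[OF fun_cong[OF wyx], of b "{}"] b by simp
    then have "(u - D i *\<^sub>v column (Suc i) y {}) $ b = kos V pvar (x b) {}"
      using b ud unfolding D_column by (simp add: Kd_def)
    then show "(u - D i *\<^sub>v column (Suc i) y {}) $ b \<in> ?m"
      using kos_pvar_irrelevant[OF bichain_kchain[OF x b], of "{}"] by simp
  qed
  then show False using nbd column_free[OF y] by blast
qed

section \<open>The Taylor resolution\<close>

lemma lookup_esign_mult:
  fixes p :: "('v, 'k::field) mvpoly"
  shows "lookup (esign v S * p) m = esign v S * lookup p m"
  by (cases "even (card {w\<in>S. w < v})") (simp_all add: esign_def)

lemma sum_nth_distinct: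
  assumes "distinct xs"
  shows "(\<Sum>c\<in>{0..<length xs}. f (xs ! c)) = (\<Sum>x\<in>set xs. f x)"
  using assms by (simp add: sum.distinct_set_conv_list sum_list_sum_nth)

text \<open>Any squarefree monomial ideal fits: the generator of index v is the product of the
  variables in \<open>lab v\<close>. The order on the index type is for the signs.\<close>

locale taylor =
  fixes V :: "'v set" and W :: "'i::linorder set" and lab :: "'i \<Rightarrow> 'v set"
  assumes finite_V: "finite V" and finite_W: "finite W" and lab_V: "\<And>v. v \<in> W \<Longrightarrow> lab v \<subseteq> V"
begin

text \<open>\<open>sqfree (U S)\<close> is the least common multiple of the generators indexed by
  \<open>S\<close>; \<open>step v S\<close> is the factor by which it grows when v is added.\<close>

definition U :: "'i set \<Rightarrow> 'v set" where "U S = \<Union> (lab ` S)"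

definition step :: "'i \<Rightarrow> 'i set \<Rightarrow> ('v \<Rightarrow>\<^sub>0 nat)" where
  "step v S = sqfree (U (insert v S)) - sqfree (U S)"

definition tay :: "('i set \<Rightarrow> ('v, 'k::field) mvpoly) \<Rightarrow> 'i set \<Rightarrow> ('v, 'k) mvpoly" where
  "tay z S = (\<Sum>v\<in>W - S. esign v S * single (step v S) 1 * z (insert v S))"

text \<open>The multidegree \<open>M\<close> strand of a Taylor chain: a generator \<open>e_T\<close> has multidegree
  \<open>sqfree (U T)\<close>. Each strand is the augmented chain complex of a full simplex.\<close>

definition strand :: "('i set \<Rightarrow> ('v, 'k::field) mvpoly) \<Rightarrow> ('v \<Rightarrow>\<^sub>0 nat) \<Rightarrow> 'i set \<Rightarrow> 'k" where
  "strand z M S = (if U S \<subseteq> keys M then lookup (z S) (M - sqfree (U S)) else 0)"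

definition dividing :: "('v \<Rightarrow>\<^sub>0 nat) \<Rightarrow> 'i set" where
  "dividing M = {v\<in>W. lab v \<subseteq> keys M}"

lemma U_insert: "U (insert v S) = lab v \<union> U S"
  by (simp add: U_def)

lemma finite_sub_W: "S \<subseteq> W \<Longrightarrow> finite S"
  using finite_W finite_subset by blast

lemma U_V: "S \<subseteq> W \<Longrightarrow> U S \<subseteq> V"
  using lab_V by (auto simp: U_def)

lemma finite_U: "S \<subseteq> W \<Longrightarrow> finite (U S)"
  using U_V finite_V finite_subset by metis

lemma step_add:
  assumes "S \<subseteq> W" "v \<in> W"
  shows "sqfree (U S) + step v S = sqfree (U (insert v S))"
  unfolding step_def using assms finite_U[of S] finite_U[of "insert v S"]
  by (intro sqfree_minus_add) (auto simp: U_insert)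

lemma finite_dividing: "finite (dividing M)"
  unfolding dividing_def using finite_W by simp

text \<open>Inside one multidegree M the monomial coefficient of the differential is absorbed by the
  change of lcm, so only signs remain. Indices whose generator does not divide M contribute nothing,
  which leaves the simplex on \<open>dividing M\<close>.\<close>

lemma strand_tay:
  assumes "S \<subseteq> W" "U S \<subseteq> keys M"
  shows "strand (tay z) M S = kos (dividing M) (\<lambda>_. 1) (strand z M) S"
proof -
  let ?N = "M - sqfree (U S)"
  have N: "sqfree (U S) + ?N = M" using sqfree_minus_add[OF finite_U[OF assms(1)] assms(2)] .
  have entry: "lookup (single (step v S) 1 * z (insert v S)) ?N = (if v \<in> dividing M then strand z M (insert v S) else 0)"
    if v: "v \<in> W - S" for v
  proof (cases "v \<in> dividing M")
    case True
    then have sub: "U (insert v S) \<subseteq> keys M" using assms(2) by (simp add: dividing_def U_insert)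
    have vS: "insert v S \<subseteq> W" using v assms(1) by blast
    have "sqfree (U S) + ?N = sqfree (U S) + (step v S + (M - sqfree (U (insert v S))))"
      using step_add[OF assms(1), of v] sqfree_minus_add[OF finite_U[OF vS] sub] v N
      by (simp add: add.assoc[symmetric])
    then have e: "?N = step v S + (M - sqfree (U (insert v S)))" by simp
    have "lookup (single (step v S) 1 * z (insert v S)) ?N = lookup (z (insert v S)) (M - sqfree (U (insert v S)))"
      by (subst e) (simp only: lookup_single_mult_add mult_1_left)
    then show ?thesis using True sub by (simp add: strand_def)
  next
    case False
    have "?N \<noteq> step v S + n" for n
    proof
      assume "?N = step v S + n"
      then have "M = sqfree (U (insert v S)) + n"
        using N step_add[OF assms(1), of v] v by (simp add: add.assoc[symmetric])
      then have "U (insert v S) \<subseteq> keys M"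
        using finite_U[of "insert v S"] assms(1) v by (simp add: keys_add_nat)
      then show False using False v by (simp add: dividing_def U_insert)
    qed
    then show ?thesis using False lookup_single_mult_not by metis
  qed
  have "strand (tay z) M S = (\<Sum>v\<in>W - S. esign v S * lookup (single (step v S) 1 * z (insert v S)) ?N)"
    using assms(2) by (simp add: strand_def tay_def lookup_sum lookup_esign_mult mult.assoc)
  also have "\<dots> = (\<Sum>v\<in>W - S. if v \<in> dividing M then esign v S * strand z M (insert v S) else 0)"
    by (rule sum.cong[OF refl]) (simp add: entry)
  also have "\<dots> = (\<Sum>v\<in>(W - S) \<inter> dividing M. esign v S * strand z M (insert v S))"
    using finite_W by (simp add: sum.inter_restrict)
  also have "(W - S) \<inter> dividing M = dividing M - S" by (auto simp: dividing_def)
  finally show ?thesis by (simp add: kos_def)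
qed

lemma strand_ext:
  assumes "S \<subseteq> W" "\<And>M. U S \<subseteq> keys M \<Longrightarrow> strand y M S = strand z M S"
  shows "y S = z S"
proof (rule poly_mapping_eqI)
  fix n
  let ?M = "sqfree (U S) + n"
  have "U S \<subseteq> keys ?M" using finite_U[OF assms(1)] by (simp add: keys_add_nat)
  then show "lookup (y S) n = lookup (z S) n" using assms(2)[of ?M] by (simp add: strand_def)
qed

lemma tay_tay:
  assumes "S \<subseteq> W"
  shows "tay (tay z) S = 0"
proof -
  have "tay (tay z) S = (\<lambda>_. 0) S"
  proof (rule strand_ext[OF assms])
    fix M :: "'v \<Rightarrow>\<^sub>0 nat" assume M: "U S \<subseteq> keys M"
    have "strand (tay (tay z)) M S = kos (dividing M) (\<lambda>_. 1) (strand (tay z) M) S"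
      by (rule strand_tay[OF assms M])
    also have "\<dots> = kos (dividing M) (\<lambda>_. 1) (kos (dividing M) (\<lambda>_. 1) (strand z M)) S"
      by (rule kos_cong, rule strand_tay) (use assms M in \<open>auto simp: dividing_def U_insert\<close>)
    also have "\<dots> = 0" by (rule kos_kos[OF finite_dividing finite_sub_W[OF assms]])
    finally show "strand (tay (tay z)) M S = strand (\<lambda>_. 0) M S" by (simp add: strand_def)
  qed
  then show ?thesis .
qed

text \<open>The contraction of the Taylor complex, assembled strand by strand: in multidegree M it
  is the cone with an apex chosen among the generators dividing M. The apex varies with M, so this
  is given by coefficients.\<close>

definition tcone :: "('i set \<Rightarrow> ('v, 'k::field) mvpoly) \<Rightarrow> 'i set \<Rightarrow> ('v, 'k) mvpoly" where
  "tcone z T = Abs_poly_mapping (\<lambda>n. kcone (SOME x. x \<in> dividing (sqfree (U T) + n)) (strand z (sqfree (U T) + n)) T)"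

lemma lookup_tcone:
  assumes "finite T" "\<forall>S. z S \<noteq> 0 \<longrightarrow> S \<subseteq> W"
  shows "lookup (tcone z T) n = kcone (SOME x. x \<in> dividing (sqfree (U T) + n)) (strand z (sqfree (U T) + n)) T"
proof -
  let ?f = "\<lambda>n. kcone (SOME x. x \<in> dividing (sqfree (U T) + n)) (strand z (sqfree (U T) + n)) T"
  \<comment> \<open>A nonzero coefficient at n comes from a monomial of some
    \<open>z (T - {x})\<close> with x in T, and the multidegree recovers n from that monomial; hence
    the support is finite.\<close>
  have "{n. ?f n \<noteq> 0} \<subseteq> (+) (sqfree (U T)) -` (\<Union>x\<in>T. (+) (sqfree (U (T - {x}))) ` keys (z (T - {x})))"
  proof
    fix n assume "n \<in> {n. ?f n \<noteq> 0}"
    then obtain x where x: "x \<in> T" "strand z (sqfree (U T) + n) (T - {x}) \<noteq> 0"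
      by (auto simp: kcone_def split: if_splits)
    let ?M = "sqfree (U T) + n"
    have sub: "U (T - {x}) \<subseteq> keys ?M" and l: "lookup (z (T - {x})) (?M - sqfree (U (T - {x}))) \<noteq> 0"
      using x(2) by (auto simp: strand_def split: if_splits)
    have "z (T - {x}) \<noteq> 0" using l by auto
    then have "T - {x} \<subseteq> W" using assms(2) by blast
    then have "?M = sqfree (U (T - {x})) + (?M - sqfree (U (T - {x})))"
      using sqfree_minus_add[OF finite_U sub] by simp
    moreover have "?M - sqfree (U (T - {x})) \<in> keys (z (T - {x}))" using l by (simp add: in_keys_iff)
    ultimately show "n \<in> (+) (sqfree (U T)) -` (\<Union>x\<in>T. (+) (sqfree (U (T - {x}))) ` keys (z (T - {x})))"
      using x(1) by blast
  qed
  moreover have "finite ((+) (sqfree (U T)) -` (\<Union>x\<in>T. (+) (sqfree (U (T - {x}))) ` keys (z (T - {x}))))"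
    using assms(1) by (intro finite_vimageI) (auto simp: inj_on_def)
  ultimately have "finite {n. ?f n \<noteq> 0}" by (rule finite_subset)
  then show ?thesis unfolding tcone_def by simp
qed

lemma some_dividing: "dividing M \<noteq> {} \<Longrightarrow> (SOME x. x \<in> dividing M) \<in> dividing M"
  by (rule someI_ex) blast

lemma tcone_nonzero:
  assumes "finite T" "\<forall>S. z S \<noteq> 0 \<longrightarrow> S \<subseteq> W"
    and "\<forall>M S. strand z M S \<noteq> 0 \<longrightarrow> dividing M \<noteq> {}"
    and "n \<in> keys (tcone z T)"
  obtains x where "x \<in> T" "x \<in> W" "T - {x} \<subseteq> W" "z (T - {x}) \<noteq> 0" "strand z (sqfree (U T) + n) (T - {x}) \<noteq> 0"
proof -
  let ?M = "sqfree (U T) + n"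
  let ?x = "SOME x. x \<in> dividing ?M"
  have "kcone ?x (strand z ?M) T \<noteq> 0"
    using assms(4) lookup_tcone[OF assms(1,2)] by (simp add: in_keys_iff)
  then have x: "?x \<in> T" "strand z ?M (T - {?x}) \<noteq> 0" by (auto simp: kcone_def split: if_splits)
  then have "z (T - {?x}) \<noteq> 0" by (auto simp: strand_def split: if_splits)
  moreover have "?x \<in> W" using some_dividing[OF assms(3)[rule_format, OF x(2)]] by (simp add: dividing_def)
  ultimately show ?thesis using that x assms(2) by blast
qed

lemma strand_tcone:
  assumes "T \<subseteq> W" "\<forall>S. z S \<noteq> 0 \<longrightarrow> S \<subseteq> W" "dividing M \<noteq> {}"
  shows "strand (tcone z) M T = kcone (SOME x. x \<in> dividing M) (strand z M) T"
proof (cases "U T \<subseteq> keys M")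
  case True
  then show ?thesis
    using sqfree_minus_add[OF finite_U[OF assms(1)] True] lookup_tcone[OF finite_sub_W[OF assms(1)] assms(2)]
    by (simp add: strand_def)
next
  case False
  let ?x = "SOME x. x \<in> dividing M"
  have "lab ?x \<subseteq> keys M" using some_dividing[OF assms(3)] by (simp add: dividing_def)
  then have "strand z M (T - {?x}) = 0" if "?x \<in> T"
    using that False U_insert[of ?x "T - {?x}"] by (auto simp: strand_def insert_absorb)
  then show ?thesis using False by (auto simp: strand_def kcone_def)
qed

text \<open>A strand over a nonempty \<open>dividing M\<close> is the chain complex of a simplex and
  is contracted by the cone. The second hypothesis excludes the multidegrees divisible by no
  generator, where only the empty set contributes and the strand is not exact.\<close>

lemma tay_exact:
  assumes "\<forall>S. z S \<noteq> 0 \<longrightarrow> S \<subseteq> W" "\<forall>M S. strand z M S \<noteq> 0 \<longrightarrow> dividing M \<noteq> {}"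
    and "\<And>S. S \<subseteq> W \<Longrightarrow> tay z S = 0" "S \<subseteq> W"
  shows "tay (tcone z) S = z S"
proof (rule strand_ext[OF assms(4)])
  fix M :: "'v \<Rightarrow>\<^sub>0 nat" assume M: "U S \<subseteq> keys M"
  have k: "strand (tay (tcone z)) M S = kos (dividing M) (\<lambda>_. 1) (strand (tcone z) M) S"
    by (rule strand_tay[OF assms(4) M])
  show "strand (tay (tcone z)) M S = strand z M S"
  proof (cases "dividing M = {}")
    case True
    then have "strand z M S = 0" using assms(2) by blast
    then show ?thesis unfolding k using True by (simp add: kos_def)
  next
    case False
    let ?x = "SOME x. x \<in> dividing M"
    have x: "?x \<in> dividing M" by (rule some_dividing[OF False])
    have "kos (dividing M) (\<lambda>_. 1) (strand (tcone z) M) S = kos (dividing M) (\<lambda>_. 1) (kcone ?x (strand z M)) S"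
      by (rule kos_cong, rule strand_tcone) (use assms(1,4) False in \<open>auto simp: dividing_def\<close>)
    also have "\<dots> + kcone ?x (kos (dividing M) (\<lambda>_. 1) (strand z M)) S = strand z M S"
      using kos_kcone[OF finite_dividing finite_sub_W[OF assms(4)] x, of "\<lambda>_. 1"] by simp
    moreover have "kcone ?x (kos (dividing M) (\<lambda>_. 1) (strand z M)) S = 0"
    proof -
      have "S - {?x} \<subseteq> W" "U (S - {?x}) \<subseteq> keys M" using assms(4) M by (auto simp: U_def)
      then have "kos (dividing M) (\<lambda>_. 1) (strand z M) (S - {?x}) = strand (tay z) M (S - {?x})"
        by (simp add: strand_tay)
      also have "\<dots> = 0" using assms(3)[OF \<open>S - {?x} \<subseteq> W\<close>] by (simp add: strand_def)
      finally show ?thesis by (simp add: kcone_def)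
    qed
    ultimately show ?thesis unfolding k by simp
  qed
qed

section \<open>The Taylor complex in matrix form\<close>

definition basis :: "nat \<Rightarrow> 'i set list" where
  "basis i = (SOME xs. distinct xs \<and> set xs = {T. T \<subseteq> W \<and> card T = i})"

lemma basis: "distinct (basis i)" "set (basis i) = {T. T \<subseteq> W \<and> card T = i}"
proof -
  have "finite {T. T \<subseteq> W \<and> card T = i}" using finite_W by simp
  from finite_distinct_list[OF this]
  have "\<exists>xs. distinct xs \<and> set xs = {T. T \<subseteq> W \<and> card T = i}" by (simp add: conj_commute)
  from someI_ex[OF this] show "distinct (basis i)" "set (basis i) = {T. T \<subseteq> W \<and> card T = i}"
    unfolding basis_def by blast+
qed

lemma basis_nth: "b < length (basis i) \<Longrightarrow> basis i ! b \<subseteq> W \<and> card (basis i ! b) = i"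
  using basis(2)[of i] nth_mem by blast

lemma basis_0: "basis 0 = [{}]"
proof -
  have s: "set (basis 0) = {{}}" unfolding basis(2) using finite_sub_W by auto
  then have "length (basis 0) = 1" using distinct_card[OF basis(1)[of 0]] by simp
  then obtain T where "basis 0 = [T]" by (auto simp: length_Suc_conv)
  then show ?thesis using s by simp
qed

definition shifts :: "nat \<Rightarrow> int list" where
  "shifts i = map (\<lambda>T. int (card (U T))) (basis i)"

text \<open>The coefficient of e_S in the differential of e_T. It is used when \<open>T\<close> has
  one element more than \<open>S\<close>, so that \<open>the_elem (T - S)\<close> is the element
  removed.\<close>

definition coef :: "'i set \<Rightarrow> 'i set \<Rightarrow> ('v, 'k::field) mvpoly" where
  "coef S T = (if S \<subseteq> T then esign (the_elem (T - S)) S * single (sqfree (U T) - sqfree (U S)) 1 else 0)"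

definition dmat :: "nat \<Rightarrow> ('v, 'k::field) mvpoly mat" where
  "dmat i = mat (length (basis i)) (length (basis (Suc i))) (\<lambda>(b, c). coef (basis i ! b) (basis (Suc i) ! c))"

definition tvec :: "nat \<Rightarrow> ('i set \<Rightarrow> ('v, 'k::field) mvpoly) \<Rightarrow> ('v, 'k) mvpoly vec" where
  "tvec i z = vec (length (basis i)) (\<lambda>b. z (basis i ! b))"

lemma dmat_tvec: "dmat i *\<^sub>v tvec (Suc i) z = tvec i (tay z)"
proof (rule eq_vecI)
  fix b assume "b < dim_vec (tvec i (tay z))"
  then have b: "b < length (basis i)" by (simp add: tvec_def)
  let ?S = "basis i ! b"
  have S: "?S \<subseteq> W" "card ?S = i" "finite ?S" using basis_nth[OF b] finite_sub_W by auto
  have "(dmat i *\<^sub>v tvec (Suc i) z) $ b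
      = (\<Sum>c\<in>{0..<length (basis (Suc i))}. coef ?S (basis (Suc i) ! c) * z (basis (Suc i) ! c))"
    using b by (subst mult_mat_vec_entry[of _ "length (basis i)" "length (basis (Suc i))"])
       (auto simp: dmat_def tvec_def)
  also have "\<dots> = (\<Sum>T\<in>set (basis (Suc i)). coef ?S T * z T)"
    by (rule sum_nth_distinct[OF basis(1)])
  also have "\<dots> = (\<Sum>T\<in>(\<lambda>v. insert v ?S) ` (W - ?S). coef ?S T * z T)"
  proof (rule sum.mono_neutral_right)
    show "(\<lambda>v. insert v ?S) ` (W - ?S) \<subseteq> set (basis (Suc i))" unfolding basis(2) using S by auto
    show "\<forall>T\<in>set (basis (Suc i)) - (\<lambda>v. insert v ?S) ` (W - ?S). coef ?S T * z T = 0"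
    proof
      fix T assume T: "T \<in> set (basis (Suc i)) - (\<lambda>v. insert v ?S) ` (W - ?S)"
      then have TW: "T \<subseteq> W" "card T = Suc i" unfolding basis(2) by auto
      have "\<not> ?S \<subseteq> T"
      proof
        assume sub: "?S \<subseteq> T"
        have "card (T - ?S) = 1" using card_Diff_subset[OF S(3) sub] TW S by simp
        then obtain v where "T - ?S = {v}" using card_1_singletonE by blast
        then have "T = insert v ?S" "v \<in> W - ?S" using sub TW by auto
        then show False using T by blast
      qed
      then show "coef ?S T * z T = 0" by (simp add: coef_def)
    qed
  qed simp
  also have "\<dots> = (\<Sum>v\<in>W - ?S. coef ?S (insert v ?S) * z (insert v ?S))"
    by (subst sum.reindex) (auto simp: inj_on_def)
  also have "\<dots> = tay z ?S" unfolding tay_def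
  proof (rule sum.cong[OF refl])
    fix v assume "v \<in> W - ?S"
    then have "insert v ?S - ?S = {v}" by auto
    then show "coef ?S (insert v ?S) * z (insert v ?S) = esign v ?S * single (step v ?S) 1 * z (insert v ?S)"
      by (simp add: coef_def step_def subset_insertI)
  qed
  finally show "(dmat i *\<^sub>v tvec (Suc i) z) $ b = tvec i (tay z) $ b" using b by (simp add: tvec_def)
qed (simp add: dmat_def tvec_def)

lemma tvec_cases:
  assumes "u \<in> free_mod V (shifts i)"
  obtains z where "u = tvec i z" "\<And>T. z T \<in> carrier (poly_ring V)" "\<forall>T. z T \<noteq> 0 \<longrightarrow> T \<subseteq> W \<and> card T = i"
proof -
  have u: "dim_vec u = length (basis i)" "\<And>b. b < length (basis i) \<Longrightarrow> u $ b \<in> carrier (poly_ring V)"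
    using assms by (auto simp: free_mod_def shifts_def simp del: poly_ring_simps)
  let ?idx = "\<lambda>T. SOME b. b < length (basis i) \<and> basis i ! b = T"
  have idx: "?idx (basis i ! b) = b" if "b < length (basis i)" for b
    using that basis(1)[of i] by (intro some_equality) (auto simp: nth_eq_iff_index_eq)
  define z where "z = (\<lambda>T. if T \<in> set (basis i) then u $ (?idx T) else 0)"
  show ?thesis
  proof (rule that)
    show "u = tvec i z"
      by (rule eq_vecI) (use u(1) idx in \<open>auto simp: tvec_def z_def\<close>)
    show "z T \<in> carrier (poly_ring V)" for T
    proof (cases "T \<in> set (basis i)")
      case True
      then obtain b where "b < length (basis i)" "T = basis i ! b" by (metis in_set_conv_nth)
      then show ?thesis using u(2) idx True by (simp add: z_def del: poly_ring_simps)
    qed (simp add: z_def)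
    show "\<forall>T. z T \<noteq> 0 \<longrightarrow> T \<subseteq> W \<and> card T = i"
      using basis(2)[of i] by (auto simp: z_def split: if_splits)
  qed
qed

lemma tvec_free: "(\<And>T. T \<subseteq> W \<Longrightarrow> card T = i \<Longrightarrow> z T \<in> carrier (poly_ring V)) \<Longrightarrow> tvec i z \<in> free_mod V (shifts i)"
  using basis_nth by (simp add: free_mod_def tvec_def shifts_def del: poly_ring_simps)

lemma single_step_carrier: "S \<subseteq> W \<Longrightarrow> v \<in> W \<Longrightarrow> single (step v S) 1 \<in> carrier (poly_ring V)"
proof -
  assume S: "S \<subseteq> W" "v \<in> W"
  have "keys (step v S) \<subseteq> keys (sqfree (U (insert v S)))"
    unfolding step_add[OF S, symmetric] by (simp add: keys_add_nat)
  also have "\<dots> \<subseteq> V" using U_V[of "insert v S"] finite_U[of "insert v S"] S by simp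
  finally show ?thesis by simp
qed

lemma tay_carrier:
  fixes z :: "'i set \<Rightarrow> ('v, 'k::field) mvpoly"
  assumes "S \<subseteq> W" "\<And>T. z T \<in> carrier (poly_ring V)"
  shows "tay z S \<in> carrier (poly_ring V)"
  unfolding tay_def
proof (rule carrier_sum)
  fix v assume v: "v \<in> W - S"
  have "single (step v S) 1 * z (insert v S) \<in> carrier (poly_ring V)"
    by (rule carrier_closed(2)[OF single_step_carrier assms(2)]) (use v assms(1) in auto)
  then show "esign v S * single (step v S) 1 * z (insert v S) \<in> carrier (poly_ring V)"
    unfolding mult.assoc by (rule ideal_esign_mult[OF ideal_carrier])
qed

lemma tcone_carrier:
  assumes "T \<subseteq> W" "\<forall>S. z S \<noteq> 0 \<longrightarrow> S \<subseteq> W" "\<forall>M S. strand z M S \<noteq> 0 \<longrightarrow> dividing M \<noteq> {}"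
    and "\<And>T. z T \<in> carrier (poly_ring V)"
  shows "tcone z T \<in> carrier (poly_ring V)"
  unfolding poly_ring_simps
proof
  fix n assume "n \<in> keys (tcone z T)"
  then obtain x where x: "x \<in> T" "x \<in> W" "T - {x} \<subseteq> W" "z (T - {x}) \<noteq> 0" "strand z (sqfree (U T) + n) (T - {x}) \<noteq> 0"
    using tcone_nonzero[OF finite_sub_W[OF assms(1)] assms(2,3)] by blast
  let ?M = "sqfree (U T) + n" and ?S = "T - {x}"
  have s: "U ?S \<subseteq> keys ?M" "?M - sqfree (U ?S) \<in> keys (z ?S)"
    using x(5) by (auto simp: strand_def in_keys_iff split: if_splits)
  have "keys (?M - sqfree (U ?S)) \<subseteq> V" using s(2) assms(4)[of ?S] by auto
  moreover have "sqfree (U ?S) + (?M - sqfree (U ?S)) = ?M" by (rule sqfree_minus_add[OF finite_U[OF x(3)] s(1)])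
  ultimately have "keys ?M \<subseteq> V" using U_V[OF x(3)] finite_U[OF x(3)] by (metis keys_add_nat keys_sqfree le_sup_iff)
  then show "keys n \<subseteq> V" by (simp add: keys_add_nat)
qed

lemma exact_at:
  fixes z :: "'i set \<Rightarrow> ('v, 'k::field) mvpoly"
  assumes "\<And>T. z T \<in> carrier (poly_ring V)" "\<forall>T. z T \<noteq> 0 \<longrightarrow> T \<subseteq> W \<and> card T = i"
    and "\<forall>M S. strand z M S \<noteq> 0 \<longrightarrow> dividing M \<noteq> {}"
    and "\<And>S. S \<subseteq> W \<Longrightarrow> tay z S = 0"
  shows "\<exists>w\<in>free_mod V (shifts (Suc i)). tvec i z = dmat i *\<^sub>v w"
proof
  have W: "\<forall>S. z S \<noteq> 0 \<longrightarrow> S \<subseteq> W" using assms(2) by blast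
  show "tvec (Suc i) (tcone z) \<in> free_mod V (shifts (Suc i))"
    by (rule tvec_free) (rule tcone_carrier[OF _ W assms(3,1)])
  have "tay (tcone z) S = z S" if "S \<subseteq> W" for S
    by (rule tay_exact[OF W assms(3,4) that])
  then show "tvec i z = dmat i *\<^sub>v tvec (Suc i) (tcone z)"
    unfolding dmat_tvec using basis_nth by (auto simp: tvec_def)
qed

abbreviation edges :: "'v set set" where "edges \<equiv> lab ` W"

lemma coef_homog:
  assumes "S \<subseteq> W" "T \<subseteq> W"
  shows "coef S T \<in> homog V (int (card (U T)) - int (card (U S)))"
proof (cases "S \<subseteq> T")
  case True
  have "U S \<subseteq> U T" using True by (auto simp: U_def)
  then have e: "sqfree (U S) + (sqfree (U T) - sqfree (U S)) = sqfree (U T)"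
    using finite_U assms by (intro sqfree_minus_add) auto
  have "keys (sqfree (U T) - sqfree (U S)) \<subseteq> V"
    using arg_cong[OF e, of keys] finite_U[OF assms(2)] U_V[OF assms(2)] by (auto simp: keys_add_nat)
  moreover have "mon_degree (sqfree (U S)) + mon_degree (sqfree (U T) - sqfree (U S)) = mon_degree (sqfree (U T))"
    using arg_cong[OF e, of mon_degree] by (simp add: mon_degree_add)
  then have "int (mon_degree (sqfree (U T) - sqfree (U S))) = int (card (U T)) - int (card (U S))"
    using finite_U assms by (simp add: mon_degree_sqfree)
  ultimately have "single (sqfree (U T) - sqfree (U S)) 1 \<in> homog V (int (card (U T)) - int (card (U S)))"
    by (simp add: homog_iff)
  then show ?thesis using True homog_esign by (simp add: coef_def)
qed (simp add: coef_def)

lemma taylor_resolution: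
  "graded_free_resolution V (sr_ideal V (independent_sets V edges) :: ('v, 'k::field) mvpoly set)
     shifts (vec 1 (\<lambda>_. 1)) dmat"
proof -
  let ?I = "sr_ideal V (independent_sets V edges) :: ('v, 'k) mvpoly set"
  note id = ideal_sr[OF complex_independent_sets, of V edges, where 'k = 'k]
  have s0: "shifts 0 = [0]" by (simp add: shifts_def basis_0 U_def)
  have eps: "vec 1 (\<lambda>_. 1) \<bullet> u = u $ 0" if "dim_vec u = 1" for u :: "('v, 'k) mvpoly vec"
    using that by (simp add: scalar_prod_def)
  have zero: "quot_map V ?I p = \<zero>\<^bsub>quot_ring V ?I\<^esub> \<longleftrightarrow> p \<in> ?I" for p
    unfolding quot_map_zero[OF id] quot_map_eq_iff[OF id] by simp
  have surj: "(\<lambda>u. quot_map V ?I (vec 1 (\<lambda>_. 1) \<bullet> u)) ` free_mod V (shifts 0) = carrier (quot_ring V ?I)"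
    unfolding carrier_quot_ring
  proof
    show "(\<lambda>u. quot_map V ?I (vec 1 (\<lambda>_. 1) \<bullet> u)) ` free_mod V (shifts 0) \<subseteq> quot_map V ?I ` carrier (poly_ring V)"
    proof (rule image_subsetI)
      fix u :: "('v, 'k) mvpoly vec" assume "u \<in> free_mod V (shifts 0)"
      then have "u $ 0 \<in> carrier (poly_ring V)" "dim_vec u = 1"
        by (auto simp: free_mod_def s0 simp del: poly_ring_simps)
      then show "quot_map V ?I (vec 1 (\<lambda>_. 1) \<bullet> u) \<in> quot_map V ?I ` carrier (poly_ring V)"
        using eps[of u] by (metis imageI)
    qed
    show "quot_map V ?I ` carrier (poly_ring V) \<subseteq> (\<lambda>u. quot_map V ?I (vec 1 (\<lambda>_. 1) \<bullet> u)) ` free_mod V (shifts 0)"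
    proof (rule image_subsetI)
      fix p :: "('v, 'k) mvpoly" assume "p \<in> carrier (poly_ring V)"
      then have "vec 1 (\<lambda>_. p) \<in> free_mod V (shifts 0)" by (simp add: free_mod_def s0 del: poly_ring_simps)
      moreover have "vec 1 (\<lambda>_. 1) \<bullet> vec 1 (\<lambda>_. p) = p" by (subst eps) simp_all
      ultimately show "quot_map V ?I p \<in> (\<lambda>u. quot_map V ?I (vec 1 (\<lambda>_. 1) \<bullet> u)) ` free_mod V (shifts 0)"
        by (metis (no_types, lifting) imageI)
    qed
  qed
  have ker0: "{u \<in> free_mod V (shifts 0). quot_map V ?I (vec 1 (\<lambda>_. 1) \<bullet> u) = \<zero>\<^bsub>quot_ring V ?I\<^esub>}
      = (\<lambda>w. dmat 0 *\<^sub>v w) ` free_mod V (shifts 1)"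
  proof
    show "{u \<in> free_mod V (shifts 0). quot_map V ?I (vec 1 (\<lambda>_. 1) \<bullet> u) = \<zero>\<^bsub>quot_ring V ?I\<^esub>}
      \<subseteq> (\<lambda>w. dmat 0 *\<^sub>v w) ` free_mod V (shifts 1)"
    proof
      fix u assume "u \<in> {u \<in> free_mod V (shifts 0). quot_map V ?I (vec 1 (\<lambda>_. 1) \<bullet> u) = \<zero>\<^bsub>quot_ring V ?I\<^esub>}"
      then have u: "u \<in> free_mod V (shifts 0)" "vec 1 (\<lambda>_. 1) \<bullet> u \<in> ?I" unfolding zero by auto
      then have u0: "u $ 0 \<in> ?I" using eps[of u] by (simp add: free_mod_def s0)
      obtain z where z: "u = tvec 0 z" "\<And>T. z T \<in> carrier (poly_ring V)" "\<forall>T. z T \<noteq> 0 \<longrightarrow> T \<subseteq> W \<and> card T = 0"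
        using tvec_cases[OF u(1)] by blast
      have z0: "z {} \<in> ?I" using u0 z(1) by (simp add: tvec_def basis_0)
      have ne: "z T = 0" if "T \<noteq> {}" for T using z(3) finite_sub_W[of T] that by (metis card_0_eq)
      have "\<exists>w\<in>free_mod V (shifts (Suc 0)). tvec 0 z = dmat 0 *\<^sub>v w"
      proof (rule exact_at[OF z(2,3)])
        \<comment> \<open>In homological degree 0 membership in the ideal is what makes the strands
          contractible: a monomial of \<open>z {}\<close> has a dependent support, hence is
          divisible by a generator.\<close>
        have "dividing M \<noteq> {}" if s: "strand z M S \<noteq> 0" for M S
        proof -
          have "S = {}" using s by (rule contrapos_np) (simp add: strand_def ne)
          then have "M \<in> keys (z {})" using s by (simp add: strand_def U_def sqfree_def in_keys_iff)
          then have "keys M \<subseteq> V" "keys M \<notin> independent_sets V edges" using z0 by (auto simp: sr_ideal_def)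
          then show ?thesis by (auto simp: independent_sets_def dividing_def)
        qed
        then show "\<forall>M S. strand z M S \<noteq> 0 \<longrightarrow> dividing M \<noteq> {}" by blast
      next
        fix S assume "S \<subseteq> W"
        show "tay z S = 0" unfolding tay_def by (simp add: ne)
      qed
      then show "u \<in> (\<lambda>w. dmat 0 *\<^sub>v w) ` free_mod V (shifts 1)" using z(1) by auto
    qed
    show "(\<lambda>w. dmat 0 *\<^sub>v w) ` free_mod V (shifts 1)
      \<subseteq> {u \<in> free_mod V (shifts 0). quot_map V ?I (vec 1 (\<lambda>_. 1) \<bullet> u) = \<zero>\<^bsub>quot_ring V ?I\<^esub>}"
    proof (rule image_subsetI)
      fix w :: "('v, 'k) mvpoly vec" assume "w \<in> free_mod V (shifts 1)"
      then have "w \<in> free_mod V (shifts (Suc 0))" by simp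
      then obtain z where z: "w = tvec (Suc 0) z" "\<And>T. z T \<in> carrier (poly_ring V)"
        using tvec_cases by blast
      have d: "dmat 0 *\<^sub>v w = tvec 0 (tay z)" unfolding z(1) by (rule dmat_tvec)
      have "tay z {} \<in> ?I"
        unfolding tay_def
      proof (rule ideal_sum_closed[OF id])
        fix v assume v: "v \<in> W - {}"
        have "step v {} = sqfree (lab v)" by (simp add: step_def U_def sqfree_def)
        then have "single (step v {}) 1 \<in> ?I"
          using v lab_V[of v] finite_V finite_subset[of "lab v" V]
          by (auto simp: sr_ideal_def independent_sets_def)
        from ideal_poly_ringD(4)[OF id this z(2), of "insert v {}"]
        have "single (step v {}) 1 * z (insert v {}) \<in> ?I" by (simp add: mult.commute)
        then show "esign v {} * single (step v {}) 1 * z (insert v {}) \<in> ?I"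
          unfolding mult.assoc by (rule ideal_esign_mult[OF id])
      qed
      moreover have "vec 1 (\<lambda>_. 1) \<bullet> tvec 0 (tay z) = tay z {}"
        by (subst eps) (simp_all add: tvec_def basis_0)
      moreover have "tvec 0 (tay z) \<in> free_mod V (shifts 0)"
        by (rule tvec_free) (rule tay_carrier[OF _ z(2)])
      ultimately show "dmat 0 *\<^sub>v w \<in> {u \<in> free_mod V (shifts 0). quot_map V ?I (vec 1 (\<lambda>_. 1) \<bullet> u) = \<zero>\<^bsub>quot_ring V ?I\<^esub>}"
        unfolding d zero by simp
    qed
  qed
  have exact: "{u \<in> free_mod V (shifts (Suc i)). dmat i *\<^sub>v u = 0\<^sub>v (length (shifts i))}
      = (\<lambda>w. dmat (Suc i) *\<^sub>v w :: ('v, 'k) mvpoly vec) ` free_mod V (shifts (Suc (Suc i)))" for i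
  proof
    show "{u \<in> free_mod V (shifts (Suc i)). dmat i *\<^sub>v u = 0\<^sub>v (length (shifts i))}
      \<subseteq> (\<lambda>w. dmat (Suc i) *\<^sub>v w :: ('v, 'k) mvpoly vec) ` free_mod V (shifts (Suc (Suc i)))"
    proof
      fix u :: "('v, 'k) mvpoly vec"
      assume "u \<in> {u \<in> free_mod V (shifts (Suc i)). dmat i *\<^sub>v u = 0\<^sub>v (length (shifts i))}"
      then have u: "u \<in> free_mod V (shifts (Suc i))" "dmat i *\<^sub>v u = 0\<^sub>v (length (basis i))"
        by (auto simp: shifts_def)
      obtain z where z: "u = tvec (Suc i) z" "\<And>T. z T \<in> carrier (poly_ring V)" "\<forall>T. z T \<noteq> 0 \<longrightarrow> T \<subseteq> W \<and> card T = Suc i"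
        using tvec_cases[OF u(1)] by blast
      have "\<exists>w\<in>free_mod V (shifts (Suc (Suc i))). tvec (Suc i) z = dmat (Suc i) *\<^sub>v w"
      proof (rule exact_at[OF z(2,3)])
        \<comment> \<open>In positive homological degree S is nonempty, and the generators it
          indexes divide M.\<close>
        have "dividing M \<noteq> {}" if "strand z M S \<noteq> 0" for M S
        proof -
          have "z S \<noteq> 0" and sub: "U S \<subseteq> keys M" using that by (auto simp: strand_def split: if_splits)
          then have S: "S \<subseteq> W" "card S = Suc i" using z(3) by blast+
          then obtain v where "v \<in> S" by fastforce
          then show ?thesis using S(1) sub by (auto simp: dividing_def U_def)
        qed
        then show "\<forall>M S. strand z M S \<noteq> 0 \<longrightarrow> dividing M \<noteq> {}" by blast
      next
        fix S assume S: "S \<subseteq> W"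
        show "tay z S = 0"
        \<comment> \<open>The matrix equation speaks about the sets of size i; for other S every
          \<open>insert v S\<close> has the wrong size for z.\<close>
        proof (cases "card S = i")
          case True
          then have "S \<in> set (basis i)" using S basis(2) by blast
          then obtain b where b: "b < length (basis i)" "basis i ! b = S" by (metis in_set_conv_nth)
          have "tvec i (tay z) $ b = 0" using u(2) b(1) unfolding z(1) dmat_tvec by simp
          then show ?thesis using b by (simp add: tvec_def)
        next
          case False
          have "z (insert v S) = 0" if v: "v \<in> W - S" for v
          proof (rule ccontr)
            assume "z (insert v S) \<noteq> 0"
            then have "card (insert v S) = Suc i" using z(3) by blast
            then show False using False v finite_sub_W[OF S] by simp
          qed
          then show ?thesis unfolding tay_def by simp
        qed
      qed
      then show "u \<in> (\<lambda>w. dmat (Suc i) *\<^sub>v w) ` free_mod V (shifts (Suc (Suc i)))" using z(1) by auto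
    qed
    show "(\<lambda>w. dmat (Suc i) *\<^sub>v w :: ('v, 'k) mvpoly vec) ` free_mod V (shifts (Suc (Suc i)))
      \<subseteq> {u \<in> free_mod V (shifts (Suc i)). dmat i *\<^sub>v u = 0\<^sub>v (length (shifts i))}"
    proof (rule image_subsetI)
      fix w :: "('v, 'k) mvpoly vec" assume "w \<in> free_mod V (shifts (Suc (Suc i)))"
      then obtain z where z: "w = tvec (Suc (Suc i)) z" "\<And>T. z T \<in> carrier (poly_ring V)"
        using tvec_cases by blast
      have d: "dmat (Suc i) *\<^sub>v w = tvec (Suc i) (tay z)" unfolding z(1) by (rule dmat_tvec)
      have "tvec (Suc i) (tay z) \<in> free_mod V (shifts (Suc i))"
        by (rule tvec_free) (rule tay_carrier[OF _ z(2)])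
      moreover have "dmat i *\<^sub>v tvec (Suc i) (tay z) = 0\<^sub>v (length (shifts i))"
        unfolding dmat_tvec by (rule eq_vecI) (simp_all add: tvec_def shifts_def tay_tay basis_nth)
      ultimately show "dmat (Suc i) *\<^sub>v w \<in> {u \<in> free_mod V (shifts (Suc i)). dmat i *\<^sub>v u = 0\<^sub>v (length (shifts i))}"
        unfolding d by simp
    qed
  qed
  have eps_homog: "vec 1 (\<lambda>_. 1) $ b \<in> homog V (shifts 0 ! b)" if "b < length (shifts 0)" for b
    using that by (simp add: s0 homog_iff mon_degree_def)
  have dmat_homog: "dmat i $$ (b, c) \<in> homog V (shifts (Suc i) ! c - shifts i ! b)"
    if "b < length (shifts i)" "c < length (shifts (Suc i))" for i b c
    using that coef_homog[of "basis i ! b" "basis (Suc i) ! c"] basis_nth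
    by (simp add: dmat_def shifts_def)
  have dmat_carrier: "dmat i \<in> carrier_mat (length (shifts i)) (length (shifts (Suc i)))" for i
    by (simp add: dmat_def shifts_def)
  show ?thesis
    unfolding graded_free_resolution_def
    by (intro conjI allI impI surj ker0 exact eps_homog dmat_homog dmat_carrier) (simp_all add: s0)
qed

section \<open>Tor classes from the Taylor resolution\<close>

lemma single_irrelevant: "m \<noteq> 0 \<Longrightarrow> keys m \<subseteq> V \<Longrightarrow> single m 1 \<in> irrelevant_ideal V"
  by (simp add: irrelevant_ideal_eq_sr sr_ideal_def)

lemma step_nonzero:
  assumes "S \<subseteq> W" "v \<in> W" "\<not> lab v \<subseteq> U S"
  shows "step v S \<noteq> 0"
proof
  assume "step v S = 0"
  then have "sqfree (U S) = sqfree (U (insert v S))" using step_add[OF assms(1,2)] by simp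
  then have "keys (sqfree (U S)) = keys (sqfree (U (insert v S)))" by simp
  then show False using assms finite_U[of S] finite_U[of "insert v S"] by (simp add: U_insert) blast
qed

text \<open>The class is that of e_A. Dropping any element of A shrinks the lcm, so d(e_A) has
  coefficients in the irrelevant ideal. Adding any element enlarges the lcm, so a boundary has its
  coefficient at e_A in the irrelevant ideal and cannot agree with e_A modulo it.\<close>

lemma tor_nonzero_taylor:
  assumes "A \<subseteq> W" "\<And>v. v \<in> A \<Longrightarrow> \<not> lab v \<subseteq> U (A - {v})" "\<And>v. v \<in> W - A \<Longrightarrow> \<not> lab v \<subseteq> U A"
  shows "tor_nonzero V (sr_ideal V (independent_sets V edges) :: ('v, 'k::field) mvpoly set) (card A) (int (card (U A)))"
proof -
  let ?m = "irrelevant_ideal V :: ('v, 'k) mvpoly set"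
  have id: "ideal ?m (poly_ring V)"
    unfolding irrelevant_ideal_eq_sr by (rule ideal_sr) (simp add: complex_def)
  have step_m: "esign v S * single (step v S) 1 * p \<in> ?m"
    if "S \<subseteq> W" "v \<in> W" "\<not> lab v \<subseteq> U S" "p \<in> carrier (poly_ring V)" for S v and p :: "('v, 'k) mvpoly"
  proof -
    have "single (step v S) 1 \<in> ?m"
      using single_irrelevant[OF step_nonzero[OF that(1-3)]] single_step_carrier[OF that(1,2), where 'a = 'k] by simp
    from ideal_poly_ringD(4)[OF id this that(4)] have "single (step v S) 1 * p \<in> ?m" by (simp add: mult.commute)
    then show ?thesis unfolding mult.assoc by (rule ideal_esign_mult[OF id])
  qed
  let ?z = "\<lambda>T. if T = A then 1 else 0 :: ('v, 'k) mvpoly"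
  let ?u = "tvec (card A) ?z"
  have zc: "?z T \<in> carrier (poly_ring V)" for T by simp
  have "?u \<in> free_mod_piece V (shifts (card A)) (int (card (U A)))"
    unfolding free_mod_piece_def
    by (auto simp: tvec_def shifts_def homog_iff mon_degree_def)
  moreover have "case card A of 0 \<Rightarrow> True | Suc l \<Rightarrow> dmat l *\<^sub>v ?u \<in> free_mod_irr V (shifts l)"
  proof (cases "card A")
    case (Suc l)
    have "tay ?z S \<in> ?m" if S: "S \<subseteq> W" for S
      unfolding tay_def
    proof (rule ideal_sum_closed[OF id])
      fix v assume v: "v \<in> W - S"
      show "esign v S * single (step v S) 1 * ?z (insert v S) \<in> ?m"
      proof (cases "insert v S = A")
        case True
        then have "S = A - {v}" "v \<in> A" using v by auto
        then have "\<not> lab v \<subseteq> U S" using assms(2) by blast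
        then show ?thesis using step_m[OF S _ _ zc] v by blast
      next
        case False
        then show ?thesis using ideal_poly_ringD(2)[OF id] by simp
      qed
    qed
    then have "tvec l (tay ?z) \<in> free_mod_irr V (shifts l)"
      using basis_nth by (auto simp: free_mod_irr_def tvec_def shifts_def)
    then show ?thesis using Suc dmat_tvec[of l ?z] by simp
  qed simp
  moreover have "\<not> (\<exists>w\<in>free_mod V (shifts (Suc (card A))). ?u - dmat (card A) *\<^sub>v w \<in> free_mod_irr V (shifts (card A)))"
  proof
    assume "\<exists>w\<in>free_mod V (shifts (Suc (card A))). ?u - dmat (card A) *\<^sub>v w \<in> free_mod_irr V (shifts (card A))"
    then obtain w where w: "w \<in> free_mod V (shifts (Suc (card A)))" "?u - dmat (card A) *\<^sub>v w \<in> free_mod_irr V (shifts (card A))" by blast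
    obtain z where z: "w = tvec (Suc (card A)) z" "\<And>T. z T \<in> carrier (poly_ring V)"
      using tvec_cases[OF w(1)] by blast
    have "A \<in> set (basis (card A))" using assms(1) basis(2) by blast
    then obtain b where b: "b < length (basis (card A))" "basis (card A) ! b = A" by (metis in_set_conv_nth)
    have "(?u - tvec (card A) (tay z)) $ b \<in> ?m"
      using w(2) b(1) unfolding z(1) dmat_tvec free_mod_irr_def by (simp add: shifts_def)
    then have "1 - tay z A \<in> ?m" using b by (simp add: tvec_def)
    moreover have "tay z A \<in> ?m"
      unfolding tay_def
    proof (rule ideal_sum_closed[OF id])
      fix v assume "v \<in> W - A"
      then show "esign v A * single (step v A) 1 * z (insert v A) \<in> ?m"
        using step_m[OF assms(1) _ assms(3) z(2)] by blast
    qed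
    ultimately have "1 - tay z A + tay z A \<in> ?m" by (rule ideal_poly_ringD(3)[OF id])
    then show False by (simp add: irrelevant_ideal_eq_sr sr_ideal_def)
  qed
  ultimately show ?thesis unfolding tor_nonzero_def using taylor_resolution[where 'k = 'k] by blast
qed

end

section \<open>Disjoint unions of complete multipartite graphs\<close>

text \<open>Disjointness makes every edge of M essential for the union, and inducedness says that no
  further edge lies inside the union; these are the two conditions of
  \<open>tor_nonzero_taylor\<close>. The union has two vertices per edge.\<close>

lemma tor_nonzero_induced_matching:
  fixes V :: "'v set"
  assumes "fin_simple_graph V E" "M \<subseteq> E"
    and "\<And>f g. f \<in> M \<Longrightarrow> g \<in> M \<Longrightarrow> f \<noteq> g \<Longrightarrow> f \<inter> g = {}"
    and "\<And>f. f \<in> E \<Longrightarrow> f \<subseteq> \<Union> M \<Longrightarrow> f \<in> M"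
  shows "tor_nonzero V (edge_ideal V E :: ('v, 'k::field) mvpoly set) (card M) (int (2 * card M))"
proof -
  have finV: "finite V" and edge: "\<And>f. f \<in> E \<Longrightarrow> f \<subseteq> V \<and> card f = 2"
    using assms(1) by (auto simp: fin_simple_graph_def)
  have "finite E" by (rule finite_subset[of _ "Pow V"]) (use edge finV in auto)
  from finite_distinct_list[OF this] obtain es where es: "set es = E" "distinct es" by blast
  \<comment> \<open>Edges are indexed by their positions in a list because the Taylor signs need a
    linear order on the index type.\<close>
  let ?W = "{0..<length es}" and ?lab = "\<lambda>k. es ! k"
  have img: "?lab ` ?W = E" using es(1) by (metis image_set map_nth set_upt)
  have inj: "inj_on ?lab ?W" using es(2) by (simp add: inj_on_nth)
  interpret taylor V ?W ?lab
  proof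
    fix v assume "v \<in> ?W"
    then have "es ! v \<in> E" using es(1) by auto
    then show "es ! v \<subseteq> V" using edge by blast
  qed (use finV in auto)
  define A where "A = {k\<in>?W. es ! k \<in> M}"
  have A: "A \<subseteq> ?W" "?lab ` A = M" using img assms(2) by (auto simp: A_def)
  have UA: "U A = \<Union> M" unfolding U_def A(2) ..
  have cardA: "card A = card M" using card_image[OF inj_on_subset[OF inj A(1)]] A(2) by simp
  have "tor_nonzero V (sr_ideal V (independent_sets V edges) :: ('v, 'k) mvpoly set) (card A) (int (card (U A)))"
  proof (rule tor_nonzero_taylor[OF A(1)])
    fix k assume k: "k \<in> A"
    show "\<not> es ! k \<subseteq> U (A - {k})"
    proof
      assume sub: "es ! k \<subseteq> U (A - {k})"
      have kM: "es ! k \<in> M" using k by (simp add: A_def)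
      then have "card (es ! k) = 2" using edge assms(2) by blast
      then obtain x where x: "x \<in> es ! k" by fastforce
      then obtain l where l: "l \<in> A - {k}" "x \<in> es ! l" using sub by (auto simp: U_def)
      then have "es ! l \<noteq> es ! k" using inj k A(1) by (auto simp: inj_on_def)
      then show False using assms(3)[OF kM, of "es ! l"] l x by (auto simp: A_def)
    qed
  next
    fix k assume k: "k \<in> ?W - A"
    then have "es ! k \<in> E" using img by blast
    then show "\<not> es ! k \<subseteq> U A" using assms(4)[of "es ! k"] k unfolding UA by (auto simp: A_def)
  qed
  moreover have "card (U A) = 2 * card M"
  proof -
    have "card (\<Union> M) = (\<Sum>f\<in>M. card f)"
    proof (rule card_Union_disjoint)
      show "pairwise disjnt M" using assms(3) by (auto simp: pairwise_def disjnt_def)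
      show "finite f" if "f \<in> M" for f using that edge assms(2) finV finite_subset by (metis subsetD)
    qed
    also have "\<dots> = (\<Sum>f\<in>M. 2)" using edge assms(2) by (intro sum.cong refl) blast
    finally show ?thesis unfolding UA by simp
  qed
  ultimately show ?thesis unfolding cardA img edge_ideal_eq_sr[OF assms(1)] by simp
qed

text \<open>The join over the components of the disjoint unions of the simplices on the parts. The
  vertex set \<open>U\<close> is a parameter of its own because the induction on vertices shrinks it
  inside a fixed \<open>V\<close>.\<close>

definition multipartite_complex :: "('v \<Rightarrow> nat) \<Rightarrow> ('v \<Rightarrow> nat) \<Rightarrow> 'v set \<Rightarrow> 'v set set" where
  "multipartite_complex cmp part U = {F. F \<subseteq> U \<and> (\<forall>x\<in>F. \<forall>y\<in>F. cmp x = cmp y \<longrightarrow> part x = part y)}"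

lemma multipartite_complexD:
  assumes "F \<in> multipartite_complex cmp part U"
  shows "F \<subseteq> U" "x \<in> F \<Longrightarrow> y \<in> F \<Longrightarrow> cmp x = cmp y \<Longrightarrow> part x = part y"
  using assms unfolding multipartite_complex_def by blast+

definition multipartite_edges :: "('v \<Rightarrow> nat) \<Rightarrow> ('v \<Rightarrow> nat) \<Rightarrow> 'v set \<Rightarrow> 'v set set" where
  "multipartite_edges cmp part V = {{x, y} | x y. x \<in> V \<and> y \<in> V \<and> cmp x = cmp y \<and> part x \<noteq> part y}"

lemma fin_simple_graph_multipartite:
  "finite V \<Longrightarrow> fin_simple_graph V (multipartite_edges cmp part V)"
  by (auto simp: fin_simple_graph_def multipartite_edges_def card_2_iff)

lemma independent_sets_multipartite:
  "independent_sets V (multipartite_edges cmp part V) = multipartite_complex cmp part V"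
proof
  show "independent_sets V (multipartite_edges cmp part V) \<subseteq> multipartite_complex cmp part V"
  proof
    fix F assume F: "F \<in> independent_sets V (multipartite_edges cmp part V)"
    have "part x = part y" if "x \<in> F" "y \<in> F" "cmp x = cmp y" for x y
    proof (rule ccontr)
      assume "part x \<noteq> part y"
      moreover have "x \<in> V" "y \<in> V" using F that by (auto simp: independent_sets_def)
      ultimately have "{x, y} \<in> multipartite_edges cmp part V"
        using that unfolding multipartite_edges_def by blast
      then have "\<not> {x, y} \<subseteq> F" using F unfolding independent_sets_def by blast
      then show False using that by blast
    qed
    then show "F \<in> multipartite_complex cmp part V"
      using F unfolding multipartite_complex_def independent_sets_def by blast
  qed
  show "multipartite_complex cmp part V \<subseteq> independent_sets V (multipartite_edges cmp part V)"
  proof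
    fix F assume F: "F \<in> multipartite_complex cmp part V"
    have "\<not> f \<subseteq> F" if "f \<in> multipartite_edges cmp part V" for f
      using that F unfolding multipartite_edges_def multipartite_complex_def by auto
    then show "F \<in> independent_sets V (multipartite_edges cmp part V)"
      using F unfolding multipartite_complex_def independent_sets_def by blast
  qed
qed

lemma complex_multipartite: "U \<subseteq> V \<Longrightarrow> complex V (multipartite_complex cmp part U)"
  unfolding complex_def
proof (intro conjI ballI allI impI)
  fix F G assume "F \<in> multipartite_complex cmp part U" "G \<subseteq> F"
  note F = multipartite_complexD[OF this(1)]
  show "G \<in> multipartite_complex cmp part U"
    unfolding multipartite_complex_def using \<open>G \<subseteq> F\<close> F by blast
qed (auto simp: multipartite_complex_def)

lemma koszul_vanishing_mono: "koszul_vanishing V J r \<Longrightarrow> r \<le> r' \<Longrightarrow> koszul_vanishing V J r'"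
  unfolding koszul_vanishing_def by force

text \<open>The components meeting at least two parts, that is, those containing an edge. Their
  number will be the regularity.\<close>

definition edge_components :: "('v \<Rightarrow> nat) \<Rightarrow> ('v \<Rightarrow> nat) \<Rightarrow> 'v set \<Rightarrow> nat set" where
  "edge_components cmp part U = {c. \<exists>x\<in>U. \<exists>y\<in>U. cmp x = c \<and> cmp y = c \<and> part x \<noteq> part y}"

lemma finite_edge_components: "finite U \<Longrightarrow> finite (edge_components cmp part U)"
  by (rule finite_subset[of _ "cmp ` U"]) (auto simp: edge_components_def)

text \<open>Induction on the vertices. If x is in conflict with no other vertex it is a cone point
  and is removed at no cost. Otherwise the deletion has no more edge components, and the star loses
  one, which pays for the shift in \<open>koszul_vanishing_colon\<close>.\<close>

lemma koszul_vanishing_multipartite: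
  fixes V :: "'v::linorder set"
  assumes "finite V" "U \<subseteq> V"
  shows "koszul_vanishing V (sr_ideal V (multipartite_complex cmp part U) :: ('v, 'k::field) mvpoly set)
    (int (card (edge_components cmp part U)))"
proof -
  have "finite U" using assms finite_subset by metis
  then show ?thesis using assms(2)
  proof (induct U rule: finite_psubset_induct)
    case (psubset U)
    let ?\<Delta> = "multipartite_complex cmp part" and ?C = "edge_components cmp part"
    show ?case
    proof (cases "U = {}")
      case True
      have e: "?\<Delta> {} = {{}}" by (auto simp: multipartite_complex_def)
      show ?thesis unfolding True e by (rule koszul_vanishing_mono[OF koszul_vanishing_irrelevant]) simp
    next
      case False
      then obtain x where x: "x \<in> U" by blast
      have xV: "x \<in> V" using x psubset.prems by blast
      note c = complex_multipartite[OF psubset.prems, of cmp part]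
      have "deletion x (?\<Delta> U) = ?\<Delta> (U - {x})"
        by (auto simp: deletion_def multipartite_complex_def)
      moreover have "card (?C (U - {x})) \<le> card (?C U)"
        by (rule card_mono[OF finite_edge_components[OF psubset.hyps(1)]]) (auto simp: edge_components_def)
      moreover have "koszul_vanishing V (sr_ideal V (?\<Delta> (U - {x})) :: ('v, 'k) mvpoly set) (int (card (?C (U - {x}))))"
        by (rule psubset.hyps(2)) (use x psubset.prems in auto)
      ultimately have del: "koszul_vanishing V (sr_ideal V (deletion x (?\<Delta> U)) :: ('v, 'k) mvpoly set) (int (card (?C U)))"
        using koszul_vanishing_mono by fastforce
      show ?thesis
      proof (cases "\<forall>y\<in>U. cmp y = cmp x \<longrightarrow> part y = part x")
        case True
        have "star x (?\<Delta> U) = ?\<Delta> U"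
        proof
          show "star x (?\<Delta> U) \<subseteq> ?\<Delta> U"
          proof
            fix F assume "F \<in> star x (?\<Delta> U)"
            then have "insert x F \<in> ?\<Delta> U" by (simp add: star_def)
            then show "F \<in> ?\<Delta> U" by (rule complexD[OF c]) (rule subset_insertI)
          qed
          show "?\<Delta> U \<subseteq> star x (?\<Delta> U)"
          proof
            fix F assume F: "F \<in> ?\<Delta> U"
            have "F \<subseteq> U" by (rule multipartite_complexD(1)[OF F])
            have 1: "\<forall>a\<in>F. \<forall>b\<in>F. cmp a = cmp b \<longrightarrow> part a = part b"
              by (intro ballI impI) (rule multipartite_complexD(2)[OF F])
            have 2: "\<forall>a\<in>F. cmp a = cmp x \<longrightarrow> part a = part x" using \<open>F \<subseteq> U\<close> True by blast
            have "\<forall>a\<in>insert x F. \<forall>b\<in>insert x F. cmp a = cmp b \<longrightarrow> part a = part b"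
            proof (intro ballI impI)
              fix a b assume "a \<in> insert x F" "b \<in> insert x F" "cmp a = cmp b"
              then show "part a = part b" using 1 2 by (metis insertE)
            qed
            then show "F \<in> star x (?\<Delta> U)"
              using \<open>F \<subseteq> U\<close> x unfolding star_def multipartite_complex_def by blast
          qed
        qed
        then show ?thesis by (rule koszul_vanishing_cone[OF c assms(1) xV del])
      next
        case False
        then obtain y where y: "y \<in> U" "cmp y = cmp x" "part y \<noteq> part x" by blast
        \<comment> \<open>A face containing x can only use the part of x in its component. After the
          other parts are removed, the component of x carries no edge.\<close>
        let ?U = "{z\<in>U. cmp z = cmp x \<longrightarrow> part z = part x}"
        have star: "star x (?\<Delta> U) = ?\<Delta> ?U"
        proof
          show "star x (?\<Delta> U) \<subseteq> ?\<Delta> ?U"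
          proof
            fix F assume "F \<in> star x (?\<Delta> U)"
            then have F: "insert x F \<in> ?\<Delta> U" by (simp add: star_def)
            have "part z = part x" if "z \<in> F" "cmp z = cmp x" for z
              by (rule multipartite_complexD(2)[OF F]) (use that in auto)
            then show "F \<in> ?\<Delta> ?U"
              using multipartite_complexD[OF F] unfolding multipartite_complex_def by blast
          qed
          show "?\<Delta> ?U \<subseteq> star x (?\<Delta> U)"
          proof
            fix F assume F: "F \<in> ?\<Delta> ?U"
            have FU: "F \<subseteq> U" using multipartite_complexD(1)[OF F] by blast
            have 1: "\<forall>a\<in>F. \<forall>b\<in>F. cmp a = cmp b \<longrightarrow> part a = part b"
              by (intro ballI impI) (rule multipartite_complexD(2)[OF F])
            have 2: "\<forall>a\<in>F. cmp a = cmp x \<longrightarrow> part a = part x"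
              using multipartite_complexD(1)[OF F] by blast
            have "\<forall>a\<in>insert x F. \<forall>b\<in>insert x F. cmp a = cmp b \<longrightarrow> part a = part b"
            proof (intro ballI impI)
              fix a b assume "a \<in> insert x F" "b \<in> insert x F" "cmp a = cmp b"
              then show "part a = part b" using 1 2 by (metis insertE)
            qed
            then show "F \<in> star x (?\<Delta> U)"
              using FU x unfolding star_def multipartite_complex_def by blast
          qed
        qed
        have "koszul_vanishing V (sr_ideal V (?\<Delta> ?U) :: ('v, 'k) mvpoly set) (int (card (?C ?U)))"
          by (rule psubset.hyps(2)) (use y psubset.prems in auto)
        moreover have "int (card (?C ?U)) \<le> int (card (?C U)) - 1"
        proof -
          have "cmp x \<in> ?C U" using x y by (auto simp: edge_components_def)
          moreover have "?C ?U \<subseteq> ?C U - {cmp x}" by (auto simp: edge_components_def)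
          ultimately have "?C ?U \<subset> ?C U" by blast
          then have "card (?C ?U) < card (?C U)"
            by (rule psubset_card_mono[OF finite_edge_components[OF psubset.hyps(1)]])
          then show ?thesis by simp
        qed
        ultimately have "koszul_vanishing V (sr_ideal V (star x (?\<Delta> U)) :: ('v, 'k) mvpoly set) (int (card (?C U)) - 1)"
          unfolding star by (rule koszul_vanishing_mono)
        then show ?thesis by (rule koszul_vanishing_colon[OF c assms(1) xV del])
      qed
    qed
  qed
qed

text \<open>The induced matching M bounds the regularity from below and the number of edge
  components bounds it from above; the last hypothesis makes the two bounds meet.\<close>

lemma regularity_multipartite:
  fixes V :: "'v::linorder set"
  assumes "finite V"
    and "M \<subseteq> multipartite_edges cmp part V"
    and "\<And>f g. f \<in> M \<Longrightarrow> g \<in> M \<Longrightarrow> f \<noteq> g \<Longrightarrow> f \<inter> g = {}"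
    and "\<And>f. f \<in> multipartite_edges cmp part V \<Longrightarrow> f \<subseteq> \<Union> M \<Longrightarrow> f \<in> M"
    and "card (edge_components cmp part V) = card M"
  shows "regularity V (edge_ideal V (multipartite_edges cmp part V) :: ('v, 'k::field) mvpoly set) = int (card M)"
  unfolding regularity_def
proof (rule Greatest_equality)
  let ?I = "edge_ideal V (multipartite_edges cmp part V) :: ('v, 'k) mvpoly set"
  note gr = fin_simple_graph_multipartite[OF assms(1), of cmp part]
  have "tor_nonzero V ?I (card M) (int (2 * card M))"
    by (rule tor_nonzero_induced_matching[OF gr assms(2-4)])
  then show "\<exists>i. tor_nonzero V ?I i (int i + int (card M))" by (intro exI[of _ "card M"]) simp
  fix j assume "\<exists>i. tor_nonzero V ?I i (int i + j)"
  then obtain i where "tor_nonzero V ?I i (int i + j)" by blast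
  then have "tor_nonzero V (sr_ideal V (multipartite_complex cmp part V) :: ('v, 'k) mvpoly set) i (int i + j)"
    unfolding edge_ideal_eq_sr[OF gr] independent_sets_multipartite .
  from tor_nonzero_le[OF assms(1) complex_multipartite[OF subset_refl]
      koszul_vanishing_multipartite[OF assms(1) subset_refl] this]
  show "j \<le> int (card M)" using assms(5) by simp
qed

section \<open>Counting the faces of maximal size\<close>

definition block :: "('v \<Rightarrow> nat) \<Rightarrow> ('v \<Rightarrow> nat) \<Rightarrow> 'v set \<Rightarrow> nat \<Rightarrow> nat \<Rightarrow> 'v set" where
  "block cmp part V c p = {v\<in>V. cmp v = c \<and> part v = p}"

text \<open>Component 0 carries the multiplicity, through its e parts of the maximal size s. Each of
  the components 1, ..., n has part 0 as its only largest part, of size t. As \<open>s_pos\<close>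
  holds, empty parts do not count among the largest.\<close>

locale multipartite =
  fixes V :: "'v::linorder set" and cmp part :: "'v \<Rightarrow> nat" and n s t e :: nat
  assumes finite_V: "finite V" and comp_less: "\<And>v. v \<in> V \<Longrightarrow> cmp v < Suc n" and s_pos: "s \<ge> 1"
    and block0: "\<And>p. card (block cmp part V 0 p) \<le> s" "card {p. card (block cmp part V 0 p) = s} = e"
    and blocks: "\<And>c. 1 \<le> c \<Longrightarrow> c < Suc n \<Longrightarrow> card (block cmp part V c 0) = t"
      "\<And>c p. 1 \<le> c \<Longrightarrow> c < Suc n \<Longrightarrow> p \<noteq> 0 \<Longrightarrow> card (block cmp part V c p) < t"
    and e_pos: "e \<ge> 1"
begin

abbreviation B where "B \<equiv> block cmp part V"
abbreviation \<Delta> where "\<Delta> \<equiv> multipartite_complex cmp part V"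
abbreviation E where "E \<equiv> multipartite_edges cmp part V"

definition rest :: "'v set" where "rest = (\<Union>c\<in>{1..<Suc n}. B c 0)"

lemma finite_B: "finite (B c p)"
  using finite_V by (simp add: block_def)

lemma face_slice: "F \<in> \<Delta> \<Longrightarrow> \<exists>p. {v\<in>F. cmp v = c} \<subseteq> B c p"
proof (cases "{v\<in>F. cmp v = c} = {}")
  case False
  assume F: "F \<in> \<Delta>"
  obtain x where x: "x \<in> F" "cmp x = c" using False by blast
  have "{v\<in>F. cmp v = c} \<subseteq> B c (part x)"
  proof
    fix v assume v: "v \<in> {v\<in>F. cmp v = c}"
    have "v \<in> V" using multipartite_complexD(1)[OF F] v by blast
    moreover have "part v = part x" by (rule multipartite_complexD(2)[OF F]) (use v x in auto)
    ultimately show "v \<in> B c (part x)" using v by (simp add: block_def)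
  qed
  then show ?thesis ..
qed auto

lemma slice_card:
  assumes "F \<in> \<Delta>"
  shows "card {v\<in>F. cmp v = 0} \<le> s"
    and "1 \<le> c \<Longrightarrow> c < Suc n \<Longrightarrow> card {v\<in>F. cmp v = c} \<le> t"
proof -
  have le: "\<exists>p. card {v\<in>F. cmp v = c} \<le> card (B c p)" for c
    using face_slice[OF assms, of c] card_mono[OF finite_B] by blast
  show "card {v\<in>F. cmp v = 0} \<le> s" using le[of 0] block0(1) order_trans by blast
  assume "1 \<le> c" "c < Suc n"
  then have "card (B c p) \<le> t" for p using blocks[of c] by (cases "p = 0") (auto simp: less_imp_le)
  then show "card {v\<in>F. cmp v = c} \<le> t" using le[of c] order_trans by blast
qed

lemma card_face:
  assumes "F \<in> \<Delta>"
  shows "card F = card {v\<in>F. cmp v = 0} + (\<Sum>c\<in>{1..<Suc n}. card {v\<in>F. cmp v = c})"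
proof -
  have FV: "F \<subseteq> V" using assms by (simp add: multipartite_complex_def)
  have "F = (\<Union>c\<in>{0..<Suc n}. {v\<in>F. cmp v = c})" using FV comp_less by auto
  also have "card \<dots> = (\<Sum>c\<in>{0..<Suc n}. card {v\<in>F. cmp v = c})"
    using finite_subset[OF FV finite_V] by (intro card_UN_disjoint) auto
  also have "{0..<Suc n} = insert 0 {1..<Suc n}" by auto
  finally show ?thesis by simp
qed

lemma card_face_le: "F \<in> \<Delta> \<Longrightarrow> card F \<le> s + n * t"
proof -
  assume F: "F \<in> \<Delta>"
  have "(\<Sum>c\<in>{1..<Suc n}. card {v\<in>F. cmp v = c}) \<le> (\<Sum>c\<in>{1..<Suc n}. t)"
    by (rule sum_mono) (use slice_card(2)[OF F] in auto)
  then show ?thesis unfolding card_face[OF F] using slice_card(1)[OF F] by simp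
qed

lemma maximal_face: "B 0 p \<union> rest \<in> \<Delta>"
  unfolding multipartite_complex_def rest_def block_def by auto

lemma card_maximal_face:
  assumes "card (B 0 p) = s"
  shows "card (B 0 p \<union> rest) = s + n * t"
proof -
  have "card rest = (\<Sum>c\<in>{1..<Suc n}. card (B c 0))"
    unfolding rest_def using finite_B by (intro card_UN_disjoint) (auto simp: block_def)
  also have "\<dots> = (\<Sum>c\<in>{1..<Suc n}. t)" by (rule sum.cong) (use blocks in auto)
  finally have "card rest = n * t" by simp
  moreover have "finite rest" unfolding rest_def using finite_B by blast
  moreover have "B 0 p \<inter> rest = {}" by (auto simp: rest_def block_def)
  ultimately show ?thesis using finite_B assms by (simp add: card_Un_disjoint)
qed

lemma exists_maximal_face: "\<exists>F\<in>\<Delta>. card F = s + n * t"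
proof -
  have "{p. card (B 0 p) = s} \<noteq> {}" using block0(2) e_pos by fastforce
  then show ?thesis using maximal_face card_maximal_face by blast
qed

text \<open>Equality in the sum of the componentwise bounds forces equality in each component. A
  slice of maximal size fills its part, which outside component 0 can only be part 0.\<close>

lemma face_maximal_eq:
  assumes F: "F \<in> \<Delta>" "card F = s + n * t"
  shows "\<exists>p. card (B 0 p) = s \<and> F = B 0 p \<union> rest"
proof -
  have FV: "F \<subseteq> V" using assms by (simp add: multipartite_complex_def)
  let ?S = "\<lambda>c. {v\<in>F. cmp v = c}"
  have le: "(\<Sum>c\<in>{1..<Suc n}. card (?S c)) \<le> (\<Sum>c\<in>{1..<Suc n}. t)"
    by (rule sum_mono) (use slice_card(2)[OF F(1)] in auto)
  have 0: "card (?S 0) = s" and sum: "(\<Sum>c\<in>{1..<Suc n}. card (?S c)) = (\<Sum>c\<in>{1..<Suc n}. t)"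
    using le slice_card(1)[OF F(1)] card_face[OF F(1)] F(2) by simp_all
  have c: "card (?S c) = t" if "c \<in> {1..<Suc n}" for c
  proof (rule ccontr)
    assume "card (?S c) \<noteq> t"
    then have "card (?S c) < t" using slice_card(2)[OF F(1), of c] that by simp
    then have "(\<Sum>c\<in>{1..<Suc n}. card (?S c)) < (\<Sum>c\<in>{1..<Suc n}. t)"
      using that slice_card(2)[OF F(1)] by (intro sum_strict_mono_ex1) auto
    then show False using sum by simp
  qed
  obtain p where p: "?S 0 \<subseteq> B 0 p" using face_slice[OF F(1)] by blast
  have "s \<le> card (B 0 p)" using card_mono[OF finite_B p] 0 by simp
  then have cp: "card (B 0 p) = s" using block0(1)[of p] by simp
  then have S0: "?S 0 = B 0 p" using card_subset_eq[OF finite_B p] 0 by simp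
  have Sc: "?S c = B c 0" if cc: "c \<in> {1..<Suc n}" for c
  proof -
    obtain q where q: "?S c \<subseteq> B c q" using face_slice[OF F(1)] by blast
    have "t \<le> card (B c q)" using card_mono[OF finite_B q] c[OF cc] by simp
    then have "q = 0" using blocks(2)[of c q] cc by fastforce
    then show ?thesis using card_subset_eq[OF finite_B, of "?S c" c 0] q c[OF cc] blocks(1)[of c] cc by simp
  qed
  have "F = ?S 0 \<union> (\<Union>c\<in>{1..<Suc n}. ?S c)"
  proof
    show "F \<subseteq> ?S 0 \<union> (\<Union>c\<in>{1..<Suc n}. ?S c)"
    proof
      fix v assume v: "v \<in> F"
      then have "cmp v < Suc n" using FV comp_less by blast
      then show "v \<in> ?S 0 \<union> (\<Union>c\<in>{1..<Suc n}. ?S c)" using v by (cases "cmp v = 0") auto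
    qed
  qed auto
  also have "\<dots> = B 0 p \<union> rest" unfolding rest_def using S0 Sc by auto
  finally show ?thesis using cp by blast
qed

lemma card_maximal_faces: "card {F\<in>\<Delta>. card F = s + n * t} = e"
proof -
  have "{F\<in>\<Delta>. card F = s + n * t} = (\<lambda>p. B 0 p \<union> rest) ` {p. card (B 0 p) = s}"
    using face_maximal_eq maximal_face card_maximal_face by blast
  moreover have "inj_on (\<lambda>p. B 0 p \<union> rest) {p. card (B 0 p) = s}"
  proof (rule inj_onI)
    fix p q assume pq: "p \<in> {p. card (B 0 p) = s}" "B 0 p \<union> rest = B 0 q \<union> rest"
    then have "B 0 p \<noteq> {}" using s_pos by auto
    then obtain v where v: "v \<in> B 0 p" by blast
    then have "v \<in> B 0 q" using pq(2) by (auto simp: rest_def block_def)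
    then show "p = q" using v by (simp add: block_def)
  qed
  ultimately show ?thesis using block0(2) by (simp add: card_image)
qed

lemma complex: "complex V \<Delta>"
  by (rule complex_multipartite) simp

lemma finite_\<Delta>: "finite \<Delta>"
  using finite_V by (intro finite_subset[of \<Delta> "Pow V"]) (auto simp: multipartite_complex_def)

lemma edge_ideal_eq: "edge_ideal V E = (sr_ideal V \<Delta> :: ('v, 'k::field) mvpoly set)"
  using edge_ideal_eq_sr[OF fin_simple_graph_multipartite[OF finite_V]] independent_sets_multipartite by metis

lemma h_poly_eq: "h_poly V (edge_ideal V E :: ('v, 'k::field) mvpoly set) = h_poly_of_complex (s + n * t) \<Delta>"
  unfolding edge_ideal_eq using exists_maximal_face h_poly_sr[OF complex finite_V card_face_le] by blast

lemma hilbert_multiplicity_eq: "hilbert_multiplicity V (edge_ideal V E :: ('v, 'k::field) mvpoly set) = int e"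
  unfolding hilbert_multiplicity_def h_poly_eq
  using poly_h_poly_of_complex_1[OF finite_\<Delta> card_face_le] card_maximal_faces by simp

lemma krull_dim_eq: "krull_dim (quot_ring V (edge_ideal V E :: ('v, 'k::field) mvpoly set)) = enat (s + n * t)"
  unfolding edge_ideal_eq using exists_maximal_face krull_dim_sr[OF complex finite_V card_face_le] by blast

end

lemma sum_alternating_Pow:
  assumes "finite B" "B \<noteq> {}"
  shows "(\<Sum>F\<in>Pow B. (- 1) ^ card F) = (0::int)"
proof -
  obtain b where b: "b \<in> B" using assms(2) by blast
  define C where "C = B - {b}"
  have C: "B = insert b C" "b \<notin> C" "finite C" using b assms(1) by (auto simp: C_def)
  have "(\<Sum>F\<in>Pow B. (- 1) ^ card F) = (\<Sum>F\<in>Pow C. (- 1) ^ card F) + (\<Sum>F\<in>insert b ` Pow C. (- 1) ^ card F :: int)"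
    unfolding C(1) Pow_insert using C by (intro sum.union_disjoint) auto
  also have "(\<Sum>F\<in>insert b ` Pow C. (- 1) ^ card F) = (\<Sum>F\<in>Pow C. - ((- 1) ^ card F) :: int)"
  proof (subst sum.reindex)
    show "inj_on (insert b) (Pow C)" using C(2) by (auto simp: inj_on_def insert_ident)
    show "sum ((\<lambda>F. (- 1) ^ card F) \<circ> insert b) (Pow C) = (\<Sum>F\<in>Pow C. - ((- 1) ^ card F) :: int)"
    proof (rule sum.cong[OF refl])
      fix F assume "F \<in> Pow C"
      then have "b \<notin> F" "finite F" using C finite_subset by auto
      then show "((\<lambda>F. (- 1) ^ card F) \<circ> insert b) F = (- ((- 1) ^ card F) :: int)" by simp
    qed
  qed
  finally show ?thesis by (simp add: sum_negf)
qed

text \<open>With a single component the faces are those of disjoint simplices sharing just the empty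
  face. The alternating sum over a nonempty simplex is 0, so its nonempty faces contribute -1, and
  the empty face contributes 1.\<close>

lemma (in multipartite) sum_alternating_faces:
  assumes "n = 0" "finite P" "\<And>p. B 0 p \<noteq> {} \<longleftrightarrow> p \<in> P"
  shows "(\<Sum>F\<in>\<Delta>. (- 1) ^ (s - card F)) = (- 1) ^ s * (1 - int (card P))"
proof -
  let ?N = "\<lambda>p. Pow (B 0 p) - {{}}"
  have D: "\<Delta> = insert {} (\<Union>p\<in>P. ?N p)"
  proof
    show "\<Delta> \<subseteq> insert {} (\<Union>p\<in>P. ?N p)"
    proof
      fix F assume F: "F \<in> \<Delta>"
      obtain p where "{v\<in>F. cmp v = 0} \<subseteq> B 0 p" using face_slice[OF F] by blast
      moreover have "{v\<in>F. cmp v = 0} = F"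
        using multipartite_complexD(1)[OF F] comp_less assms(1) by auto
      ultimately have "F \<subseteq> B 0 p" by simp
      then show "F \<in> insert {} (\<Union>p\<in>P. ?N p)" using assms(3)[of p] by (cases "F = {}") auto
    qed
    show "insert {} (\<Union>p\<in>P. ?N p) \<subseteq> \<Delta>"
    proof
      fix F assume "F \<in> insert {} (\<Union>p\<in>P. ?N p)"
      then obtain p where "F \<subseteq> B 0 p" by auto
      then show "F \<in> \<Delta>" using complexD[OF complex maximal_face] by blast
    qed
  qed
  have 1: "(\<Sum>F\<in>?N p. (- 1) ^ card F) = (- 1 :: int)" if "p \<in> P" for p
  proof -
    have "(\<Sum>F\<in>?N p. (- 1) ^ card F) = (\<Sum>F\<in>Pow (B 0 p). (- 1) ^ card F) - (- 1 :: int) ^ card ({} :: 'v set)"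
      by (subst sum_diff1) (simp_all add: finite_B)
    then show ?thesis using sum_alternating_Pow[OF finite_B] assms(3) that by simp
  qed
  have "(\<Sum>F\<in>\<Delta>. (- 1) ^ card F) = (1::int) + (\<Sum>F\<in>(\<Union>p\<in>P. ?N p). (- 1) ^ card F)"
    unfolding D using assms(2) finite_B by (subst sum.insert) auto
  also have "(\<Sum>F\<in>(\<Union>p\<in>P. ?N p). (- 1) ^ card F) = (\<Sum>p\<in>P. \<Sum>F\<in>?N p. (- 1 :: int) ^ card F)"
  proof (rule sum.UNION_disjoint)
    show "\<forall>p\<in>P. \<forall>q\<in>P. p \<noteq> q \<longrightarrow> ?N p \<inter> ?N q = {}"
    proof (intro ballI impI)
      fix p q :: nat assume "p \<noteq> q"
      then have "B 0 p \<inter> B 0 q = {}" by (auto simp: block_def)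
      then show "?N p \<inter> ?N q = {}" by blast
    qed
  qed (use assms(2) finite_B in auto)
  also have "\<dots> = - int (card P)" using 1 by simp
  finally have S: "(\<Sum>F\<in>\<Delta>. (- 1) ^ card F) = 1 - int (card P)" by simp
  have "(\<Sum>F\<in>\<Delta>. (- 1) ^ (s - card F)) = (\<Sum>F\<in>\<Delta>. (- 1) ^ s * (- 1) ^ card F :: int)"
  proof (rule sum.cong[OF refl])
    fix F assume F: "F \<in> \<Delta>"
    have "card F \<le> s" using card_face_le[OF F] assms(1) by simp
    then have "(- 1 :: int) ^ s = (- 1) ^ (s - card F) * (- 1) ^ card F" by (simp flip: power_add)
    moreover have "(- 1 :: int) ^ card F * (- 1) ^ card F = 1" by (simp flip: power_add power_mult_distrib)
    ultimately show "(- 1) ^ (s - card F) = (- 1) ^ s * (- 1 :: int) ^ card F" by (simp add: mult.assoc)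
  qed
  then show ?thesis using S by (simp flip: sum_distrib_left)
qed

section \<open>A regular sequence as long as the dimension\<close>

lemma sum_pvar_nzd:
  fixes g :: "('v, 'k::field) mvpoly"
  assumes "finite X" "X \<noteq> {}" "X \<subseteq> V" "g \<in> carrier (poly_ring V)"
    and "(\<Sum>x\<in>X. pvar x) * g \<in> sr_ideal V (insert {} ((\<lambda>x. {x}) ` X))"
  shows "g \<in> sr_ideal V (insert {} ((\<lambda>x. {x}) ` X))"
proof -
  have "keys m \<notin> insert {} ((\<lambda>x. {x}) ` X)" if m: "m \<in> keys g" for m
  proof
    assume "keys m \<in> insert {} ((\<lambda>x. {x}) ` X)"
    \<comment> \<open>For the constant monomial any x in X will do. Multiplying by x stays on the
      face {x}, and no other variable of X divides the product, so its coefficient in the product is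
      that of m in g. Hence one linear form suffices over every field.\<close>
    then obtain x where x: "x \<in> X" "keys m \<subseteq> {x}" using assms(2) by auto
    let ?m = "single x 1 + m"
    have km: "keys ?m = {x}" using x by (auto simp: keys_add_nat)
    have "lookup ((\<Sum>x\<in>X. pvar x) * g) ?m = (\<Sum>y\<in>X. lookup (pvar y * g) ?m)"
      by (simp add: sum_distrib_right lookup_sum)
    also have "\<dots> = (\<Sum>y\<in>X. if y = x then lookup g m else 0)"
    proof (rule sum.cong[OF refl])
      fix y
      show "lookup (pvar y * g) ?m = (if y = x then lookup g m else 0)"
      proof (cases "y = x")
        case True
        then show ?thesis using lookup_single_mult_add[of "single x 1" 1 g m] by (simp add: pvar_def)
      next
        case False
        have "?m \<noteq> single y 1 + k" for k :: "'v \<Rightarrow>\<^sub>0 nat"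
        proof
          assume "?m = single y 1 + k"
          then have "y \<in> keys ?m" by (simp add: keys_add_nat)
          then show False using km False by blast
        qed
        then show ?thesis using False lookup_single_mult_not[of ?m "single y 1" 1 g] by (simp add: pvar_def)
      qed
    qed
    also have "\<dots> = lookup g m" using x(1) assms(1) by simp
    finally have "?m \<in> keys ((\<Sum>x\<in>X. pvar x) * g)" using m by (simp add: in_keys_iff)
    then have "keys ?m \<notin> insert {} ((\<lambda>x. {x}) ` X)" using assms(5) unfolding sr_ideal_def by blast
    then show False unfolding km using x(1) by blast
  qed
  then show ?thesis using assms(4) by (simp add: sr_ideal_def)
qed

text \<open>A cone point has a variable that is a nonzerodivisor, because its colon ideal is the
  ideal itself, and it remains a cone point when other cone points are removed. After all of
  \<open>ys\<close> are gone only isolated points of the complex are left, and the sum of their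
  variables is a nonzerodivisor by \<open>sum_pvar_nzd\<close>.\<close>

lemma depth_sr_ge:
  assumes "complex V \<Delta>" "finite V" "distinct ys" "set ys \<subseteq> V" "\<And>y. y \<in> set ys \<Longrightarrow> star y \<Delta> = \<Delta>"
    and "X \<noteq> {}" "X \<subseteq> V" "{F\<in>\<Delta>. F \<inter> set ys = {}} = insert {} ((\<lambda>x. {x}) ` X)"
  shows "enat (Suc (length ys)) \<le> depth_quot V (sr_ideal V \<Delta> :: ('v, 'k::field) mvpoly set)"
proof -
  let ?I = "sr_ideal V \<Delta> :: ('v, 'k) mvpoly set" and ?R = "poly_ring V :: ('v, 'k) mvpoly ring"
  let ?f = "\<Sum>x\<in>X. pvar x :: ('v, 'k) mvpoly"
  let ?fs = "map pvar ys @ [?f]"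
  let ?m = "irrelevant_ideal V :: ('v, 'k) mvpoly set"
  have finX: "finite X" using assms(2,7) finite_subset by blast
  have idm: "ideal ?m ?R" unfolding irrelevant_ideal_eq_sr by (rule ideal_sr) (simp add: complex_def)
  have pm: "pvar v \<in> ?m" if "v \<in> V" for v
    using that by (simp add: irrelevant_ideal_eq_sr sr_ideal_def pvar_def del: keys_eq_empty)
  have fm: "set ?fs \<subseteq> ?m" using assms(4,7) pm ideal_sum_closed[OF idm, of X pvar] by auto
  have mcar: "?m \<subseteq> carrier ?R" by (rule ideal_poly_ringD(1)[OF idm])
  have J: "genideal ?R (?I \<union> pvar ` Y) = sr_ideal V {F\<in>\<Delta>. F \<inter> Y = {}}" if "Y \<subseteq> V" for Y
    by (rule genideal_sr_vars[OF assms(1) that])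
  have "regular_sequence_quot ?R ?I ?fs"
    unfolding regular_sequence_quot_def
  proof (intro conjI allI impI ballI)
    show "set ?fs \<subseteq> carrier ?R" using fm mcar by (rule order_trans)
  next
    fix i and g :: "('v, 'k) mvpoly"
    assume i: "i < length ?fs" and g: "g \<in> carrier ?R"
      and fg: "?fs ! i \<otimes>\<^bsub>?R\<^esub> g \<in> genideal ?R (?I \<union> set (take i ?fs))"
    show "g \<in> genideal ?R (?I \<union> set (take i ?fs))"
    proof (cases "i < length ys")
      case True
      let ?Y = "set (take i ys)" and ?y = "ys ! i"
      have YV: "?Y \<subseteq> V" using set_take_subset[of i ys] assms(4) by blast
      have t: "set (take i ?fs) = pvar ` ?Y" using True by (simp add: take_map)
      have yV: "?y \<in> V" using True assms(4) by auto
      have yY: "?y \<notin> ?Y" using True assms(3) by (auto simp: in_set_conv_nth nth_eq_iff_index_eq)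
      have st: "insert ?y F \<in> \<Delta> \<longleftrightarrow> F \<in> \<Delta>" for F
        using assms(5)[of ?y] True unfolding star_def by (metis (no_types, lifting) mem_Collect_eq nth_mem)
      have "star ?y {F\<in>\<Delta>. F \<inter> ?Y = {}} = {F\<in>\<Delta>. F \<inter> ?Y = {}}"
        unfolding star_def using st yY by simp
      moreover have "pvar ?y * g \<in> sr_ideal V {F\<in>\<Delta>. F \<inter> ?Y = {}}"
        using fg True unfolding t J[OF YV] by (simp add: nth_append)
      ultimately show ?thesis unfolding t J[OF YV] using pvar_mult_sr_iff[OF yV g] by metis
    next
      case False
      then have "i = length ys" using i by simp
      then have t: "set (take i ?fs) = pvar ` set ys" and "?fs ! i = ?f" by (simp_all add: nth_append)
      then have "?f * g \<in> sr_ideal V (insert {} ((\<lambda>x. {x}) ` X))"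
        using fg unfolding t J[OF assms(4)] assms(8) by simp
      then show ?thesis unfolding t J[OF assms(4)] assms(8)
        by (rule sum_pvar_nzd[OF finX assms(6,7) g])
    qed
  next
    have "{} \<in> \<Delta>" using assms(8) by blast
    then have "?I \<subseteq> ?m" unfolding irrelevant_ideal_eq_sr sr_ideal_def by auto
    then have "genideal ?R (?I \<union> set ?fs) \<subseteq> ?m"
      using fm by (intro genideal_minimal_poly[OF idm]) blast
    moreover have "1 \<notin> ?m" by (simp add: irrelevant_ideal_eq_sr sr_ideal_def)
    moreover have "1 \<in> carrier ?R" by simp
    ultimately show "genideal ?R (?I \<union> set ?fs) \<noteq> carrier ?R" by blast
  qed
  then show ?thesis
    unfolding depth_quot_def using fm by (intro Sup_upper CollectI exI[of _ ?fs]) simp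
qed

text \<open>The vertex \<open>(c, p, k)\<close> is the \<open>k\<close>-th vertex in part \<open>p\<close> of component \<open>c\<close>.\<close>

definition code :: "nat \<Rightarrow> nat \<Rightarrow> nat \<Rightarrow> nat" where
  "code c p k = prod_encode (c, prod_encode (p, k))"

definition comp_of :: "nat \<Rightarrow> nat" where
  "comp_of v = fst (prod_decode v)"

definition part_of :: "nat \<Rightarrow> nat" where
  "part_of v = fst (prod_decode (snd (prod_decode v)))"

lemma code_simps [simp]: "comp_of (code c p k) = c" "part_of (code c p k) = p"
  "code c p k = code c' p' k' \<longleftrightarrow> c = c' \<and> p = p' \<and> k = k'"
  by (auto simp: code_def comp_of_def part_of_def)

definition vertices :: "nat \<Rightarrow> nat \<Rightarrow> (nat \<Rightarrow> nat \<Rightarrow> nat) \<Rightarrow> nat set" where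
  "vertices n m sz = (\<lambda>(c, p, k). code c p k) ` (SIGMA c:{..<n}. SIGMA p:{..<m}. {..<sz c p})"

lemma vertices_iff: "v \<in> vertices n m sz \<longleftrightarrow> (\<exists>c p k. v = code c p k \<and> c < n \<and> p < m \<and> k < sz c p)"
  by (force simp: vertices_def)

lemma finite_vertices: "finite (vertices n m sz)"
  unfolding vertices_def by (intro finite_imageI finite_SigmaI) auto

lemma block_vertices:
  "block comp_of part_of (vertices n m sz) c p = (if c < n \<and> p < m then code c p ` {..<sz c p} else {})"
  by (auto simp: block_def vertices_iff)

lemma card_block_vertices:
  "card (block comp_of part_of (vertices n m sz) c p) = (if c < n \<and> p < m then sz c p else 0)"
  by (auto simp: block_vertices card_image inj_on_def)

lemma multipartite_vertices:
  assumes "1 \<le> s" "1 \<le> e" "0 < m" "1 \<le> t" "\<And>p. p < m \<Longrightarrow> sz 0 p \<le> s" "card {p. p < m \<and> sz 0 p = s} = e"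
    and "\<And>c. 1 \<le> c \<Longrightarrow> sz c 0 = t" "\<And>c p. 1 \<le> c \<Longrightarrow> p \<noteq> 0 \<Longrightarrow> sz c p < t"
  shows "multipartite (vertices (Suc n) m sz) comp_of part_of n s t e"
proof
  have "{p. card (block comp_of part_of (vertices (Suc n) m sz) 0 p) = s} = {p. p < m \<and> sz 0 p = s}"
    using assms(1) by (auto simp: card_block_vertices)
  then show "card {p. card (block comp_of part_of (vertices (Suc n) m sz) 0 p) = s} = e" using assms(6) by simp
qed (use assms in \<open>auto simp: card_block_vertices finite_vertices vertices_iff\<close>)

section \<open>The three families of graphs\<close>

lemma exists_multiplicity_regularity:
  assumes "1 \<le> e" "1 \<le> r"
  shows "\<exists>(V :: nat set) E. fin_simple_graph V E \<and>
    hilbert_multiplicity V (edge_ideal V E :: (nat, 'k::field) mvpoly set) = int e \<and>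
    regularity V (edge_ideal V E :: (nat, 'k) mvpoly set) = int r"
proof -
  \<comment> \<open>Part e is a singleton in every component. Component 0 has in addition e parts of
    size 2, and each further component has part 0 of size 2, which makes it a copy of
    K_{1,2}.\<close>
  define sz :: "nat \<Rightarrow> nat \<Rightarrow> nat" where "sz = (\<lambda>c p. if p = e then 1 else if c = 0 \<or> p = 0 then 2 else 0)"
  define V where "V = vertices r (Suc e) sz"
  \<comment> \<open>One edge per component, between part 0 and the singleton part. Distinct
    components are not joined, so these edges form an induced matching.\<close>
  define edge where "edge = (\<lambda>c. {code c 0 0, code c e 0})"
  let ?M = "edge ` {..<r}"
  let ?E = "multipartite_edges comp_of part_of V"
  have e0: "e \<noteq> 0" using assms(1) by simp
  have "{p. p < Suc e \<and> sz 0 p = 2} = {..<e}" by (auto simp: sz_def less_Suc_eq)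
  then have "multipartite (vertices (Suc (r - 1)) (Suc e) sz) comp_of part_of (r - 1) 2 2 e"
    using assms by (intro multipartite_vertices) (auto simp: sz_def)
  then interpret multipartite V comp_of part_of "r - 1" 2 2 e
    using assms(2) by (simp add: V_def)
  have inV: "code c 0 0 \<in> V" "code c e 0 \<in> V" if "c < r" for c
    using that e0 by (auto simp: V_def vertices_iff sz_def)
  have injM: "inj_on edge {..<r}"
    by (auto simp: inj_on_def edge_def doubleton_eq_iff)
  have ME: "?M \<subseteq> ?E"
  proof (rule image_subsetI)
    fix c assume "c \<in> {..<r}"
    then have "code c 0 0 \<in> V \<and> code c e 0 \<in> V \<and> comp_of (code c 0 0) = comp_of (code c e 0) \<and>
        part_of (code c 0 0) \<noteq> part_of (code c e 0)" using inV e0 by simp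
    then show "edge c \<in> ?E" unfolding edge_def multipartite_edges_def by blast
  qed
  have disj: "f \<inter> g = {}" if "f \<in> ?M" "g \<in> ?M" "f \<noteq> g" for f g
    using that by (auto simp: edge_def)
  have induced: "f \<in> ?M" if f: "f \<in> ?E" "f \<subseteq> \<Union> ?M" for f
  proof -
    obtain x y where xy: "f = {x, y}" "comp_of x = comp_of y" "part_of x \<noteq> part_of y"
      using f(1) unfolding multipartite_edges_def by blast
    have "x \<in> \<Union> ?M" "y \<in> \<Union> ?M" using f(2) xy(1) by auto
    then obtain c c' where c: "c < r" "x \<in> edge c" "c' < r" "y \<in> edge c'" by blast
    then have "c' = c" using xy(2) by (auto simp: edge_def)
    then have "f = edge c" using c xy by (auto simp: edge_def)
    then show ?thesis using c(1) by blast
  qed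
  have "edge_components comp_of part_of V = {..<r}"
  proof
    show "edge_components comp_of part_of V \<subseteq> {..<r}"
      by (auto simp: edge_components_def V_def vertices_iff)
    show "{..<r} \<subseteq> edge_components comp_of part_of V"
    proof
      fix c assume "c \<in> {..<r}"
      then have "code c 0 0 \<in> V" "code c e 0 \<in> V" using inV by auto
      then show "c \<in> edge_components comp_of part_of V"
        unfolding edge_components_def using e0
        by (intro CollectI bexI[of _ "code c 0 0"] bexI[of _ "code c e 0"]) auto
    qed
  qed
  then have "card (edge_components comp_of part_of V) = card ?M" using injM by (simp add: card_image)
  from regularity_multipartite[OF finite_V ME disj induced this]
  have "regularity V (edge_ideal V ?E :: (nat, 'k) mvpoly set) = int r"
    using injM by (simp add: card_image)
  then show ?thesis
    using fin_simple_graph_multipartite[OF finite_V] hilbert_multiplicity_eq[where 'k = 'k] by blast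
qed

lemma exists_multiplicity_degree:
  assumes "1 \<le> e" "1 \<le> s" "2 \<le> e * s"
  shows "\<exists>(V :: nat set) E. fin_simple_graph V E \<and>
    hilbert_multiplicity V (edge_ideal V E :: (nat, 'k::field) mvpoly set) = int e \<and>
    Polynomial.degree (h_poly V (edge_ideal V E :: (nat, 'k) mvpoly set)) = s"
proof -
  \<comment> \<open>The alternating sum is \<open>(- 1) ^ s * (1 - int m)\<close>, so at least two
    parts are needed. The extra singleton is smaller than the other parts only for s > 1; for s = 1
    the assumption \<open>2 \<le> e * s\<close> already gives e >= 2.\<close>
  define m where "m = (if s = 1 then e else Suc e)"
  define sz :: "nat \<Rightarrow> nat \<Rightarrow> nat" where "sz = (\<lambda>c p. if c = 0 then if p < e then s else 1 else if p = 0 then 1 else 0)"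
  define V where "V = vertices (Suc 0) m sz"
  have m2: "2 \<le> m" using assms by (auto simp: m_def)
  have "{p. p < m \<and> sz 0 p = s} = {..<e}"
    using assms by (auto simp: sz_def m_def split: if_splits)
  then interpret multipartite V comp_of part_of 0 s 1 e
    unfolding V_def using assms m2 by (intro multipartite_vertices) (auto simp: sz_def)
  have "B 0 p \<noteq> {} \<longleftrightarrow> p \<in> {..<m}" for p
    using assms(2) by (auto simp: V_def block_vertices sz_def lessThan_empty_iff)
  then have "(\<Sum>F\<in>\<Delta>. (- 1) ^ (s - card F)) = (- 1) ^ s * (1 - int m)"
    using sum_alternating_faces[of "{..<m}"] by simp
  then have "(\<Sum>F\<in>\<Delta>. (- 1) ^ (s - card F)) \<noteq> (0 :: int)" using m2 by simp
  then have "Polynomial.degree (h_poly_of_complex s \<Delta>) = s"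
    using card_face_le by (intro degree_h_poly_of_complex finite_\<Delta>) auto
  then have "Polynomial.degree (h_poly V (edge_ideal V E :: (nat, 'k) mvpoly set)) = s"
    unfolding h_poly_eq by simp
  then show ?thesis
    using fin_simple_graph_multipartite[OF finite_V] hilbert_multiplicity_eq[where 'k = 'k] by blast
qed

text \<open>K_e with d - 1 isolated vertices. Independent sets contain at most one vertex of K_e,
  which gives dimension d and e largest faces; the regular sequence shows that the depth reaches the
  dimension.\<close>

lemma exists_multiplicity_depth_dim:
  assumes "1 \<le> e" "1 \<le> d"
  shows "\<exists>(V :: nat set) E. fin_simple_graph V E \<and>
    hilbert_multiplicity V (edge_ideal V E :: (nat, 'k::field) mvpoly set) = int e \<and>
    depth_quot V (edge_ideal V E :: (nat, 'k) mvpoly set) = enat d \<and>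
    krull_dim (quot_ring V (edge_ideal V E :: (nat, 'k) mvpoly set)) = enat d"
proof -
  define sz :: "nat \<Rightarrow> nat \<Rightarrow> nat" where "sz = (\<lambda>c p. if c = 0 \<or> p = 0 then 1 else 0)"
  define V where "V = vertices d e sz"
  have "{p. p < e \<and> sz 0 p = 1} = {..<e}" by (auto simp: sz_def)
  then have "multipartite (vertices (Suc (d - 1)) e sz) comp_of part_of (d - 1) 1 1 e"
    using assms by (intro multipartite_vertices) (auto simp: sz_def)
  then interpret multipartite V comp_of part_of "d - 1" 1 1 e
    using assms(2) by (simp add: V_def)
  have d: "1 + (d - 1) * 1 = d" using assms(2) by simp
  \<comment> \<open>The isolated vertices, one for each component from 1 on, and the vertices of K_e
    in component 0.\<close>
  let ?ys = "map (\<lambda>c. code c 0 0) [1..<d]" and ?X = "(\<lambda>p. code 0 p 0) ` {..<e}"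
  have V: "v \<in> V \<longleftrightarrow> v \<in> ?X \<or> v \<in> set ?ys" for v
  proof -
    have "k < sz c p \<longleftrightarrow> k = 0 \<and> (c = 0 \<or> p = 0)" for c p k by (simp add: sz_def)
    then have "v \<in> V \<longleftrightarrow> (\<exists>c p. v = code c p 0 \<and> c < d \<and> p < e \<and> (c = 0 \<or> p = 0))"
      unfolding V_def vertices_iff by metis
    also have "\<dots> \<longleftrightarrow> (\<exists>p<e. v = code 0 p 0) \<or> (\<exists>c\<in>{1..<d}. v = code c 0 0)"
    proof
      assume "\<exists>c p. v = code c p 0 \<and> c < d \<and> p < e \<and> (c = 0 \<or> p = 0)"
      then obtain c p where "v = code c p 0" "c < d" "p < e" "c = 0 \<or> p = 0" by blast
      then show "(\<exists>p<e. v = code 0 p 0) \<or> (\<exists>c\<in>{1..<d}. v = code c 0 0)" by (cases "c = 0") auto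
    next
      assume "(\<exists>p<e. v = code 0 p 0) \<or> (\<exists>c\<in>{1..<d}. v = code c 0 0)"
      then show "\<exists>c p. v = code c p 0 \<and> c < d \<and> p < e \<and> (c = 0 \<or> p = 0)"
      proof
        assume "\<exists>p<e. v = code 0 p 0"
        then obtain p where "p < e" "v = code 0 p 0" by blast
        then show ?thesis using assms(2) by - (rule exI[of _ 0], rule exI[of _ p], simp)
      next
        assume "\<exists>c\<in>{1..<d}. v = code c 0 0"
        then obtain c where "c \<in> {1..<d}" "v = code c 0 0" by blast
        then show ?thesis using assms(1) by (intro exI[of _ c] exI[of _ 0]) auto
      qed
    qed
    finally show ?thesis by auto
  qed
  have iso: "star y \<Delta> = \<Delta>" if y: "y \<in> set ?ys" for y
  proof
    show "star y \<Delta> \<subseteq> \<Delta>" unfolding star_def using complexD[OF complex] by blast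
    show "\<Delta> \<subseteq> star y \<Delta>"
    proof
      fix F assume F: "F \<in> \<Delta>"
      have yV: "y \<in> V" using V y by blast
      \<comment> \<open>An isolated vertex is alone in its component, so it can be added to any face
        without conflict.\<close>
      have y1: "v = y" if "v \<in> V" "comp_of v = comp_of y" for v
        using that y V[of v] by auto
      have "insert y F \<in> \<Delta>"
        unfolding multipartite_complex_def
      proof (intro CollectI conjI ballI impI)
        show "insert y F \<subseteq> V" using multipartite_complexD(1)[OF F] yV by blast
        fix a b assume ab: "a \<in> insert y F" "b \<in> insert y F" "comp_of a = comp_of b"
        then have "a \<in> V" "b \<in> V" using multipartite_complexD(1)[OF F] yV by auto
        then show "part_of a = part_of b"
          using ab multipartite_complexD(2)[OF F] y1 by (metis insertE)
      qed
      then show "F \<in> star y \<Delta>" by (simp add: star_def)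
    qed
  qed
  have faces: "{F\<in>\<Delta>. F \<inter> set ?ys = {}} = insert {} ((\<lambda>x. {x}) ` ?X)"
  proof
    show "{F\<in>\<Delta>. F \<inter> set ?ys = {}} \<subseteq> insert {} ((\<lambda>x. {x}) ` ?X)"
    proof
      fix F assume "F \<in> {F\<in>\<Delta>. F \<inter> set ?ys = {}}"
      then have F: "F \<in> \<Delta>" "F \<inter> set ?ys = {}" by auto
      have FX: "F \<subseteq> ?X" using multipartite_complexD(1)[OF F(1)] F(2) V by blast
      have "a = b" if "a \<in> F" "b \<in> F" for a b
      proof -
        have "a \<in> ?X" "b \<in> ?X" using FX that by auto
        then show ?thesis using multipartite_complexD(2)[OF F(1) that] by auto
      qed
      then have "F = {} \<or> (\<exists>x. F = {x})" by blast
      then show "F \<in> insert {} ((\<lambda>x. {x}) ` ?X)" using FX by auto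
    qed
    show "insert {} ((\<lambda>x. {x}) ` ?X) \<subseteq> {F\<in>\<Delta>. F \<inter> set ?ys = {}}"
      using V by (auto simp: multipartite_complex_def)
  qed
  have "enat (Suc (length ?ys)) \<le> depth_quot V (sr_ideal V \<Delta> :: (nat, 'k) mvpoly set)"
  proof (rule depth_sr_ge[OF complex finite_V _ _ iso _ _ faces])
    show "distinct ?ys" by (simp add: distinct_map inj_on_def)
    show "?X \<noteq> {}" using assms(1) by (auto simp: lessThan_empty_iff)
  qed (use V in auto)
  moreover have "Suc (length ?ys) = d" using assms(2) by simp
  moreover have "depth_quot V (sr_ideal V \<Delta> :: (nat, 'k) mvpoly set) \<le> enat d"
    using depth_sr_le[OF complex finite_V card_face_le] unfolding d .
  ultimately have "depth_quot V (edge_ideal V E :: (nat, 'k) mvpoly set) = enat d"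
    unfolding edge_ideal_eq by (metis antisym)
  moreover have "krull_dim (quot_ring V (edge_ideal V E :: (nat, 'k) mvpoly set)) = enat d"
    unfolding krull_dim_eq d ..
  ultimately show ?thesis
    using fin_simple_graph_multipartite[OF finite_V] hilbert_multiplicity_eq[where 'k = 'k] by blast
qed

theorem theorem4p11:
  fixes e r s \<delta> d :: nat
  assumes "e \<ge> 1" and "r \<ge> 1" and "s \<ge> 1" and "\<delta> \<ge> 1" and "d \<ge> 1"
  shows
    "(\<exists>(V :: nat set) E. fin_simple_graph V E \<and>
        hilbert_multiplicity V (edge_ideal V E :: (nat, 'k::field) mvpoly set) = int e \<and>
        regularity V (edge_ideal V E :: (nat, 'k) mvpoly set) = int r)
   \<and> (e * s \<ge> 2 \<longrightarrow>
      (\<exists>(V :: nat set) E. fin_simple_graph V E \<and>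
        hilbert_multiplicity V (edge_ideal V E :: (nat, 'k) mvpoly set) = int e \<and>
        Polynomial.degree (h_poly V (edge_ideal V E :: (nat, 'k) mvpoly set)) = s))
   \<and> (\<exists>(V :: nat set) E. fin_simple_graph V E \<and>
        hilbert_multiplicity V (edge_ideal V E :: (nat, 'k) mvpoly set) = int e \<and>
        depth_quot V (edge_ideal V E :: (nat, 'k) mvpoly set) = enat \<delta>)
   \<and> (e * d \<ge> 2 \<longrightarrow>
      (\<exists>(V :: nat set) E. fin_simple_graph V E \<and>
        hilbert_multiplicity V (edge_ideal V E :: (nat, 'k) mvpoly set) = int e \<and>
        krull_dim (quot_ring V (edge_ideal V E :: (nat, 'k) mvpoly set)) = enat d))"
  using exists_multiplicity_regularity[OF assms(1,2), where 'k = 'k]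
    exists_multiplicity_degree[OF assms(1,3), where 'k = 'k]
    exists_multiplicity_depth_dim[OF assms(1,4), where 'k = 'k]
    exists_multiplicity_depth_dim[OF assms(1,5), where 'k = 'k]
  by blast

end
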